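(* Let $k$ be a field with $\operatorname{char} k=p>2$, and let $C/k$ be a hyperelliptic curve $Y^2=c\prod_{r\in R}(X-r)$, where $R\subset\bar k$ is a finite non-empty set and the right-hand side lies in $k[X]$. Let $G\subset\operatorname{Aut}_kC$ be a finite affine group of automorphisms, acting as $g(X)=\alpha(g)X+\beta(g)$, $g(Y)=\gamma(g)Y$ with $\alpha(g),\beta(g),\gamma(g)\in k$, and suppose that $G$ does not contain the hyperelliptic involution. Let $q$ be a power of $p$ and let $\Phi:C\to C$ be a morphism of the form $$\Phi X=aX^q+b,\qquad \Phi Y=d\,Y^q$$ that normalises $G$, meaning $\Phi G=G\Phi$ as sets. Then $\Phi$ descends to a morphism $\Psi:C/G\to C/G$ (that is, $\pi\Phi=\Psi\pi$ for the quotient map $\pi:C\to C/G$), given by $$\Psi x=a^{|G|}x^q+\prod_{g\in G}(\alpha(g)b+\beta(g)),$$ $$\Psi y=\begin{cases} d\,y^q&\text{if }\gamma=\mathbf 1,\\ a^{\lfloor m/2\rfloor |G|/m}\,d\,y^q&\text{if }\gamma\neq\mathbf 1,\end{cases}$$ where $m$ is the prime-to-$p$ part of $|G|$, and $x,y$ are the coordinates on the model of $C/G$ described in the context.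
   Context: $C$ is the smooth projective curve with the given affine equation; genus $\le 1$ is allowed. The hyperelliptic involution is $(X,Y)\mapsto(X,-Y)$. $\gamma=\mathbf 1$ means $\gamma(g)=1$ for all $g\in G$. $G$ acts on $\bar k$ through the $X$-coordinate by $r\mapsto\alpha(g)r+\beta(g)$, preserving $R$; $R/G$ is the set of orbits. $\Phi X$, $\Psi x$, etc. denote the effect on coordinate functions. Model of $C/G$. Let $I=\prod_{g\in G}(\alpha(g)X+\beta(g))$. If $\gamma=\mathbf 1$: $x=I$, $y=Y$, and $C/G:\ y^2=c(-1)^{|R|-|R/G|}\prod_{O\in R/G}(x-\prod_{r\in O}r)$. If $\gamma\ne\mathbf 1$: let $U$ be the set of $a\in k$ that are fixed points of some non-trivial $g\in G$ acting through the $X$-coordinate; then $m=|G|/|U|$. Put $\lambda=\prod_{a\in U}a$ and $I_T=\prod_{g\in\ker\alpha}(\alpha(g)X+\beta(g))$. Then $x=I$, $y=(I_T-\lambda)^{\lfloor m/2\rfloor}Y$, and $C/G:\ y^2=c(-1)^{(m-1)(|R/G|-1)}(x-\lambda^m)\prod_{O\in R/G,\,O\ne U}(x-\prod_{r\in O}r)$. *)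

theory Defs
  imports "HOL-Algebra.Algebraic_Closure_Type" "HOL-Algebra.Bij"
    "HOL-Computational_Algebra.Computational_Algebra"
begin

section \<open>Curves \<open>Y\<^sup>2 = f(X)\<close> as smooth projective curves\<close>

text \<open>
  The smooth projective curve with affine equation \<open>Y\<^sup>2 = f(X)\<close>, where \<open>f\<close> is squarefree of
  degree \<open>n \<ge> 1\<close>, is the curve \<open>Y\<^sup>2 = Z^(2h) f(X/Z)\<close> in the weighted projective plane
  \<open>P(1,h,1)\<close> with \<open>h = \<lceil>n/2\<rceil>\<close>. It consists of the two affine charts \<open>Y\<^sup>2 = f(X)\<close> (where
  \<open>Z = 1\<close>) and \<open>V\<^sup>2 = U^(2h) f(1/U)\<close> (where \<open>X = 1\<close>), both of which are smooth.
  As usual for varieties over a field \<open>k\<close>, a curve is given by its points over the algebraic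
  closure of \<open>k\<close>, and what is defined over \<open>k\<close> is recorded by requiring coefficients in \<open>k\<close>.
  A point is represented by the set of all its weighted homogeneous coordinate vectors.
\<close>

type_synonym 'k coords = "'k alg_closure \<times> 'k alg_closure \<times> 'k alg_closure"
type_synonym 'k point = "'k coords set"
type_synonym 'k kbar_poly = "'k alg_closure Polynomial.poly"

definition wpoint ::
  "nat \<Rightarrow> 'k::field alg_closure \<Rightarrow> 'k alg_closure \<Rightarrow> 'k alg_closure \<Rightarrow> 'k point" where
  "wpoint h x y z = {(t * x, t ^ h * y, t * z) | t. t \<noteq> 0}"

definition weight :: "'k::field kbar_poly \<Rightarrow> nat" where
  "weight f = (Polynomial.degree f + 1) div 2"

definition homog :: "'k::field kbar_poly \<Rightarrow> 'k alg_closure \<Rightarrow> 'k alg_closure \<Rightarrow> 'k alg_closure" where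
  "homog f x z =
     (\<Sum>i\<le>Polynomial.degree f. Polynomial.coeff f i * x ^ i * z ^ (2 * weight f - i))"

definition curve :: "'k::field kbar_poly \<Rightarrow> 'k point set" where
  "curve f = {wpoint (weight f) x y z | x y z. (x, z) \<noteq> (0, 0) \<and> y ^ 2 = homog f x z}"

definition aff :: "'k::field kbar_poly \<Rightarrow> 'k alg_closure \<Rightarrow> 'k alg_closure \<Rightarrow> 'k point" where
  "aff f x y = wpoint (weight f) x y 1"

definition hyp_poly :: "'k::field \<Rightarrow> 'k alg_closure set \<Rightarrow> 'k kbar_poly" where
  "hyp_poly c R = Polynomial.smult (to_ac c) (\<Prod>r\<in>R. [:- r, 1:])"

text \<open>Since \<open>R\<close> is a set, the right-hand side of the equation is squarefree.\<close>

definition hyperelliptic :: "'k::field \<Rightarrow> 'k alg_closure set \<Rightarrow> bool" where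
  "hyperelliptic c R \<longleftrightarrow>
     finite R \<and> R \<noteq> {} \<and> c \<noteq> 0 \<and> hyp_poly c R \<in> range (map_poly to_ac)"

section \<open>Morphisms and rational functions over \<open>k\<close>\<close>

text \<open>
  \<open>wform h e F\<close>: \<open>F\<close> is the function given by a polynomial over \<open>k\<close> in \<open>X, Y, Z\<close> that is
  homogeneous of degree \<open>e\<close> for the weights \<open>1, h, 1\<close>. The zero form has every degree.
\<close>

inductive wform :: "nat \<Rightarrow> nat \<Rightarrow> ('k::field coords \<Rightarrow> 'k alg_closure) \<Rightarrow> bool" for h where
  x: "wform h 1 (\<lambda>(x, y, z). x)"
| y: "wform h h (\<lambda>(x, y, z). y)"
| z: "wform h 1 (\<lambda>(x, y, z). z)"
| const: "wform h 0 (\<lambda>_. to_ac a)"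
| add: "wform h e F \<Longrightarrow> wform h e F' \<Longrightarrow> wform h e (\<lambda>v. F v + F' v)"
| mult: "wform h e F \<Longrightarrow> wform h e' F' \<Longrightarrow> wform h (e + e') (\<lambda>v. F v * F' v)"

text \<open>
  A morphism over \<open>k\<close> is a map that, around every point, is given by weighted homogeneous forms
  over \<open>k\<close> of degrees \<open>e\<close>, \<open>h' e\<close>, \<open>e\<close>, where \<open>1, h', 1\<close> are the weights on the target. As the
  target satisfies \<open>Y\<^sup>2 = Z^(2h') f'(X/Z)\<close>, the forms define a point as soon as the first or the
  third is non-zero. A morphism that is given by such forms on a non-empty open set is given by
  them wherever they define a point.
\<close>

definition morphism ::
  "'k::field kbar_poly \<Rightarrow> 'k kbar_poly \<Rightarrow> ('k point \<Rightarrow> 'k point) \<Rightarrow> bool" where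
  "morphism f f' \<phi> \<longleftrightarrow>
     \<phi> \<in> curve f \<rightarrow> curve f' \<and>
     (\<forall>P\<in>curve f. \<exists>e F0 F1 F2.
        wform (weight f) e F0 \<and> wform (weight f) (weight f' * e) F1 \<and> wform (weight f) e F2 \<and>
        (\<exists>v\<in>P. F0 v \<noteq> 0 \<or> F2 v \<noteq> 0) \<and>
        (\<forall>Q\<in>curve f. \<forall>v\<in>Q. F0 v \<noteq> 0 \<or> F2 v \<noteq> 0 \<longrightarrow>
           \<phi> Q = wpoint (weight f') (F0 v) (F1 v) (F2 v)))"

text \<open>
  \<open>on_coords f f' \<phi> u v\<close>: the coordinate functions \<open>x, y\<close> of the target satisfy \<open>\<phi> x = u\<close> and
  \<open>\<phi> y = v\<close>, as functions of the affine coordinates \<open>X, Y\<close> of the source.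
\<close>

definition on_coords ::
  "'k::field kbar_poly \<Rightarrow> 'k kbar_poly \<Rightarrow> ('k point \<Rightarrow> 'k point) \<Rightarrow>
   ('k alg_closure \<Rightarrow> 'k alg_closure \<Rightarrow> 'k alg_closure) \<Rightarrow>
   ('k alg_closure \<Rightarrow> 'k alg_closure \<Rightarrow> 'k alg_closure) \<Rightarrow> bool" where
  "on_coords f f' \<phi> u v \<longleftrightarrow>
     (\<forall>x y. y ^ 2 = Polynomial.poly f x \<longrightarrow> \<phi> (aff f x y) = aff f' (u x y) (v x y))"

definition Aut :: "'k::field kbar_poly \<Rightarrow> ('k point \<Rightarrow> 'k point) set" where
  "Aut f = {g \<in> Bij (curve f). morphism f f g \<and> morphism f f (inv_into (curve f) g)}"

definition hyp_involution :: "'k::field kbar_poly \<Rightarrow> 'k point \<Rightarrow> 'k point" where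
  "hyp_involution f = (\<lambda>P\<in>curve f. (\<lambda>(x, y, z). (x, - y, z)) ` P)"

text \<open>
  Elements \<open>A/B\<close> of the function field over \<open>k\<close>. As the curve is irreducible, \<open>B\<close> is a non-zero
  element of its coordinate ring iff it does not vanish at every point.
\<close>

definition ratfun ::
  "'k::field kbar_poly \<Rightarrow> ('k coords \<Rightarrow> 'k alg_closure) \<Rightarrow> ('k coords \<Rightarrow> 'k alg_closure) \<Rightarrow> bool" where
  "ratfun f A B \<longleftrightarrow>
     (\<exists>e. wform (weight f) e A \<and> wform (weight f) e B) \<and> (\<exists>P\<in>curve f. \<exists>v\<in>P. B v \<noteq> 0)"

definition invariant_ratfun ::
  "'k::field kbar_poly \<Rightarrow> ('k point \<Rightarrow> 'k point) set \<Rightarrow>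
   ('k coords \<Rightarrow> 'k alg_closure) \<Rightarrow> ('k coords \<Rightarrow> 'k alg_closure) \<Rightarrow> bool" where
  "invariant_ratfun f G A B \<longleftrightarrow>
     (\<forall>g\<in>G. \<forall>P\<in>curve f. \<forall>v\<in>P. \<forall>w\<in>g P. B v \<noteq> 0 \<and> B w \<noteq> 0 \<longrightarrow> A w / B w = A v / B v)"

definition is_pullback ::
  "'k::field kbar_poly \<Rightarrow> ('k point \<Rightarrow> 'k point) \<Rightarrow>
   ('k coords \<Rightarrow> 'k alg_closure) \<Rightarrow> ('k coords \<Rightarrow> 'k alg_closure) \<Rightarrow>
   ('k coords \<Rightarrow> 'k alg_closure) \<Rightarrow> ('k coords \<Rightarrow> 'k alg_closure) \<Rightarrow> bool" where
  "is_pullback f \<pi> A B A' B' \<longleftrightarrow>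
     (\<exists>P\<in>curve f. \<exists>w\<in>\<pi> P. B' w \<noteq> 0) \<and>
     (\<forall>P\<in>curve f. \<forall>v\<in>P. \<forall>w\<in>\<pi> P. B v \<noteq> 0 \<and> B' w \<noteq> 0 \<longrightarrow> A v / B v = A' w / B' w)"

text \<open>
  The quotient \<open>C/G\<close> is the smooth projective curve over \<open>k\<close> whose function field is \<open>k(C)\<^sup>G\<close>:
  \<open>\<pi> : C \<rightarrow> D\<close> is a quotient map iff it is a \<open>G\<close>-invariant morphism to a smooth curve such that every
  \<open>G\<close>-invariant rational function on \<open>C\<close> is the pullback of a rational function on \<open>D\<close>.
\<close>

definition quotient_map ::
  "'k::field kbar_poly \<Rightarrow> ('k point \<Rightarrow> 'k point) set \<Rightarrow> 'k kbar_poly \<Rightarrow> ('k point \<Rightarrow> 'k point) \<Rightarrow> bool"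
  where
  "quotient_map f G f' \<pi> \<longleftrightarrow>
     (\<exists>c R. hyperelliptic c R \<and> f' = hyp_poly c R) \<and>
     morphism f f' \<pi> \<and>
     (\<forall>g\<in>G. \<forall>P\<in>curve f. \<pi> (g P) = \<pi> P) \<and>
     (\<forall>A B. ratfun f A B \<and> invariant_ratfun f G A B \<longrightarrow>
        (\<exists>A' B'. ratfun f' A' B' \<and> is_pullback f \<pi> A B A' B'))"

section \<open>Affine groups of automorphisms and the model of the quotient\<close>

type_synonym 'k aut_char = "('k point \<Rightarrow> 'k point) \<Rightarrow> 'k"

definition affine_group ::
  "'k::field kbar_poly \<Rightarrow> ('k point \<Rightarrow> 'k point) set \<Rightarrow> 'k aut_char \<Rightarrow> 'k aut_char \<Rightarrow> 'k aut_char \<Rightarrow> bool"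
  where
  "affine_group f G \<alpha> \<beta> \<gamma> \<longleftrightarrow>
     finite G \<and> subgroup G (BijGroup (curve f)) \<and> G \<subseteq> Aut f \<and>
     (\<forall>g\<in>G. on_coords f f g (\<lambda>x y. to_ac (\<alpha> g) * x + to_ac (\<beta> g)) (\<lambda>x y. to_ac (\<gamma> g) * y))"

definition orbits ::
  "('k::field point \<Rightarrow> 'k point) set \<Rightarrow> 'k aut_char \<Rightarrow> 'k aut_char \<Rightarrow>
   'k alg_closure set \<Rightarrow> 'k alg_closure set set" where
  "orbits G \<alpha> \<beta> R = (\<lambda>r. (\<lambda>g. to_ac (\<alpha> g) * r + to_ac (\<beta> g)) ` G) ` R"

definition fixed_points ::
  "'k::field kbar_poly \<Rightarrow> ('k point \<Rightarrow> 'k point) set \<Rightarrow> 'k aut_char \<Rightarrow> 'k aut_char \<Rightarrow> 'k set" where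
  "fixed_points f G \<alpha> \<beta> = {a. \<exists>g\<in>G. g \<noteq> (\<lambda>P\<in>curve f. P) \<and> \<alpha> g * a + \<beta> g = a}"

definition inv_I ::
  "('k::field point \<Rightarrow> 'k point) set \<Rightarrow> 'k aut_char \<Rightarrow> 'k aut_char \<Rightarrow> 'k alg_closure \<Rightarrow> 'k alg_closure" where
  "inv_I G \<alpha> \<beta> x = (\<Prod>g\<in>G. to_ac (\<alpha> g) * x + to_ac (\<beta> g))"

definition inv_IT ::
  "('k::field point \<Rightarrow> 'k point) set \<Rightarrow> 'k aut_char \<Rightarrow> 'k aut_char \<Rightarrow> 'k alg_closure \<Rightarrow> 'k alg_closure" where
  "inv_IT G \<alpha> \<beta> x = (\<Prod>g\<in>{g\<in>G. \<alpha> g = 1}. to_ac (\<alpha> g) * x + to_ac (\<beta> g))"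

definition lambda ::
  "'k::field kbar_poly \<Rightarrow> ('k point \<Rightarrow> 'k point) set \<Rightarrow> 'k aut_char \<Rightarrow> 'k aut_char \<Rightarrow> 'k" where
  "lambda f G \<alpha> \<beta> = (\<Prod>a\<in>fixed_points f G \<alpha> \<beta>. a)"

definition m_of ::
  "'k::field kbar_poly \<Rightarrow> ('k point \<Rightarrow> 'k point) set \<Rightarrow> 'k aut_char \<Rightarrow> 'k aut_char \<Rightarrow> nat" where
  "m_of f G \<alpha> \<beta> = card G div card (fixed_points f G \<alpha> \<beta>)"

text \<open>
  The model of \<open>C/G\<close> is \<open>y\<^sup>2 = quotient_poly c R G \<alpha> \<beta> \<gamma>\<close>. As functions on \<open>C\<close>, its coordinates are
  \<open>inv_I\<close> and \<open>quotient_y\<close>.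
\<close>

definition quotient_poly ::
  "'k::field \<Rightarrow> 'k alg_closure set \<Rightarrow> ('k point \<Rightarrow> 'k point) set \<Rightarrow>
   'k aut_char \<Rightarrow> 'k aut_char \<Rightarrow> 'k aut_char \<Rightarrow> 'k kbar_poly" where
  "quotient_poly c R G \<alpha> \<beta> \<gamma> =
     (let f = hyp_poly c R;
          S = orbits G \<alpha> \<beta> R;
          U = fixed_points f G \<alpha> \<beta>;
          m = m_of f G \<alpha> \<beta>;
          lam = lambda f G \<alpha> \<beta>
      in if \<forall>g\<in>G. \<gamma> g = 1
         then Polynomial.smult (to_ac c * (- 1) ^ (card R - card S))
                (\<Prod>W\<in>S. [:- (\<Prod>r\<in>W. r), 1:])
         else Polynomial.smult (to_ac c * (- 1) ^ ((m - 1) * (card S - 1)))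
                ([:- to_ac (lam ^ m), 1:] * (\<Prod>W\<in>S - {to_ac ` U}. [:- (\<Prod>r\<in>W. r), 1:])))"

definition quotient_y ::
  "'k::field kbar_poly \<Rightarrow> ('k point \<Rightarrow> 'k point) set \<Rightarrow> 'k aut_char \<Rightarrow> 'k aut_char \<Rightarrow> 'k aut_char \<Rightarrow>
   'k alg_closure \<Rightarrow> 'k alg_closure \<Rightarrow> 'k alg_closure" where
  "quotient_y f G \<alpha> \<beta> \<gamma> x y =
     (if \<forall>g\<in>G. \<gamma> g = 1 then y
      else (inv_IT G \<alpha> \<beta> x - to_ac (lambda f G \<alpha> \<beta>)) ^ (m_of f G \<alpha> \<beta> div 2) * y)"

definition prime_to_part :: "nat \<Rightarrow> nat \<Rightarrow> nat" where
  "prime_to_part p n = n div p ^ multiplicity p n"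

text \<open>\<open>\<Phi> G = G \<Phi>\<close> as sets of maps on the curve.\<close>

definition normalises ::
  "'k::field kbar_poly \<Rightarrow> ('k point \<Rightarrow> 'k point) \<Rightarrow> ('k point \<Rightarrow> 'k point) set \<Rightarrow> bool" where
  "normalises f \<Phi> G \<longleftrightarrow>
     (\<lambda>g. compose (curve f) \<Phi> g) ` G = (\<lambda>g. compose (curve f) g \<Phi>) ` G"

end

theory Submission
  imports Defs
begin

text \<open>
  Write \<open>N = |G|\<close>, let \<open>W = \<Prod>u\<in>U. X - u = I\<^sub>T - \<lambda>\<close>, and put \<open>V = 1\<close> if \<open>\<gamma> = 1\<close>,
  \<open>V = W^(m div 2)\<close> otherwise, so that the model of the quotient has the coordinates
  \<open>x = I(X)\<close>, \<open>y = V(X) Y\<close>.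

  A \<open>G\<close>-invariant polynomial in \<open>X\<close> of degree less than \<open>N\<close> is constant, because it takes the
  same value at the \<open>N\<close> images of a generic point. This one observation shows that invariant
  polynomials are polynomials in \<open>I\<close>, that \<open>I = \<plusminus> W^m + \<lambda>^m\<close>, and, applied to the group with
  coefficients \<open>\<alpha>\<^sup>q\<close>, \<open>\<beta>\<^sup>q\<close>, that \<open>I(a X\<^sup>q + b) = a^N I(X)\<^sup>q + I(b)\<close>. At a fixed point of \<open>g\<close> that is a
  root of \<open>f\<close> one finds \<open>\<gamma>(g)\<^sup>2 = \<alpha>(g)\<close>, and at any other fixed point \<open>\<gamma>(g)\<^sup>2 = 1\<close>; hence
  \<open>\<gamma>(g) \<alpha>(g)^(m div 2) = 1\<close> and \<open>V(X) Y\<close> is invariant. Factoring \<open>f\<close> along the orbits gives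
  \<open>f\<^sub>G(I) = f V\<^sup>2\<close>, where \<open>y\<^sup>2 = f\<^sub>G(x)\<close> is the model.

  Invariant rational functions on the curve are brought to a denominator that is an invariant
  polynomial, and are then visibly rational in \<open>x\<close> and \<open>y\<close>. All statements about points at infinity
  follow from affine ones, since a weighted form that vanishes on the affine part of the curve
  vanishes on the whole curve. As \<open>\<Phi>\<close> normalises \<open>G\<close>, it permutes \<open>U\<close> if \<open>a \<noteq> 0\<close>, so \<open>W(a X\<^sup>q + b)\<close>
  is \<open>a^|U| W(X)\<^sup>q\<close>; if \<open>a = 0\<close>, then \<open>d = 0\<close> and \<open>\<Psi>\<close> is constant.
\<close>

section \<open>Polynomials over \<open>k\<close> and binary forms\<close>

text \<open>The degree count needs \<open>card G\<close> different affine maps of the line. This is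
  where the hyperelliptic involution is excluded: two elements with the same action on
  \<open>X\<close> have \<gamma> equal up to sign, and opposite signs would put the involution into
  the group. The number \<open>m\<close> arises from the exact sequence of translations and
  multipliers: \<open>card G = card M * card T\<close>, where \<open>T\<close> is a finite additive
  group, hence of \<open>p\<close>-power order, and \<open>M\<close> is a finite multiplicative
  group in characteristic \<open>p\<close>, hence of order prime to \<open>p\<close>. As \<gamma> is
  trivial on translations, it is a character of \<open>M\<close>. Both maps to be constructed have
  the shape \<open>(A(x), V(x) y)\<close> with \<open>f' \<circ> A = f V^2\<close>. For the
  descended map this works because \<open>q\<close> is odd, so that \<open>y^q\<close> is
  \<open>y\<close> times a power of the right-hand side of the equation. Existence of either
  morphism is thereby a polynomial identity. Roots, orbits and square roots live in the closure, so
  the identities are proved there. Rationality is recovered at the end: a polynomial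
  \<open>F\<close> is defined over \<open>k\<close> as soon as \<open>F \<circ> I\<close>
  is.\<close>

definition kpoly :: "'k::field kbar_poly \<Rightarrow> bool" where
  "kpoly A \<longleftrightarrow> (\<forall>i. Polynomial.coeff A i \<in> range to_ac)"

lemma range_to_ac_closed:
  assumes "x \<in> range (to_ac :: 'k::field \<Rightarrow> _)" "y \<in> range to_ac"
  shows "x + y \<in> range to_ac" "x * y \<in> range to_ac" "x - y \<in> range to_ac" "x / y \<in> range to_ac"
    "- x \<in> range to_ac" "x ^ n \<in> range to_ac"
proof -
  obtain u v where uv: "x = to_ac u" "y = to_ac v" using assms by auto
  show "x + y \<in> range to_ac" "x * y \<in> range to_ac" "x - y \<in> range to_ac" "x / y \<in> range to_ac"
    "- x \<in> range to_ac" "x ^ n \<in> range to_ac"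
    unfolding uv
    by (simp_all flip: to_ac_add to_ac_mult to_ac_diff to_ac_divide to_ac_minus to_ac_power)
qed

lemma range_to_ac_sum: "(\<And>i. i \<in> S \<Longrightarrow> g i \<in> range to_ac) \<Longrightarrow> sum g S \<in> range to_ac"
proof (induction S rule: infinite_finite_induct)
  case (insert x F)
  then show ?case by (simp add: range_to_ac_closed)
qed (auto intro: range_eqI[of _ _ 0])

lemma kpoly_iff: "kpoly A \<longleftrightarrow> A \<in> range (map_poly to_ac)"
proof
  assume A: "kpoly A"
  have "A = map_poly to_ac (map_poly of_ac A)"
    using A by (intro poly_eqI)
      (auto simp: coeff_map_poly kpoly_def to_ac_of_ac of_ac_eqI)
  then show "A \<in> range (map_poly to_ac)" by blast
qed (auto simp: kpoly_def coeff_map_poly)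

lemma kpoly_0 [simp]: "kpoly 0"
  by (auto simp: kpoly_def intro: range_eqI[of _ _ 0])

lemma kpoly_pCons: "x \<in> range to_ac \<Longrightarrow> kpoly A \<Longrightarrow> kpoly (pCons x A)"
  by (auto simp: kpoly_def coeff_pCons split: nat.splits)

lemma kpoly_1 [simp]: "kpoly 1"
  by (metis kpoly_0 kpoly_pCons one_pCons rangeI to_ac_1)

lemma kpoly_add: "kpoly A \<Longrightarrow> kpoly B \<Longrightarrow> kpoly (A + B)"
  and kpoly_diff: "kpoly A \<Longrightarrow> kpoly B \<Longrightarrow> kpoly (A - B)"
  and kpoly_minus: "kpoly A \<Longrightarrow> kpoly (- A)"
  unfolding kpoly_def coeff_add coeff_diff coeff_minus using range_to_ac_closed by metis+

lemma kpoly_mult: "kpoly A \<Longrightarrow> kpoly B \<Longrightarrow> kpoly (A * B)"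
  by (simp add: kpoly_def coeff_mult range_to_ac_closed range_to_ac_sum)

lemma kpoly_smult: "x \<in> range to_ac \<Longrightarrow> kpoly A \<Longrightarrow> kpoly (Polynomial.smult x A)"
  by (simp add: kpoly_def range_to_ac_closed)

lemma kpoly_power: "kpoly A \<Longrightarrow> kpoly (A ^ n)"
  by (induction n) (auto simp: kpoly_mult)

lemma kpoly_prod: "(\<And>i. i \<in> S \<Longrightarrow> kpoly (g i)) \<Longrightarrow> kpoly (prod g S)"
  by (induction S rule: infinite_finite_induct) (auto simp: kpoly_mult)

lemma kpoly_monom: "x \<in> range to_ac \<Longrightarrow> kpoly (Polynomial.monom x n)"
  by (simp add: monom_altdef kpoly_smult kpoly_power kpoly_pCons image_iff exI[of _ 0] exI[of _ 1])

lemma kpoly_pcompose: "kpoly A \<Longrightarrow> kpoly B \<Longrightarrow> kpoly (A \<circ>\<^sub>p B)"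
proof (induction A)
  case (pCons a A)
  have "a \<in> range to_ac" "kpoly A"
    using pCons.prems(1) unfolding kpoly_def by (metis coeff_pCons_0, metis coeff_pCons_Suc)
  with pCons show ?case
    by (simp add: pcompose_pCons kpoly_add kpoly_mult kpoly_pCons)
qed simp

lemmas kpoly_intros = kpoly_add kpoly_diff kpoly_minus kpoly_mult kpoly_smult kpoly_power
  kpoly_prod kpoly_pCons kpoly_pcompose kpoly_monom

text \<open>The leading coefficient of \<open>F\<close> can be read off from those of \<open>F \<circ>\<^sub>p B\<close> and \<open>B\<close>.\<close>

lemma kpoly_descend:
  assumes "kpoly (F \<circ>\<^sub>p B)" "kpoly B" "Polynomial.degree B > 0"
  shows "kpoly F"
  using assms(1)
proof (induction "Polynomial.degree F" arbitrary: F rule: less_induct)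
  case less
  define n where "n = Polynomial.degree F"
  define l where "l = lead_coeff F"
  have *: "lead_coeff (F \<circ>\<^sub>p B) = l * lead_coeff B ^ n"
    using lead_coeff_comp[OF assms(3), of F] by (simp add: l_def n_def)
  have "B \<noteq> 0" using assms(3) by auto
  then have "l = lead_coeff (F \<circ>\<^sub>p B) / lead_coeff B ^ n"
    by (simp add: *)
  moreover have "lead_coeff (F \<circ>\<^sub>p B) \<in> range to_ac" "lead_coeff B \<in> range to_ac"
    using less.prems assms(2) by (auto simp: kpoly_def)
  ultimately have l: "l \<in> range to_ac"
    by (simp add: range_to_ac_closed)
  show ?case
  proof (cases "n = 0")
    case True
    then have "F = [:l:]"
      unfolding n_def l_def by (metis degree_eq_zeroE lead_coeff_pCons(2) coeff_pCons_0)
    with l show ?thesis by (simp add: kpoly_pCons)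
  next
    case False
    define F' where "F' = F - Polynomial.monom l n"
    have deg: "Polynomial.degree F' < n"
    proof -
      have "Polynomial.degree F' \<le> n"
        unfolding F'_def by (intro degree_diff_le) (auto simp: n_def degree_monom_le)
      moreover have "Polynomial.coeff F' n = 0"
        by (simp add: F'_def l_def n_def)
      ultimately show ?thesis
        using False by (metis coeff_0 degree_0 leading_coeff_0_iff nat_less_le neq0_conv)
    qed
    have "kpoly (F' \<circ>\<^sub>p B)"
    proof -
      have mon: "Polynomial.monom l n \<circ>\<^sub>p B = Polynomial.smult l (B ^ n)"
        by (induction n) (simp_all add: monom_Suc monom_0 pcompose_pCons)
      then show ?thesis
        using less.prems assms(2) l by (simp add: F'_def pcompose_diff mon kpoly_intros)
    qed
    then have "kpoly F'" using less.hyps deg unfolding n_def by blast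
    moreover have "F = F' + Polynomial.monom l n" by (simp add: F'_def)
    ultimately show ?thesis using l by (metis kpoly_add kpoly_monom)
  qed
qed

text \<open>The degree \<open>e\<close> is a parameter, independent of the degree of
  \<open>A\<close>, so that forms of equal degree can be added. Coefficients of index above
  \<open>e\<close> are dropped, whence the degree bounds in most of the facts below.\<close>

definition homogen :: "nat \<Rightarrow> 'a::field poly \<Rightarrow> 'a \<Rightarrow> 'a \<Rightarrow> 'a" where
  "homogen e A x z = (\<Sum>i\<le>e. Polynomial.coeff A i * x ^ i * z ^ (e - i))"

lemma homogen_nz:
  assumes "Polynomial.degree A \<le> e" "z \<noteq> 0"
  shows "homogen e A x z = z ^ e * poly A (x / z)"
proof -
  have "poly A (x / z) = (\<Sum>i\<le>e. Polynomial.coeff A i * (x / z) ^ i)"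
    unfolding poly_altdef using assms(1)
    by (intro sum.mono_neutral_left) (auto simp: coeff_eq_0)
  then show ?thesis
    using assms(2) by (auto simp: homogen_def sum_distrib_left power_divide power_diff field_simps intro!: sum.cong)
qed

lemma homogen_z1: "Polynomial.degree A \<le> e \<Longrightarrow> homogen e A x 1 = poly A x"
  by (simp add: homogen_nz)

lemma homogen_z0: "homogen e A x 0 = Polynomial.coeff A e * x ^ e"
proof -
  have "homogen e A x 0 = (\<Sum>i\<le>e. if i = e then Polynomial.coeff A i * x ^ i else 0)"
    unfolding homogen_def by (intro sum.cong) auto
  then show ?thesis by simp
qed

lemma homogen_add: "homogen e (A + B) x z = homogen e A x z + homogen e B x z"
  by (simp add: homogen_def sum.distrib algebra_simps)

lemma homogen_0 [simp]: "homogen e 0 x z = 0"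
  by (simp add: homogen_def)

text \<open>At \<open>z = 0\<close> a form of degree \<open>e\<close> keeps only its coefficient of
  index \<open>e\<close>. This makes the values there multiplicative even if the degree bounds are
  not attained.\<close>

lemma coeff_mult_top:
  assumes "Polynomial.degree A \<le> d" "Polynomial.degree B \<le> e"
  shows "Polynomial.coeff (A * B) (d + e) = Polynomial.coeff A d * Polynomial.coeff (B::'a::field poly) e"
proof (cases "Polynomial.degree A = d \<and> Polynomial.degree B = e")
  case True
  then show ?thesis using coeff_mult_degree_sum by blast
next
  case False
  then have "Polynomial.degree A < d \<or> Polynomial.degree B < e" using assms by auto
  moreover have "Polynomial.degree (A * B) < d + e" if "Polynomial.degree A < d \<or> Polynomial.degree B < e"
    using degree_mult_le[of A B] that assms by linarith
  ultimately show ?thesis by (auto simp: coeff_eq_0)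
qed

lemma homogen_mult:
  assumes "Polynomial.degree A \<le> d" "Polynomial.degree B \<le> e"
  shows "homogen (d + e) (A * B) x z = homogen d A x z * homogen e B x z"
proof (cases "z = 0")
  case True
  then show ?thesis using coeff_mult_top[OF assms] by (simp add: homogen_z0 power_add)
next
  case False
  have "Polynomial.degree (A * B) \<le> d + e"
    using degree_mult_le[of A B] assms by linarith
  then show ?thesis using assms False by (simp add: homogen_nz power_add)
qed

lemma deg_le_weight: "Polynomial.degree f \<le> 2 * weight f"
  by (simp add: weight_def)

lemma homog_eq_homogen: "homog f x z = homogen (2 * weight f) f x z"
  unfolding homog_def homogen_def
  by (rule sum.mono_neutral_left) (auto simp: weight_def coeff_eq_0)

lemma homog_z1 [simp]: "homog f x 1 = poly f x"
  by (simp add: homog_eq_homogen homogen_z1 deg_le_weight)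

section \<open>Weighted homogeneous forms\<close>

lemma infinite_UNIV_alg_closed: "infinite (UNIV :: 'a::alg_closed_field set)"
proof
  assume fin: "finite (UNIV :: 'a set)"
  \<comment> \<open>Over a finite field this would be non-constant and yet take the value 1
    everywhere.\<close>
  define P where "P = (\<Prod>a\<in>(UNIV::'a set). [:- a, 1:]) + 1"
  have d: "Polynomial.degree (\<Prod>a\<in>(UNIV::'a set). [:- a, 1:]) = card (UNIV :: 'a set)"
    by (subst degree_prod_sum_eq) auto
  have "card (UNIV :: 'a set) > 0"
    using fin by (simp add: card_gt_0_iff)
  then have "Polynomial.degree P > 0"
    unfolding P_def by (subst degree_add_eq_left) (auto simp: d)
  then obtain x where "poly P x = 0" using alg_closed_imp_poly_has_root by blast
  moreover have "poly (\<Prod>a\<in>(UNIV::'a set). [:- a, 1:]) x = 0"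
    using fin by (auto simp: poly_prod)
  ultimately show False by (simp add: P_def)
qed

text \<open>With \<open>S = {}\<close> this is extensionality of polynomials; otherwise
  \<open>S\<close> collects the points excluded because something had to be cancelled.\<close>

lemma poly_eq_cofinite:
  fixes P Q :: "'a::alg_closed_field poly"
  assumes "finite S" "\<And>x. x \<notin> S \<Longrightarrow> poly P x = poly Q x"
  shows "P = Q"
proof (rule ccontr)
  assume "P \<noteq> Q"
  then have "finite {x. poly (P - Q) x = 0}" by (intro poly_roots_finite) auto
  moreover have "UNIV \<subseteq> S \<union> {x. poly (P - Q) x = 0}" using assms(2) by auto
  ultimately show False
    using assms(1) infinite_UNIV_alg_closed finite_subset by (metis finite_UnI)
qed

lemma poly_surj:
  fixes P :: "'a::alg_closed_field poly"
  assumes "Polynomial.degree P > 0"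
  obtains x where "poly P x = y"
proof -
  have "Polynomial.degree (P + [:- y:]) > 0"
    using assms degree_add_eq_left[of "[:- y:]" P] by simp
  then obtain x where "poly (P + [:- y:]) x = 0" using alg_closed_imp_poly_has_root by blast
  with that show thesis by auto
qed

lemma ex_sqrt: "\<exists>y::'a::alg_closed_field. y ^ 2 = x"
  using nth_root_exists[of 2 x] by auto

text \<open>The condition \<open>2 \<noteq> 0\<close> serves to separate the parts of a function
  that are even and odd in \<open>y\<close>.\<close>

definition curve_poly :: "'k::field kbar_poly \<Rightarrow> bool" where
  "curve_poly f \<longleftrightarrow> kpoly f \<and> Polynomial.degree f > 0 \<and> (2 :: 'k alg_closure) \<noteq> 0"

lemma wform_scale:
  assumes "wform h e F"
  shows "F (t * x, t ^ h * y, t * z) = t ^ e * F (x, y, z)"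
  using assms by induction (auto simp: power_add algebra_simps)

lemma wform_diff:
  assumes "wform h e F" "wform h e F'"
  shows "wform h e (\<lambda>v. F v - F' v)"
  using wform.add[OF assms(1) wform.mult[OF wform.const[where a = "- 1"] assms(2), simplified]] by simp

lemma wform_power: "wform h e F \<Longrightarrow> wform h (n * e) (\<lambda>v. F v ^ n)"
proof (induction n)
  case 0 then show ?case using wform.const[where a = 1] by simp
next
  case (Suc n)
  then show ?case using wform.mult[of h e F "n * e"] by simp
qed

text \<open>The constant rule yields zero only in degree 0; in degree \<open>e\<close> it is written
  as \<open>0 * X^e\<close>.\<close>

lemma wform_0: "wform h e (\<lambda>_. 0)"
  using wform.mult[OF wform.const[where a = 0] wform_power[OF wform.x, of h e]] by simp

lemma wform_sum: "(\<And>i. i \<in> S \<Longrightarrow> wform h e (F i)) \<Longrightarrow> wform h e (\<lambda>v. \<Sum>i\<in>S. F i v)"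
  by (induction S rule: infinite_finite_induct) (auto intro: wform.add wform_0)

lemma wform_smult: "x \<in> range to_ac \<Longrightarrow> wform h e F \<Longrightarrow> wform h e (\<lambda>v. x * F v)"
  using wform.mult[OF wform.const] by fastforce

lemma wform_mult': "wform h d F \<Longrightarrow> wform h e F' \<Longrightarrow> n = d + e \<Longrightarrow> wform h n (\<lambda>v. F v * F' v)"
  using wform.mult by blast

lemma wform_compose_homogen:
  assumes "kpoly A" "wform h e F" "wform h e F'" "d = n * e"
  shows "wform h d (\<lambda>v. homogen n A (F v) (F' v))"
  unfolding homogen_def
proof (rule wform_sum)
  fix i assume i: "i \<in> {..n}"
  have "i * e + (n - i) * e = d"
    using i assms(4) by (simp flip: add_mult_distrib)
  then have "wform h d (\<lambda>v. F v ^ i * F' v ^ (n - i))"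
    by (rule wform_mult'[OF wform_power[OF assms(2)] wform_power[OF assms(3)] sym])
  then show "wform h d (\<lambda>v. Polynomial.coeff A i * F v ^ i * F' v ^ (n - i))"
    unfolding mult.assoc using assms(1) by (intro wform_smult) (auto simp: kpoly_def)
qed

lemma wform_homogen: "kpoly A \<Longrightarrow> wform h e (\<lambda>(x, y, z). homogen e A x z)"
  using wform_compose_homogen[OF _ wform.x wform.z, of A e e h] by (simp add: case_prod_unfold)

lemma wform_compose:
  assumes "wform h' d A" "wform h e F0" "wform h (h' * e) F1" "wform h e F2"
  shows "wform h (d * e) (\<lambda>v. A (F0 v, F1 v, F2 v))"
  using assms(1)
proof induction
  case (const a)
  then show ?case using wform.const by simp
next
  case (add e' F F')
  then show ?case by (intro wform.add)
next
  case (mult e' F e'' F')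
  then show ?case by (auto intro: wform_mult' simp: add_mult_distrib)
qed (use assms in auto)

text \<open>On the curve every power of \<open>y\<close> reduces by \<open>y^2 = f\<close>, so forms
  restrict to \<open>A + y B\<close>. Subtraction on naturals truncates; if
  \<open>e < weight f\<close>, then the alternative \<open>B = 0\<close> must hold.\<close>

lemma wform_normal_form:
  assumes "wform (weight f) e F" "kpoly f"
  shows "\<exists>A B. kpoly A \<and> kpoly B \<and> Polynomial.degree A \<le> e \<and>
    (B = 0 \<or> Polynomial.degree B + weight f \<le> e) \<and>
    (\<forall>x y z. y ^ 2 = homog f x z \<longrightarrow> F (x, y, z) = homogen e A x z + y * homogen (e - weight f) B x z)"
  using assms(1)
proof induction
  case x
  have "kpoly ([:0, 1:] :: 'a kbar_poly)"
    by (metis kpoly_1 kpoly_pCons one_pCons rangeI to_ac_0)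
  then show ?case by (intro exI[of _ "[:0, 1:]"] exI[of _ 0]) (auto simp: homogen_def)
next
  case y
  then show ?case by (intro exI[of _ 0] exI[of _ 1]) (auto simp: homogen_def)
next
  case z
  then show ?case by (intro exI[of _ 1] exI[of _ 0]) (auto simp: homogen_def)
next
  case (const a)
  then show ?case by (intro exI[of _ "[:to_ac a:]"] exI[of _ 0]) (auto simp: homogen_def kpoly_pCons)
next
  case (add e F F')
  then obtain A B A' B' where 1: "kpoly A \<and> kpoly B \<and> Polynomial.degree A \<le> e \<and>
    (B = 0 \<or> Polynomial.degree B + weight f \<le> e) \<and>
    (\<forall>x y z. y ^ 2 = homog f x z \<longrightarrow> F (x, y, z) = homogen e A x z + y * homogen (e - weight f) B x z)"
    "kpoly A' \<and> kpoly B' \<and> Polynomial.degree A' \<le> e \<and>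
    (B' = 0 \<or> Polynomial.degree B' + weight f \<le> e) \<and>
    (\<forall>x y z. y ^ 2 = homog f x z \<longrightarrow> F' (x, y, z) = homogen e A' x z + y * homogen (e - weight f) B' x z)"
    by blast
  have "Polynomial.degree (A + A') \<le> e" using 1 by (simp add: degree_add_le)
  moreover have "B + B' = 0 \<or> Polynomial.degree (B + B') + weight f \<le> e"
    using 1 degree_add_le_max[of B B'] by (cases "B = 0"; cases "B' = 0") auto
  ultimately show ?case
    using 1 by (intro exI[of _ "A + A'"] exI[of _ "B + B'"]) (auto simp: kpoly_add homogen_add algebra_simps)
next
  case (mult e F e' F')
  define h where "h = weight f"
  obtain A B where 1: "kpoly A" "kpoly B" "Polynomial.degree A \<le> e"
    "B = 0 \<or> Polynomial.degree B + h \<le> e"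
    "\<forall>x y z. y ^ 2 = homog f x z \<longrightarrow> F (x, y, z) = homogen e A x z + y * homogen (e - h) B x z"
    using mult.IH(1) unfolding h_def by (elim exE conjE)
  obtain A' B' where 2: "kpoly A'" "kpoly B'" "Polynomial.degree A' \<le> e'"
    "B' = 0 \<or> Polynomial.degree B' + h \<le> e'"
    "\<forall>x y z. y ^ 2 = homog f x z \<longrightarrow> F' (x, y, z) = homogen e' A' x z + y * homogen (e' - h) B' x z"
    using mult.IH(2) unfolding h_def by (elim exE conjE)
  have AB': "homogen (e + e' - h) (A * B') x z = homogen e A x z * homogen (e' - h) B' x z"
    "A * B' = 0 \<or> Polynomial.degree (A * B') + h \<le> e + e'" for x z
    using homogen_mult[of A e B' "e' - h" x z] 1(3) 2(4) degree_mult_le[of A B'] by (cases "B' = 0"; auto)+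
  have BA': "homogen (e + e' - h) (B * A') x z = homogen (e - h) B x z * homogen e' A' x z"
    "B * A' = 0 \<or> Polynomial.degree (B * A') + h \<le> e + e'" for x z
    using homogen_mult[of B "e - h" A' e' x z] 2(3) 1(4) degree_mult_le[of B A'] by (cases "B = 0"; auto)+
  \<comment> \<open>The product of the two terms with \<open>y\<close> is \<open>y^2 B B'\<close>,
    which becomes \<open>f B B'\<close> and joins the part without \<open>y\<close>. The degrees fit
    because \<open>homog f\<close> has degree \<open>2 * h\<close>.\<close>
  have BB': "homogen (e + e') (f * (B * B')) x z = homog f x z * (homogen (e - h) B x z * homogen (e' - h) B' x z)"
    "Polynomial.degree (f * (B * B')) \<le> e + e'" for x z
  proof -
    consider "B = 0" | "B' = 0" | "Polynomial.degree B + h \<le> e" "Polynomial.degree B' + h \<le> e'"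
      using 1(4) 2(4) by auto
    then have "homogen (e + e') (f * (B * B')) x z = homog f x z * (homogen (e - h) B x z * homogen (e' - h) B' x z)
      \<and> Polynomial.degree (f * (B * B')) \<le> e + e'"
    proof cases
      case 3
      have d: "Polynomial.degree (B * B') \<le> (e - h) + (e' - h)"
        using degree_mult_le[of B B'] 3 by linarith
      moreover have "2 * h + ((e - h) + (e' - h)) = e + e'" using 3 by simp
      ultimately have "homogen (e + e') (f * (B * B')) x z = homog f x z * homogen ((e - h) + (e' - h)) (B * B') x z"
        using homogen_mult[OF deg_le_weight d, of f x z] by (simp add: homog_eq_homogen h_def)
      moreover have "Polynomial.degree (f * (B * B')) \<le> e + e'"
        using degree_mult_le[of f "B * B'"] d deg_le_weight[of f] 3 unfolding h_def by linarith
      ultimately show ?thesis using homogen_mult[of B "e - h" B' "e' - h"] 3 by simp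
    qed auto
    then show "homogen (e + e') (f * (B * B')) x z = homog f x z * (homogen (e - h) B x z * homogen (e' - h) B' x z)"
      "Polynomial.degree (f * (B * B')) \<le> e + e'" by auto
  qed
  have d1: "Polynomial.degree (A * A' + f * (B * B')) \<le> e + e'"
    using BB'(2) degree_mult_le[of A A'] 1(3) 2(3) by (intro degree_add_le) auto
  have d2: "A * B' + B * A' = 0 \<or> Polynomial.degree (A * B' + B * A') + h \<le> e + e'"
    using AB'(2) BA'(2) degree_add_le_max[of "A * B'" "B * A'"]
    by (cases "A * B' = 0"; cases "B * A' = 0") auto
  have val: "F (x, y, z) * F' (x, y, z) = homogen (e + e') (A * A' + f * (B * B')) x z
      + y * homogen (e + e' - h) (A * B' + B * A') x z" if "y ^ 2 = homog f x z" for x y z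
    unfolding homogen_add AB' BA' BB' 1(5)[rule_format, OF that] 2(5)[rule_format, OF that] homogen_mult[OF 1(3) 2(3)]
    by (simp add: that[symmetric] power2_eq_square algebra_simps)
  have k: "kpoly (A * A' + f * (B * B'))" "kpoly (A * B' + B * A')"
    by (intro kpoly_add kpoly_mult 1 2 assms(2))+
  show ?case unfolding h_def[symmetric]
    by (rule exI[of _ "A * A' + f * (B * B')"], rule exI[of _ "A * B' + B * A'"])
       (intro conjI k d1 d2 allI impI val)
qed

text \<open>In the normal form \<open>A + y B\<close>, the points \<open>(x, y)\<close> and
  \<open>(x, -y)\<close> force \<open>A(x) = 0\<close>, and \<open>B(x) = 0\<close> off the roots of
  \<open>f\<close>. So both polynomials are zero, and their homogenisations vanish at infinity
  too.\<close>

lemma wform_vanish: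
  assumes F: "wform (weight f) e F" and f: "curve_poly f"
    and aff: "\<And>x y. y ^ 2 = poly f x \<Longrightarrow> F (x, y, 1) = 0"
    and v: "y ^ 2 = homog f x z"
  shows "F (x, y, z) = 0"
proof -
  obtain A B where A: "Polynomial.degree A \<le> e" "B = 0 \<or> Polynomial.degree B + weight f \<le> e"
    "\<forall>x y z. y ^ 2 = homog f x z \<longrightarrow> F (x, y, z) = homogen e A x z + y * homogen (e - weight f) B x z"
    using wform_normal_form[OF F conjunct1[OF f[unfolded curve_poly_def]]] by (elim exE conjE)
  have dB: "Polynomial.degree B \<le> e - weight f" using A(2) by auto
  have 0: "poly A x + y * poly B x = 0" if "y ^ 2 = poly f x" for x y
    using A(3)[rule_format, of y x 1] aff[OF that] that homogen_z1[OF A(1)] homogen_z1[OF dB] by simp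
  have two: "(2 :: 'a alg_closure) \<noteq> 0" and f0: "f \<noteq> 0" using f by (auto simp: curve_poly_def)
  have 1: "poly A x = 0 \<and> (poly f x \<noteq> 0 \<longrightarrow> poly B x = 0)" for x
  proof -
    obtain y where y: "y ^ 2 = poly f x" using ex_sqrt by blast
    have "poly A x + y * poly B x = 0" "poly A x + (- y) * poly B x = 0"
      using 0[OF y] 0[of "- y" x] y by auto
    then have "2 * poly A x = 0" "y * poly B x = - poly A x" by (simp_all add: algebra_simps)
    with two y show ?thesis by auto
  qed
  have "A = 0" by (rule poly_eq_cofinite[of "{}"]) (use 1 in auto)
  moreover have "B = 0"
    by (rule poly_eq_cofinite[of "{x. poly f x = 0}"]) (use 1 f0 in \<open>auto simp: poly_roots_finite\<close>)
  ultimately show ?thesis using A(3)[rule_format, OF v] by simp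
qed

section \<open>Points and morphisms\<close>

lemma mem_wpoint: "v \<in> wpoint h x y z \<longleftrightarrow> (\<exists>t. t \<noteq> 0 \<and> v = (t * x, t ^ h * y, t * z))"
  by (auto simp: wpoint_def)

lemma wpoint_self: "(x, y, z) \<in> wpoint h x y z"
  unfolding mem_wpoint by (intro exI[of _ 1]) auto

lemma wpoint_scale: "t \<noteq> 0 \<Longrightarrow> wpoint h (t * x) (t ^ h * y) (t * z) = wpoint h x y z"
proof -
  assume t: "t \<noteq> 0"
  have "(\<exists>s. s \<noteq> 0 \<and> v = (s * (t * x), s ^ h * (t ^ h * y), s * (t * z))) \<longleftrightarrow>
        (\<exists>s. s \<noteq> 0 \<and> v = (s * x, s ^ h * y, s * z))" (is "?A \<longleftrightarrow> ?B") for v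
  proof
    assume ?A
    then obtain s where "s \<noteq> 0" "v = (s * (t * x), s ^ h * (t ^ h * y), s * (t * z))" by blast
    then show ?B using t by (intro exI[of _ "s * t"]) (auto simp: power_mult_distrib)
  next
    assume ?B
    then obtain s where "s \<noteq> 0" "v = (s * x, s ^ h * y, s * z)" by blast
    then show ?A using t by (intro exI[of _ "s / t"]) (auto simp: power_divide)
  qed
  then show ?thesis by (auto simp: set_eq_iff mem_wpoint)
qed

lemma wpoint_eqD:
  assumes "wpoint h x y z = wpoint h x' y' z'"
  shows "\<exists>t. t \<noteq> 0 \<and> x = t * x' \<and> y = t ^ h * y' \<and> z = t * z'"
  using assms wpoint_self[of x y z h] by (auto simp: mem_wpoint)

lemma homog_scale: "homog f (t * x) (t * z) = t ^ (2 * weight f) * homog f x z"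
  unfolding homog_eq_homogen homogen_def sum_distrib_left
proof (rule sum.cong)
  fix i assume "i \<in> {..2 * weight f}"
  then have "t ^ (2 * weight f) = t ^ i * t ^ (2 * weight f - i)"
    by (simp flip: power_add)
  then show "Polynomial.coeff f i * (t * x) ^ i * (t * z) ^ (2 * weight f - i) =
    t ^ (2 * weight f) * (Polynomial.coeff f i * x ^ i * z ^ (2 * weight f - i))"
    by (simp add: power_mult_distrib)
qed simp

lemma curve_memD:
  assumes "P \<in> curve f" "(x, y, z) \<in> P"
  shows "x \<noteq> 0 \<or> z \<noteq> 0" "y ^ 2 = homog f x z" "P = wpoint (weight f) x y z"
proof -
  obtain x' y' z' where P: "P = wpoint (weight f) x' y' z'" "(x', z') \<noteq> (0, 0)" "y' ^ 2 = homog f x' z'"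
    using assms(1) by (auto simp: curve_def)
  then obtain t where t: "t \<noteq> 0" "x = t * x'" "y = t ^ weight f * y'" "z = t * z'"
    using assms(2) by (auto simp: mem_wpoint)
  show "x \<noteq> 0 \<or> z \<noteq> 0" using P t by auto
  show "y ^ 2 = homog f x z"
    using P(3) t by (simp add: homog_scale power_mult_distrib mult.commute flip: power_mult)
  show "P = wpoint (weight f) x y z" using P t by (simp add: wpoint_scale)
qed

lemma wpoint_in_curve: "x \<noteq> 0 \<or> z \<noteq> 0 \<Longrightarrow> y ^ 2 = homog f x z \<Longrightarrow> wpoint (weight f) x y z \<in> curve f"
  unfolding curve_def by blast

lemma curveE:
  assumes "P \<in> curve f"
  obtains x y z where "(x, y, z) \<in> P" "P = wpoint (weight f) x y z" "x \<noteq> 0 \<or> z \<noteq> 0" "y ^ 2 = homog f x z"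
  using assms unfolding curve_def by (auto intro: wpoint_self)

lemma curve_same_point:
  assumes "P \<in> curve f" "v \<in> P" "(x, y, z) \<in> P"
  obtains t where "t \<noteq> 0" "v = (t * x, t ^ weight f * y, t * z)"
  using curve_memD(3)[OF assms(1,3)] assms(2) by (auto simp: mem_wpoint)

lemma aff_in_curve_iff: "aff f x y \<in> curve f \<longleftrightarrow> y ^ 2 = poly f x"
proof
  assume "aff f x y \<in> curve f"
  from curve_memD(2)[OF this, of x y 1] show "y ^ 2 = poly f x"
    by (simp add: aff_def wpoint_self)
qed (auto simp: aff_def intro: wpoint_in_curve)

lemma aff_self: "(x, y, 1) \<in> aff f x y"
  by (simp add: aff_def wpoint_self)

lemma aff_eq_iff: "aff f x y = aff f x' y' \<longleftrightarrow> x = x' \<and> y = y'"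
  unfolding aff_def by (auto dest!: wpoint_eqD)

lemma morphism_mem: "morphism f f' \<phi> \<Longrightarrow> P \<in> curve f \<Longrightarrow> \<phi> P \<in> curve f'"
  by (auto simp: morphism_def)

text \<open>The definition of a morphism only promises some representative of the point at which the
  forms are usable; by homogeneity every representative \<open>v\<close> will do.\<close>

lemma morphism_formsE:
  assumes "morphism f f' \<phi>" "P \<in> curve f" "v \<in> P"
  obtains e F0 F1 F2 where "wform (weight f) e F0" "wform (weight f) (weight f' * e) F1"
    "wform (weight f) e F2" "F0 v \<noteq> 0 \<or> F2 v \<noteq> 0"
    "\<forall>Q\<in>curve f. \<forall>v\<in>Q. F0 v \<noteq> 0 \<or> F2 v \<noteq> 0 \<longrightarrow> \<phi> Q = wpoint (weight f') (F0 v) (F1 v) (F2 v)"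
proof -
  obtain x y z where v: "v = (x, y, z)" by (cases v)
  have "\<forall>P\<in>curve f. \<exists>e F0 F1 F2. wform (weight f) e F0 \<and> wform (weight f) (weight f' * e) F1 \<and>
      wform (weight f) e F2 \<and> (\<exists>v\<in>P. F0 v \<noteq> 0 \<or> F2 v \<noteq> 0) \<and>
      (\<forall>Q\<in>curve f. \<forall>v\<in>Q. F0 v \<noteq> 0 \<or> F2 v \<noteq> 0 \<longrightarrow> \<phi> Q = wpoint (weight f') (F0 v) (F1 v) (F2 v))"
    using assms(1) unfolding morphism_def by (rule conjunct2)
  from bspec[OF this assms(2)] obtain e F0 F1 F2 where F: "wform (weight f) e F0"
    "wform (weight f) (weight f' * e) F1" "wform (weight f) e F2" "\<exists>w\<in>P. F0 w \<noteq> 0 \<or> F2 w \<noteq> 0"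
    "\<forall>Q\<in>curve f. \<forall>v\<in>Q. F0 v \<noteq> 0 \<or> F2 v \<noteq> 0 \<longrightarrow> \<phi> Q = wpoint (weight f') (F0 v) (F1 v) (F2 v)"
    by (elim exE conjE)
  then obtain w where w: "w \<in> P" "F0 w \<noteq> 0 \<or> F2 w \<noteq> 0" by blast
  obtain t where "w = (t * x, t ^ weight f * y, t * z)"
    using curve_same_point[OF assms(2) w(1)] assms(3) v by metis
  then have nz: "F0 v \<noteq> 0 \<or> F2 v \<noteq> 0"
    using w(2) wform_scale[OF F(1), of t x y z] wform_scale[OF F(3), of t x y z] by (auto simp: v)
  show thesis by (rule that[OF F(1-3) nz F(5)])
qed

text \<open>
  At a point at infinity the forms defining \<open>\<pi>\<close> may only be composed after multiplication by one of
  them that does not vanish there: elsewhere their common zeros would spoil the identity.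
\<close>

lemma pullback_identity_extends:
  assumes pi: "morphism f f' \<pi>" and f: "curve_poly f"
    and A: "wform (weight f) d A" "wform (weight f) d B"
    and A': "wform (weight f') d' A'" "wform (weight f') d' B'"
    and aff: "\<And>x y. y ^ 2 = poly f x \<Longrightarrow> \<exists>w\<in>\<pi> (aff f x y). A (x, y, 1) * B' w = B (x, y, 1) * A' w"
    and P: "P \<in> curve f" "v \<in> P" "w \<in> \<pi> P"
  shows "A v * B' w = B v * A' w"
proof -
  obtain e F0 F1 F2 where F: "wform (weight f) e F0" "wform (weight f) (weight f' * e) F1"
    "wform (weight f) e F2" "F0 v \<noteq> 0 \<or> F2 v \<noteq> 0"
    "\<forall>Q\<in>curve f. \<forall>v\<in>Q. F0 v \<noteq> 0 \<or> F2 v \<noteq> 0 \<longrightarrow> \<pi> Q = wpoint (weight f') (F0 v) (F1 v) (F2 v)"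
    by (rule morphism_formsE[OF pi P(1,2)])
  define L where "L = (if F0 v \<noteq> 0 then F0 else F2)"
  have L: "wform (weight f) e L" "L v \<noteq> 0" "\<And>u. L u \<noteq> 0 \<Longrightarrow> F0 u \<noteq> 0 \<or> F2 u \<noteq> 0"
    using F(1,3,4) by (auto simp: L_def split: if_splits)
  define E where "E = (\<lambda>v. L v * (A v * B' (F0 v, F1 v, F2 v) - B v * A' (F0 v, F1 v, F2 v)))"
  have E: "wform (weight f) (e + (d + d' * e)) E"
    unfolding E_def by (intro wform.mult wform_diff L A wform_compose[OF A'(1) F(1-3)] wform_compose[OF A'(2) F(1-3)])
  have "E (x, y, 1) = 0" if xy: "y ^ 2 = poly f x" for x y
  proof (cases "L (x, y, 1) = 0")
    case False
    let ?u = "(x, y, 1)"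
    have c: "aff f x y \<in> curve f" using xy by (simp add: aff_in_curve_iff)
    have "\<pi> (aff f x y) = wpoint (weight f') (F0 ?u) (F1 ?u) (F2 ?u)"
      using F(5)[rule_format, OF c aff_self] L(3) False by blast
    with aff[OF xy] obtain t where t: "t \<noteq> 0"
      "A ?u * B' (t * F0 ?u, t ^ weight f' * F1 ?u, t * F2 ?u)
        = B ?u * A' (t * F0 ?u, t ^ weight f' * F1 ?u, t * F2 ?u)"
      by (auto simp: mem_wpoint)
    then show ?thesis
      using wform_scale[OF A'(1)] wform_scale[OF A'(2)] by (simp add: E_def algebra_simps)
  qed (simp add: E_def)
  moreover obtain x y z where v: "v = (x, y, z)" by (cases v)
  ultimately have "E v = 0"
    using wform_vanish[OF E f, of y x z] curve_memD(2)[OF P(1), of x y z] P(2) by auto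
  then have id: "A v * B' (F0 v, F1 v, F2 v) = B v * A' (F0 v, F1 v, F2 v)"
    using L(2) by (simp add: E_def)
  obtain t where "w = (t * F0 v, t ^ weight f' * F1 v, t * F2 v)"
    using F(5)[rule_format, OF P(1,2) F(4)] P(3) by (auto simp: mem_wpoint)
  then show ?thesis
    using id wform_scale[OF A'(1)] wform_scale[OF A'(2)] by (simp add: algebra_simps)
qed

text \<open>Equality of two weighted points is expressed by the vanishing of forms, to which
  \<open>wform_vanish\<close> applies.\<close>

lemma morphism_unique:
  assumes \<phi>: "morphism f f' \<phi>" and \<psi>: "morphism f f' \<psi>" and f: "curve_poly f"
    and aff: "\<And>x y. y ^ 2 = poly f x \<Longrightarrow> \<phi> (aff f x y) = \<psi> (aff f x y)"
    and P: "P \<in> curve f"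
  shows "\<phi> P = \<psi> P"
proof -
  define h where "h = weight f'"
  obtain x y z where v: "(x, y, z) \<in> P" using curveE[OF P] by metis
  let ?v = "(x, y, z)"
  obtain e F0 F1 F2 where F: "wform (weight f) e F0" "wform (weight f) (h * e) F1"
    "wform (weight f) e F2" "F0 ?v \<noteq> 0 \<or> F2 ?v \<noteq> 0"
    "\<forall>Q\<in>curve f. \<forall>v\<in>Q. F0 v \<noteq> 0 \<or> F2 v \<noteq> 0 \<longrightarrow> \<phi> Q = wpoint h (F0 v) (F1 v) (F2 v)"
    by (rule morphism_formsE[OF \<phi> P v, folded h_def])
  obtain e' G0 G1 G2 where G: "wform (weight f) e' G0" "wform (weight f) (h * e') G1"
    "wform (weight f) e' G2" "G0 ?v \<noteq> 0 \<or> G2 ?v \<noteq> 0"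
    "\<forall>Q\<in>curve f. \<forall>v\<in>Q. G0 v \<noteq> 0 \<or> G2 v \<noteq> 0 \<longrightarrow> \<psi> Q = wpoint h (G0 v) (G1 v) (G2 v)"
    by (rule morphism_formsE[OF \<psi> P v, folded h_def])
  have v2: "y ^ 2 = homog f x z" using curve_memD[OF P v] by simp
  have eq: "\<exists>t. t \<noteq> 0 \<and> F0 (x, y, 1) = t * G0 (x, y, 1) \<and> F1 (x, y, 1) = t ^ h * G1 (x, y, 1)
      \<and> F2 (x, y, 1) = t * G2 (x, y, 1)"
    if xy: "y ^ 2 = poly f x" and nz: "F0 (x, y, 1) \<noteq> 0 \<or> F2 (x, y, 1) \<noteq> 0" "G0 (x, y, 1) \<noteq> 0 \<or> G2 (x, y, 1) \<noteq> 0"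
    for x y
  proof -
    have c: "aff f x y \<in> curve f" using xy by (simp add: aff_in_curve_iff)
    show ?thesis
      using F(5)[rule_format, OF c aff_self nz(1)] G(5)[rule_format, OF c aff_self nz(2)] aff[OF xy] wpoint_eqD by metis
  qed
  \<comment> \<open>\<open>E\<close> compares the ratios of first and third coordinates;
    \<open>E0\<close> and \<open>E2\<close> compare the second coordinates after scaling by the
    first or the third. The prefactors in \<open>E0\<close> and \<open>E2\<close> make them vanish
    also where one of the two triples defines no point, since nothing is known about
    \<open>F1\<close> and \<open>G1\<close> there.\<close>
  define E where "E = (\<lambda>v. F0 v * G2 v - F2 v * G0 v)"
  define E0 where "E0 = (\<lambda>v. (F0 v * G0 v) * (F1 v * G0 v ^ h - G1 v * F0 v ^ h))"
  define E2 where "E2 = (\<lambda>v. (F2 v * G2 v) * (F1 v * G2 v ^ h - G1 v * F2 v ^ h))"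
  have wE: "wform (weight f) (e + e') E"
    unfolding E_def by (intro wform_diff wform.mult wform_mult'[OF F(3) G(1)] F G) auto
  have wE0: "wform (weight f) ((e + e') + (h * e + h * e')) E0"
    unfolding E0_def
    by (intro wform_diff wform.mult wform_mult'[OF G(2) wform_power[OF F(1)]] wform_power F G) auto
  have wE2: "wform (weight f) ((e + e') + (h * e + h * e')) E2"
    unfolding E2_def
    by (intro wform_diff wform.mult wform_mult'[OF G(2) wform_power[OF F(3)]] wform_power F G) auto
  have z: "E (x, y, 1) = 0 \<and> E0 (x, y, 1) = 0 \<and> E2 (x, y, 1) = 0" if xy: "y ^ 2 = poly f x" for x y
  proof (cases "(F0 (x, y, 1) \<noteq> 0 \<or> F2 (x, y, 1) \<noteq> 0) \<and> (G0 (x, y, 1) \<noteq> 0 \<or> G2 (x, y, 1) \<noteq> 0)")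
    case True
    then obtain t where "F0 (x, y, 1) = t * G0 (x, y, 1)" "F1 (x, y, 1) = t ^ h * G1 (x, y, 1)"
      "F2 (x, y, 1) = t * G2 (x, y, 1)"
      using eq[OF xy] by blast
    then show ?thesis by (simp add: E_def E0_def E2_def power_mult_distrib)
  qed (auto simp: E_def E0_def E2_def)
  have "E ?v = 0" "E0 ?v = 0" "E2 ?v = 0"
    using wform_vanish[OF wE f _ v2] wform_vanish[OF wE0 f _ v2] wform_vanish[OF wE2 f _ v2] z by auto
  then have 1: "F0 ?v * G2 ?v = F2 ?v * G0 ?v"
    "F0 ?v \<noteq> 0 \<Longrightarrow> G0 ?v \<noteq> 0 \<Longrightarrow> F1 ?v * G0 ?v ^ h = G1 ?v * F0 ?v ^ h"
    "F2 ?v \<noteq> 0 \<Longrightarrow> G2 ?v \<noteq> 0 \<Longrightarrow> F1 ?v * G2 ?v ^ h = G1 ?v * F2 ?v ^ h"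
    by (auto simp: E_def E0_def E2_def)
  have "\<exists>t. t \<noteq> 0 \<and> F0 ?v = t * G0 ?v \<and> F1 ?v = t ^ h * G1 ?v \<and> F2 ?v = t * G2 ?v"
  proof (cases "G0 ?v = 0")
    case True
    then have "G2 ?v \<noteq> 0" "F0 ?v = 0" "F2 ?v \<noteq> 0" using F(4) G(4) 1(1) by auto
    then show ?thesis using 1 True
      by (intro exI[of _ "F2 ?v / G2 ?v"]) (auto simp: field_simps)
  next
    case False
    then have "F0 ?v \<noteq> 0" using F(4) 1(1) by auto
    then show ?thesis using 1 False
      by (intro exI[of _ "F0 ?v / G0 ?v"]) (auto simp: field_simps)
  qed
  then have "wpoint h (F0 ?v) (F1 ?v) (F2 ?v) = wpoint h (G0 ?v) (G1 ?v) (G2 ?v)"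
    using wpoint_scale by metis
  then show ?thesis
    using F(5)[rule_format, OF P v F(4)] G(5)[rule_format, OF P v G(4)] by simp
qed

lemma morphism_compose:
  assumes \<phi>: "morphism f f' \<phi>" and \<psi>: "morphism f' f'' \<psi>"
  shows "morphism f f'' (\<lambda>P. \<psi> (\<phi> P))"
  unfolding morphism_def
proof (intro conjI ballI)
  show "(\<lambda>P. \<psi> (\<phi> P)) \<in> curve f \<rightarrow> curve f''"
    using morphism_mem[OF \<phi>] morphism_mem[OF \<psi>] by auto
next
  fix P assume P: "P \<in> curve f"
  define h where "h = weight f''"
  obtain x y z where v: "(x, y, z) \<in> P" using curveE[OF P] by metis
  let ?v = "(x, y, z)"
  obtain e F0 F1 F2 where F: "wform (weight f) e F0" "wform (weight f) (weight f' * e) F1"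
    "wform (weight f) e F2" "F0 ?v \<noteq> 0 \<or> F2 ?v \<noteq> 0"
    "\<forall>Q\<in>curve f. \<forall>v\<in>Q. F0 v \<noteq> 0 \<or> F2 v \<noteq> 0 \<longrightarrow> \<phi> Q = wpoint (weight f') (F0 v) (F1 v) (F2 v)"
    by (rule morphism_formsE[OF \<phi> P v])
  let ?w = "\<lambda>v. (F0 v, F1 v, F2 v)"
  have w: "?w v \<in> \<phi> Q" if "Q \<in> curve f" "v \<in> Q" "F0 v \<noteq> 0 \<or> F2 v \<noteq> 0" for Q v
    using F(5)[rule_format, OF that] by (simp add: wpoint_self)
  obtain e' G0 G1 G2 where G: "wform (weight f') e' G0" "wform (weight f') (h * e') G1"
    "wform (weight f') e' G2" "G0 (?w ?v) \<noteq> 0 \<or> G2 (?w ?v) \<noteq> 0"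
    "\<forall>Q\<in>curve f'. \<forall>v\<in>Q. G0 v \<noteq> 0 \<or> G2 v \<noteq> 0 \<longrightarrow> \<psi> Q = wpoint h (G0 v) (G1 v) (G2 v)"
    by (rule morphism_formsE[OF \<psi> morphism_mem[OF \<phi> P] w[OF P v F(4)], folded h_def])
  \<comment> \<open>The composed forms may be non-zero where \<open>F0\<close> and \<open>F2\<close>
    both vanish, and then they say nothing about the map. Multiplying by \<open>L\<close>, with
    \<open>L^h\<close> in the coordinate of weight \<open>h\<close>, leaves the point unchanged and
    excludes these places.\<close>
  define L where "L = (if F0 ?v \<noteq> 0 then F0 else F2)"
  have L: "wform (weight f) e L" "L ?v \<noteq> 0" "\<And>u. L u \<noteq> 0 \<Longrightarrow> F0 u \<noteq> 0 \<or> F2 u \<noteq> 0"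
    using F(1,3,4) by (auto simp: L_def split: if_splits)
  let ?E0 = "\<lambda>v. L v * G0 (?w v)"
  let ?E1 = "\<lambda>v. L v ^ h * G1 (?w v)"
  let ?E2 = "\<lambda>v. L v * G2 (?w v)"
  have E02: "wform (weight f) (e + e' * e) ?E0" "wform (weight f) (e + e' * e) ?E2"
    by (intro wform.mult L wform_compose[OF G(1) F(1-3)] wform_compose[OF G(3) F(1-3)])+
  have E1: "wform (weight f) (h * (e + e' * e)) ?E1"
    by (rule wform_mult'[OF wform_power[OF L(1)] wform_compose[OF G(2) F(1-3)]])
       (simp add: algebra_simps)
  have eq: "\<psi> (\<phi> Q) = wpoint h (?E0 v) (?E1 v) (?E2 v)"
    if Q: "Q \<in> curve f" "v \<in> Q" and nz: "?E0 v \<noteq> 0 \<or> ?E2 v \<noteq> 0" for Q v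
  proof -
    have "L v \<noteq> 0" using nz by auto
    then have "\<psi> (\<phi> Q) = wpoint h (G0 (?w v)) (G1 (?w v)) (G2 (?w v))"
      using G(5)[rule_format, OF morphism_mem[OF \<phi> Q(1)] w[OF Q]] L(3) nz by auto
    then show ?thesis using \<open>L v \<noteq> 0\<close> by (simp add: wpoint_scale)
  qed
  have nz: "\<exists>v\<in>P. ?E0 v \<noteq> 0 \<or> ?E2 v \<noteq> 0"
    using v L(2) G(4) by (intro bexI[of _ ?v]) auto
  show "\<exists>e F0 F1 F2. wform (weight f) e F0 \<and> wform (weight f) (weight f'' * e) F1 \<and>
      wform (weight f) e F2 \<and> (\<exists>v\<in>P. F0 v \<noteq> 0 \<or> F2 v \<noteq> 0) \<and>
      (\<forall>Q\<in>curve f. \<forall>v\<in>Q. F0 v \<noteq> 0 \<or> F2 v \<noteq> 0 \<longrightarrow>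
         \<psi> (\<phi> Q) = wpoint (weight f'') (F0 v) (F1 v) (F2 v))"
    unfolding h_def[symmetric]
  proof (intro exI conjI)
    show "wform (weight f) (e + e' * e) ?E0" by (rule E02)
    show "wform (weight f) (h * (e + e' * e)) ?E1" by (rule E1)
    show "wform (weight f) (e + e' * e) ?E2" by (rule E02)
    show "\<exists>v\<in>P. ?E0 v \<noteq> 0 \<or> ?E2 v \<noteq> 0" by (rule nz)
    show "\<forall>Q\<in>curve f. \<forall>v\<in>Q. ?E0 v \<noteq> 0 \<or> ?E2 v \<noteq> 0 \<longrightarrow>
        \<psi> (\<phi> Q) = wpoint h (?E0 v) (?E1 v) (?E2 v)"
      by (intro ballI impI eq)
  qed
qed

text \<open>The defect in the equation of the target is itself a form, so checking it on affine
  points is enough to land in the target curve everywhere.\<close>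

lemma global_morphism:
  assumes f: "curve_poly f" "kpoly f'"
    and F: "wform (weight f) e F0" "wform (weight f) (weight f' * e) F1" "wform (weight f) e F2"
    and nz: "\<And>x y z. x \<noteq> 0 \<or> z \<noteq> 0 \<Longrightarrow> y ^ 2 = homog f x z \<Longrightarrow> F0 (x, y, z) \<noteq> 0 \<or> F2 (x, y, z) \<noteq> 0"
    and aff: "\<And>x y. y ^ 2 = poly f x \<Longrightarrow> F1 (x, y, 1) ^ 2 = homog f' (F0 (x, y, 1)) (F2 (x, y, 1))"
    and \<phi>: "\<And>x y z. x \<noteq> 0 \<or> z \<noteq> 0 \<Longrightarrow> y ^ 2 = homog f x z \<Longrightarrow>
      \<phi> (wpoint (weight f) x y z) = wpoint (weight f') (F0 (x, y, z)) (F1 (x, y, z)) (F2 (x, y, z))"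
  shows "morphism f f' \<phi>"
proof -
  define E where "E = (\<lambda>v. F1 v ^ 2 - homog f' (F0 v) (F2 v))"
  have E: "wform (weight f) (2 * (weight f' * e)) E"
    unfolding E_def homog_eq_homogen
    by (intro wform_diff wform_power F wform_compose_homogen[OF f(2) F(1,3)]) simp
  have "E (x, y, z) = 0" if "y ^ 2 = homog f x z" for x y z
    by (rule wform_vanish[OF E f(1) _ that]) (simp add: E_def aff)
  then have "F1 (x, y, z) ^ 2 = homog f' (F0 (x, y, z)) (F2 (x, y, z))" if "y ^ 2 = homog f x z" for x y z
    using that by (simp add: E_def)
  then have mem: "\<phi> P \<in> curve f'" if "P \<in> curve f" for P
    using curveE[OF that] \<phi> nz by (metis wpoint_in_curve)
  have eq: "\<phi> Q = wpoint (weight f') (F0 v) (F1 v) (F2 v)" if "Q \<in> curve f" "v \<in> Q" for Q v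
    using curve_memD[OF that(1)] that(2) \<phi> by (cases v) metis
  have "\<exists>v\<in>P. F0 v \<noteq> 0 \<or> F2 v \<noteq> 0" if "P \<in> curve f" for P
    using curveE[OF that] nz by metis
  then show ?thesis
    unfolding morphism_def using mem eq
    by (intro conjI ballI exI[of _ e] exI[of _ F0] exI[of _ F1] exI[of _ F2] F impI) auto
qed

text \<open>
  If \<open>f' \<circ> A = f V\<^sup>2\<close> with \<open>V \<noteq> 0\<close>, comparing degrees shows that \<open>V(x) y\<close> can be homogenised
  in the weight \<open>weight f' * degree A\<close>; if \<open>A\<close> is constant, then \<open>V = 0\<close>.
\<close>

lemma polynomial_morphism:
  assumes f: "curve_poly f" "kpoly f'"
    and A: "kpoly A" and V: "kpoly V"
    and eq: "f' \<circ>\<^sub>p A = f * V ^ 2"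
  obtains \<phi> where "morphism f f' \<phi>" "on_coords f f' \<phi> (\<lambda>x y. poly A x) (\<lambda>x y. poly V x * y)"
proof -
  define e where "e = Polynomial.degree A"
  define h where "h = weight f"
  define h' where "h' = weight f'"
  have degV: "V = 0 \<or> Polynomial.degree V + h \<le> h' * e"
  proof (cases "V = 0")
    case False
    then have V0: "V \<noteq> 0" .
    have "f \<noteq> 0" using f by (auto simp: curve_poly_def)
    then have "Polynomial.degree f' * e = Polynomial.degree f + 2 * Polynomial.degree V"
      using arg_cong[OF eq, of Polynomial.degree] V0
      by (simp add: degree_pcompose e_def degree_mult_eq degree_power_eq)
    moreover have "Polynomial.degree f' * e \<le> 2 * (h' * e)"
      using deg_le_weight[of f'] mult_le_mono1 unfolding h'_def by (metis mult.assoc)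
    ultimately show ?thesis
      unfolding h_def weight_def[of f] by linarith
  qed simp
  let ?F0 = "\<lambda>(x, y, z). homogen e A x z" 
  let ?F1 = "\<lambda>v. (\<lambda>(x, y, z). y) v * (\<lambda>(x, y, z). homogen (h' * e - h) V x z) v"
  let ?F2 = "\<lambda>v. (\<lambda>(x, y, z). z) v ^ e"
  have F0: "wform h e ?F0" using A by (rule wform_homogen)
  have F1: "wform h (h' * e) ?F1"
  proof (cases "V = 0")
    case True then show ?thesis using wform_0[of h "h' * e"] by (simp add: case_prod_unfold)
  next
    case False
    with degV have "h' * e = h + (h' * e - h)" by simp
    then show ?thesis by (intro wform_mult'[OF wform.y wform_homogen[OF V]])
  qed
  have F2: "wform h e ?F2" using wform_power[OF wform.z, of h e] by simp
  have dV: "Polynomial.degree V \<le> h' * e - h" using degV by auto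
  \<comment> \<open>Any representative may be chosen: the three forms scale by \<open>t^e\<close>,
    \<open>(t^e)^h'\<close> and \<open>t^e\<close>, which does not change the target point.\<close>
  define \<phi> where "\<phi> = (\<lambda>P. let v = (SOME v. v \<in> P) in wpoint h' (?F0 v) (?F1 v) (?F2 v))"
  have \<phi>: "\<phi> (wpoint h x y z) = wpoint h' (?F0 (x, y, z)) (?F1 (x, y, z)) (?F2 (x, y, z))" for x y z
  proof -
    have "(SOME v. v \<in> wpoint h x y z) \<in> wpoint h x y z"
      using wpoint_self[of x y z h] by (rule someI)
    then obtain t where t: "t \<noteq> 0" "(SOME v. v \<in> wpoint h x y z) = (t * x, t ^ h * y, t * z)"
      by (auto simp: mem_wpoint)
    have "?F1 (t * x, t ^ h * y, t * z) = (t ^ e) ^ h' * ?F1 (x, y, z)"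
      using wform_scale[OF F1, of t x y z] by (simp add: mult.commute flip: power_mult)
    then have "\<phi> (wpoint h x y z) = wpoint h' (t ^ e * ?F0 (x, y, z)) ((t ^ e) ^ h' * ?F1 (x, y, z)) (t ^ e * ?F2 (x, y, z))"
      unfolding \<phi>_def Let_def t(2) wform_scale[OF F0] wform_scale[OF F2] by (rule arg_cong)
    also have "\<dots> = wpoint h' (?F0 (x, y, z)) (?F1 (x, y, z)) (?F2 (x, y, z))"
      by (rule wpoint_scale) (use t(1) in simp)
    finally show ?thesis .
  qed
  have "morphism f f' \<phi>"
  proof (rule global_morphism[OF f, where e = e and ?F0.0 = ?F0 and ?F1.0 = ?F1 and ?F2.0 = ?F2, folded h_def h'_def, OF F0 F1 F2])
    fix x y z :: "'a alg_closure" assume "x \<noteq> 0 \<or> z \<noteq> 0"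
    then show "?F0 (x, y, z) \<noteq> 0 \<or> ?F2 (x, y, z) \<noteq> 0"
    proof (cases "z = 0")
      \<comment> \<open>At infinity the first form is the leading coefficient of \<open>A\<close>
        times \<open>x^e\<close>; for \<open>e = 0\<close> the third form is
        \<open>0^0 = 1\<close>.\<close>
      case True
      with \<open>x \<noteq> 0 \<or> z \<noteq> 0\<close> show ?thesis
        by (cases "e = 0") (auto simp: homogen_z0 e_def)
    qed auto
  next
    fix x y assume xy: "y ^ 2 = poly f x"
    have "poly f' (poly A x) = poly f x * poly V x ^ 2"
      using arg_cong[OF eq, of "\<lambda>p. poly p x"] by (simp add: poly_pcompose)
    then show "?F1 (x, y, 1) ^ 2 = homog f' (?F0 (x, y, 1)) (?F2 (x, y, 1))"
      using xy dV by (simp add: homogen_z1 e_def power_mult_distrib)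
  qed (rule \<phi>)
  moreover have "on_coords f f' \<phi> (\<lambda>x y. poly A x) (\<lambda>x y. poly V x * y)"
    using \<phi>[of _ _ 1] dV unfolding on_coords_def aff_def h_def[symmetric] h'_def[symmetric]
    by (simp add: homogen_z1 e_def mult.commute)
  ultimately show thesis using that by blast
qed

section \<open>Finite groups in fields\<close>

lemma poly_zero_of_card_roots:
  fixes P :: "'a::idom poly"
  assumes "Polynomial.degree P < card S" "\<And>x. x \<in> S \<Longrightarrow> poly P x = 0"
  shows "P = 0"
proof (rule ccontr)
  assume P: "P \<noteq> 0"
  have "card S \<le> card {x. poly P x = 0}"
    using assms(2) by (intro card_mono poly_roots_finite[OF P]) auto
  with card_poly_roots_bound[OF P] assms(1) show False by simp
qed

lemma degree_minus_const:
  fixes P :: "'a::comm_ring_1 poly"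
  assumes "Polynomial.degree P > 0"
  shows "Polynomial.degree (P - [:c:]) = Polynomial.degree P"
  unfolding diff_conv_add_uminus
  using assms by (intro degree_add_eq_left) simp

text \<open>Equal leading coefficients push the degree of \<open>P - Q\<close> below the number of
  its roots in \<open>S\<close>; being monic is only the typical case.\<close>

lemma monic_poly_eqI:
  fixes P Q :: "'a::idom poly"
  assumes "Polynomial.degree P = card S" "Polynomial.degree Q = card S" "lead_coeff P = lead_coeff Q"
    "\<And>x. x \<in> S \<Longrightarrow> poly P x = poly Q x" "card S > 0"
  shows "P = Q"
proof -
  have "Polynomial.degree (P - Q) \<le> card S"
    using assms(1,2) by (intro degree_diff_le) auto
  moreover have "Polynomial.coeff (P - Q) (card S) = 0"
    using assms(1-3) by simp
  ultimately have "Polynomial.degree (P - Q) < card S"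
    using assms(5) by (metis degree_0 leading_coeff_0_iff le_neq_implies_less)
  then have "P - Q = 0"
    by (rule poly_zero_of_card_roots) (use assms(4) in simp)
  then show ?thesis by simp
qed

lemma degree_prod_linear:
  "(\<And>i. i \<in> S \<Longrightarrow> (b i :: 'a::idom) \<noteq> 0) \<Longrightarrow> Polynomial.degree (\<Prod>i\<in>S. [:a i, b i:]) = card S"
  by (subst degree_prod_sum_eq) auto

lemma lead_coeff_prod_linear:
  "(\<And>i. i \<in> S \<Longrightarrow> (b i :: 'a::idom) \<noteq> 0) \<Longrightarrow> lead_coeff (\<Prod>i\<in>S. [:a i, b i:]) = (\<Prod>i\<in>S. b i)"
  unfolding lead_coeff_prod by (intro prod.cong) auto

text \<open>A generic point has \<open>card G\<close> distinct images, at which \<open>r\<close> takes the same value.\<close>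

lemma constant_of_invariant:
  fixes \<alpha> \<beta> :: "'g \<Rightarrow> 'a::alg_closed_field"
  assumes fin: "finite G" and inj: "inj_on (\<lambda>g. (\<alpha> g, \<beta> g)) G"
    and deg: "Polynomial.degree r < card G"
    and inv: "\<And>g x. g \<in> G \<Longrightarrow> poly r (\<alpha> g * x + \<beta> g) = poly r x"
  shows "\<exists>c. r = [:c:]"
proof -
  define B where "B = (\<Union>g\<in>G. \<Union>h\<in>G - {g}. {x. \<alpha> g * x + \<beta> g = \<alpha> h * x + \<beta> h})"
  have "finite {x. \<alpha> g * x + \<beta> g = \<alpha> h * x + \<beta> h}" if "g \<in> G" "h \<in> G - {g}" for g h
  proof (cases "\<alpha> g = \<alpha> h")
    case True
    with that inj have "\<beta> g \<noteq> \<beta> h" by (auto simp: inj_on_def)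
    with True show ?thesis by auto
  next
    case False
    then have "{x. \<alpha> g * x + \<beta> g = \<alpha> h * x + \<beta> h} \<subseteq> {(\<beta> h - \<beta> g) / (\<alpha> g - \<alpha> h)}"
      by (auto simp: field_simps)
    then show ?thesis using finite_subset by blast
  qed
  then have "finite B" unfolding B_def using fin by auto
  then obtain x where x: "x \<notin> B"
    using infinite_UNIV_alg_closed by (metis UNIV_I finite_subset subsetI)
  have "inj_on (\<lambda>g. \<alpha> g * x + \<beta> g) G"
    using x by (auto simp: inj_on_def B_def)
  then have "card ((\<lambda>g. \<alpha> g * x + \<beta> g) ` G) = card G"
    by (rule card_image)
  moreover have "Polynomial.degree (r - [:poly r x:]) \<le> Polynomial.degree r"
    by (rule degree_diff_le) auto
  ultimately have "r - [:poly r x:] = 0"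
    using deg inv by (intro poly_zero_of_card_roots[of _ "(\<lambda>g. \<alpha> g * x + \<beta> g) ` G"]) auto
  then show ?thesis by (metis eq_iff_diff_eq_0)
qed

text \<open>Multiplication by \<open>a\<close> permutes \<open>M\<close>; compare the product of all
  elements before and after. This is Lagrange's theorem for a finite multiplicatively closed
  set.\<close>

lemma power_card_mult_closed:
  fixes M :: "'a::field set"
  assumes "finite M" "0 \<notin> M" "\<And>a b. a \<in> M \<Longrightarrow> b \<in> M \<Longrightarrow> a * b \<in> M" "a \<in> M"
  shows "a ^ card M = 1"
proof -
  have a: "a \<noteq> 0" using assms by auto
  have inj: "inj_on ((*) a) M" using a by (auto simp: inj_on_def)
  have "(*) a ` M = M"
    by (rule endo_inj_surj[OF assms(1) _ inj]) (use assms in auto)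
  then have "prod id M = prod id ((*) a ` M)" by simp
  also have "\<dots> = (\<Prod>b\<in>M. a * b)" by (simp add: prod.reindex[OF inj])
  also have "\<dots> = a ^ card M * prod id M" by (simp add: prod.distrib)
  finally have "prod id M = a ^ card M * prod id M" .
  moreover have "prod id M \<noteq> 0" using assms(1,2) by auto
  ultimately show ?thesis by simp
qed

lemma card_roots_of_unity_le:
  fixes M :: "'a::field set"
  assumes "0 < j" "\<And>a. a \<in> M \<Longrightarrow> a ^ j = 1"
  shows "card M \<le> j"
proof (rule ccontr)
  assume "\<not> card M \<le> j"
  define P where "P = Polynomial.monom (1::'a) j + [:- 1:]"
  have d: "Polynomial.degree P = j"
    unfolding P_def using assms(1) by (subst degree_add_eq_left) (auto simp: degree_monom_eq)
  have "P = 0"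
    using \<open>\<not> card M \<le> j\<close> d assms(2) by (intro poly_zero_of_card_roots[of P M]) (auto simp: P_def poly_monom)
  with d assms(1) show False by simp
qed

text \<open>A form of Wilson's theorem: the elements of \<open>M\<close> are exactly the roots of
  \<open>X^n - 1\<close> with \<open>n = card M\<close>, and the constant term gives their
  product.\<close>

lemma prod_mult_closed:
  fixes M :: "'a::field set"
  assumes "finite M" "0 \<notin> M" "\<And>a b. a \<in> M \<Longrightarrow> b \<in> M \<Longrightarrow> a * b \<in> M" "M \<noteq> {}"
  shows "(\<Prod>a\<in>M. a) = (- 1) ^ (card M - 1)"
proof -
  define n where "n = card M"
  have n: "n > 0" using assms by (simp add: n_def card_gt_0_iff)
  define P where "P = Polynomial.monom (1::'a) n + [:- 1:]"
  have d: "Polynomial.degree P = n"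
    unfolding P_def using n by (subst degree_add_eq_left) (auto simp: degree_monom_eq)
  have "(\<Prod>a\<in>M. [:- a, 1:]) = P"
  proof (rule monic_poly_eqI[of _ M])
    show "lead_coeff (\<Prod>a\<in>M. [:- a, 1:]) = lead_coeff P"
      by (subst lead_coeff_prod_linear) (use n in \<open>auto simp: d, auto simp: P_def coeff_pCons split: nat.splits\<close>)
    show "poly (\<Prod>a\<in>M. [:- a, 1:]) x = poly P x" if "x \<in> M" for x
      using that assms(1) power_card_mult_closed[OF assms(1-3) that]
      by (auto simp: P_def poly_prod poly_monom n_def intro!: prod_zero)
  qed (use n d in \<open>auto simp: degree_prod_linear n_def\<close>)
  from arg_cong[OF this, of "\<lambda>P. poly P 0"] have "(\<Prod>a\<in>M. - a) = - 1"
    using n by (simp add: P_def poly_prod poly_monom)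
  moreover have "(\<Prod>a\<in>M. - a) = (- 1) ^ n * (\<Prod>a\<in>M. a)"
    unfolding n_def by (subst prod_uminus) simp_all
  ultimately have "(- 1) ^ n * (\<Prod>a\<in>M. a) = - 1" by simp
  then have "(- 1) ^ n * ((- 1) ^ n * (\<Prod>a\<in>M. a)) = (- 1) ^ n * (- 1)" by simp
  then have "(\<Prod>a\<in>M. a) = - ((- 1) ^ n)"
    by (simp flip: mult.assoc power_mult_distrib)
  also have "\<dots> = (- 1) ^ (n - 1)" using n by (cases n) auto
  finally show ?thesis by (simp add: n_def)
qed

text \<open>Take a largest subgroup \<open>S\<close> of \<open>p\<close>-power order. If some
  \<open>t\<close> were missing, adjoining the multiples of \<open>t\<close> would give a subgroup
  with \<open>p\<close> times as many elements.\<close>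

lemma card_additive_group:
  fixes T :: "'a::field set"
  assumes fin: "finite T" and "0 \<in> T" and add: "\<And>s t. s \<in> T \<Longrightarrow> t \<in> T \<Longrightarrow> s + t \<in> T"
    and p: "CHAR('a) = p" "p > 0"
  shows "\<exists>e. card T = p ^ e"
proof -
  define good where "good S \<longleftrightarrow> S \<subseteq> T \<and> 0 \<in> S \<and> (\<forall>s\<in>S. \<forall>t\<in>S. s + t \<in> S) \<and> (\<forall>t\<in>S. - t \<in> S)
    \<and> (\<exists>e. card S = p ^ e)" for S
  have "good {0}" using assms(2) by (auto simp: good_def intro: exI[of _ 0])
  moreover have "\<forall>S. good S \<longrightarrow> card S < Suc (card T)"
    using fin by (auto simp: good_def less_Suc_eq_le intro: card_mono)
  ultimately obtain S where S: "good S" "\<And>S'. good S' \<Longrightarrow> card S' \<le> card S"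
    using ex_has_greatest_nat[of good "{0}" card "Suc (card T)"] by (auto simp: less_imp_le)
  have "S = T"
  proof (rule ccontr)
    assume "S \<noteq> T"
    then obtain t where t: "t \<in> T" "t \<notin> S" using S(1) by (auto simp: good_def)
    have prime: "prime p" using p prime_CHAR_semidom[where 'a = 'a] by simp
    have S1: "s + s' \<in> S" "- s \<in> S" "0 \<in> S" if "s \<in> S" "s' \<in> S" for s s'
      using S(1) that by (auto simp: good_def)
    have finS: "finite S" using S(1) fin finite_subset by (auto simp: good_def)
    have mul: "of_nat n * s \<in> S" if "s \<in> S" for n s
      using that S1 S(1) by (induction n) (auto simp: algebra_simps good_def)
    have mulT: "of_nat n * t \<in> T" for n
      using t(1) assms(2) add by (induction n) (auto simp: algebra_simps)
    define S' where "S' = (\<lambda>(s, i). s + of_nat i * t) ` (S \<times> {..<p})"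
    have key: "i = j" if ij: "s + of_nat i * t = s' + of_nat j * t" "s \<in> S" "s' \<in> S" "i < p" "j < p" "i \<le> j"
      for s s' i j
    proof (rule ccontr)
      assume "i \<noteq> j"
      have "of_nat (j - i) * t = s - s'" using ij(1,6) by (simp add: of_nat_diff algebra_simps)
      then have 1: "of_nat (j - i) * t \<in> S" using S1(1,2) ij by (metis add_uminus_conv_diff)
      have "coprime (j - i) p"
      proof -
        have "\<not> p dvd j - i" using \<open>i \<noteq> j\<close> ij by (auto dest: dvd_imp_le)
        then show ?thesis using prime prime_imp_coprime coprime_commute by blast
      qed
      \<comment> \<open>Bezout inverts \<open>j - i\<close> modulo \<open>p\<close>, so
        \<open>t\<close> would be a multiple of an element of \<open>S\<close>.\<close>
      then obtain u v where uv: "u * (j - i) = v * p + 1"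
        using coprime_bezout_strong[of "j - i" p] prime
        by (metis mult.commute not_prime_1)
      have "of_nat u * (of_nat (j - i) * t) = of_nat (u * (j - i)) * t" by (simp add: mult.assoc)
      also have "\<dots> = t" unfolding uv by (simp add: p(1)[symmetric] algebra_simps)
      finally have eq: "of_nat u * (of_nat (j - i) * t) = t" .
      show False using mul[OF 1, of u] t(2) unfolding eq by simp
    qed
    have "inj_on (\<lambda>(s, i). s + of_nat i * t) (S \<times> {..<p})"
    proof (rule inj_onI)
      fix a b assume ab: "a \<in> S \<times> {..<p}" "b \<in> S \<times> {..<p}"
        "(case a of (s, i) \<Rightarrow> s + of_nat i * t) = (case b of (s, i) \<Rightarrow> s + of_nat i * t)"
      obtain s i s' j where eq: "a = (s, i)" "b = (s', j)" by (cases a, cases b)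
      have h: "s \<in> S" "s' \<in> S" "i < p" "j < p" "s + of_nat i * t = s' + of_nat j * t"
        using ab by (auto simp: eq)
      have "i = j" using key[of s i s' j] key[of s' j s i] h by (cases "i \<le> j") auto
      with h show "a = b" by (simp add: eq)
    qed
    then have card: "card S' = card S * p" unfolding S'_def by (subst card_image) (auto simp: card_cartesian_product)
    have mem: "s + of_nat n * t \<in> S'" if "s \<in> S" for s n
    proof -
      have "of_nat n = (of_nat (n mod p) :: 'a)"
        using p(1) by (metis of_nat_CHAR add.right_neutral mult_zero_left of_nat_add of_nat_mult div_mult_mod_eq mult_zero_right add_0)
      then show ?thesis using that p(2) unfolding S'_def
        by (intro image_eqI[of _ _ "(s, n mod p)"]) auto
    qed
    have "good S'" unfolding good_def
    proof (intro conjI ballI)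
      show "S' \<subseteq> T" using S(1) mulT add by (auto simp: S'_def good_def)
      show "0 \<in> S'" using mem[of 0 0] S1 S(1) by (auto simp: good_def)
      show "\<exists>e. card S' = p ^ e"
        using S(1) card by (metis good_def power_Suc2)
    next
      fix a b assume "a \<in> S'" "b \<in> S'"
      then obtain s i s' j where "s \<in> S" "s' \<in> S" "a = s + of_nat i * t" "b = s' + of_nat j * t"
        by (auto simp: S'_def)
      then show "a + b \<in> S'" using mem[of "s + s'" "i + j"] S1 by (simp add: algebra_simps)
    next
      fix a assume "a \<in> S'"
      then obtain s i where s: "s \<in> S" "i < p" "a = s + of_nat i * t" by (auto simp: S'_def)
      have "of_nat (p - i) = (- of_nat i :: 'a)"
        using s(2) by (simp add: of_nat_diff p(1)[symmetric])
      then show "- a \<in> S'" using mem[of "- s" "p - i"] s S1 by (simp add: algebra_simps)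
    qed
    then have "card S * p \<le> card S" using S(2) card by metis
    moreover have "card S > 0" using S1 finS S(1) by (auto simp: good_def card_gt_0_iff)
    ultimately show False using prime_gt_1_nat[OF prime] by simp
  qed
  with S(1) show ?thesis by (auto simp: good_def)
qed

section \<open>Finite groups of affine maps\<close>

text \<open>The elements of \<open>G\<close> are mere labels of coefficient triples. The group laws
  are stated as existence of labels with the right coefficients, so no composition on
  \<open>G\<close> is needed; \<open>faithful\<close> says that the action on \<open>X\<close> alone
  determines the label.\<close>

locale affine_chars =
  fixes G :: "'g set" and \<alpha> \<beta> \<gamma> :: "'g \<Rightarrow> 'a::alg_closed_field"
  assumes finite_G: "finite G"
    and ex_one: "\<exists>e\<in>G. \<alpha> e = 1 \<and> \<beta> e = 0 \<and> \<gamma> e = 1"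
    and ex_mult: "g \<in> G \<Longrightarrow> h \<in> G \<Longrightarrow>
      \<exists>k\<in>G. \<alpha> k = \<alpha> g * \<alpha> h \<and> \<beta> k = \<alpha> g * \<beta> h + \<beta> g \<and> \<gamma> k = \<gamma> g * \<gamma> h"
    and ex_inverse: "g \<in> G \<Longrightarrow> \<exists>k\<in>G. \<alpha> k * \<alpha> g = 1 \<and> \<alpha> k * \<beta> g + \<beta> k = 0 \<and> \<gamma> k * \<gamma> g = 1"
    and faithful: "g \<in> G \<Longrightarrow> h \<in> G \<Longrightarrow> \<alpha> g = \<alpha> h \<Longrightarrow> \<beta> g = \<beta> h \<Longrightarrow> g = h"
    and odd_char: "CHAR('a) > 2"
begin

abbreviation act :: "'g \<Rightarrow> 'a \<Rightarrow> 'a" where "act g x \<equiv> \<alpha> g * x + \<beta> g"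

definition I :: "'a poly" where "I = (\<Prod>g\<in>G. [:\<beta> g, \<alpha> g:])"
text \<open>The leading coefficient of \<open>I\<close>. It turns out to be a sign and accounts for
  the signs in the model of the quotient.\<close>

definition \<epsilon> :: 'a where "\<epsilon> = (\<Prod>g\<in>G. \<alpha> g)"
text \<open>The kernel of \<alpha>, identified with an additive subgroup of the field.\<close>

definition T :: "'a set" where "T = \<beta> ` {g \<in> G. \<alpha> g = 1}"
text \<open>The group of multipliers; its order will be the number \<open>m\<close> of the
  theorem.\<close>

definition M :: "'a set" where "M = \<alpha> ` G"
definition U :: "'a set" where "U = {u. \<exists>g\<in>G. \<not> (\<alpha> g = 1 \<and> \<beta> g = 0) \<and> act g u = u}"
definition W :: "'a poly" where "W = (\<Prod>u\<in>U. [:- u, 1:])"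
definition lam :: 'a where "lam = (\<Prod>u\<in>U. u)"

lemma prime_char: "prime (CHAR('a))"
  using prime_CHAR_semidom[where 'a = 'a] odd_char by simp

lemma alpha_nz: "g \<in> G \<Longrightarrow> \<alpha> g \<noteq> 0" and gamma_nz: "g \<in> G \<Longrightarrow> \<gamma> g \<noteq> 0"
  using ex_inverse by fastforce+

lemma inj_coeffs: "inj_on (\<lambda>g. (\<alpha> g, \<beta> g)) G"
  using faithful by (auto simp: inj_on_def)

lemma card_G_pos: "card G > 0"
  using ex_one finite_G by (auto simp: card_gt_0_iff)

lemma act_inj: "g \<in> G \<Longrightarrow> act g x = act g y \<longleftrightarrow> x = y"
  using alpha_nz by auto

text \<open>The map \<pi> is right multiplication by \<open>g\<close>, chosen through
  \<open>ex_mult\<close>; its injectivity rests on \<open>faithful\<close>.\<close>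

lemma right_mult_bij:
  assumes "g \<in> G"
  obtains \<pi> where "bij_betw \<pi> G G" "\<And>h x. h \<in> G \<Longrightarrow> act (\<pi> h) x = act h (act g x)"
proof -
  obtain \<pi> where \<pi>: "\<And>h. h \<in> G \<Longrightarrow> \<pi> h \<in> G \<and> \<alpha> (\<pi> h) = \<alpha> h * \<alpha> g \<and> \<beta> (\<pi> h) = \<alpha> h * \<beta> g + \<beta> h"
    using ex_mult[OF _ assms] by metis
  have "inj_on \<pi> G"
  proof (rule inj_onI)
    fix h k assume h: "h \<in> G" "k \<in> G" "\<pi> h = \<pi> k"
    then have "\<alpha> h * \<alpha> g = \<alpha> k * \<alpha> g" "\<alpha> h * \<beta> g + \<beta> h = \<alpha> k * \<beta> g + \<beta> k" using \<pi> by metis+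
    then have "\<alpha> h = \<alpha> k" "\<beta> h = \<beta> k" using alpha_nz[OF assms] by auto
    with h faithful show "h = k" by blast
  qed
  moreover have "\<pi> ` G = G"
    by (rule endo_inj_surj[OF finite_G _ \<open>inj_on \<pi> G\<close>]) (use \<pi> in auto)
  ultimately show thesis
    using \<pi> by (intro that[of \<pi>]) (auto simp: bij_betw_def algebra_simps)
qed

lemma prod_act:
  assumes "g \<in> G"
  shows "(\<Prod>h\<in>G. F (act h (act g x))) = (\<Prod>h\<in>G. F (act h x))"
proof -
  obtain \<pi> where \<pi>: "bij_betw \<pi> G G" "\<And>h x. h \<in> G \<Longrightarrow> act (\<pi> h) x = act h (act g x)"
    using right_mult_bij[OF assms] by metis
  have "(\<Prod>h\<in>G. F (act h x)) = (\<Prod>h\<in>G. F (act (\<pi> h) x))"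
    by (rule prod.reindex_bij_betw[OF \<pi>(1), symmetric])
  then show ?thesis using \<pi>(2) by simp
qed

lemma poly_I: "poly I x = (\<Prod>g\<in>G. act g x)"
  by (simp add: I_def poly_prod mult.commute add.commute)

lemma I_act: "g \<in> G \<Longrightarrow> poly I (act g x) = poly I x"
  unfolding poly_I by (rule prod_act[where F = "\<lambda>x. x"])

lemma degree_I: "Polynomial.degree I = card G"
  unfolding I_def by (rule degree_prod_linear) (rule alpha_nz)

lemma lead_coeff_I: "Polynomial.coeff I (card G) = \<epsilon>"
  using lead_coeff_prod_linear[of G \<alpha> \<beta>] alpha_nz degree_I by (simp add: I_def \<epsilon>_def)

lemma I_0: "poly I 0 = 0"
  using ex_one finite_G by (auto simp: poly_I intro: prod_zero)

text \<open>Inversion permutes \<open>G\<close>, so the product of all multipliers equals the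
  product of their inverses.\<close>

lemma \<epsilon>_square: "\<epsilon> * \<epsilon> = 1"
proof -
  obtain \<iota> where \<iota>: "\<And>g. g \<in> G \<Longrightarrow> \<iota> g \<in> G \<and> \<alpha> (\<iota> g) * \<alpha> g = 1 \<and> \<alpha> (\<iota> g) * \<beta> g + \<beta> (\<iota> g) = 0"
    using ex_inverse by metis
  have inj: "inj_on \<iota> G"
  proof (rule inj_onI)
    fix g h assume h: "g \<in> G" "h \<in> G" "\<iota> g = \<iota> h"
    have "\<alpha> (\<iota> g) * \<alpha> g = \<alpha> (\<iota> g) * \<alpha> h" "\<alpha> (\<iota> g) * \<beta> g = \<alpha> (\<iota> g) * \<beta> h"
      using \<iota>[OF h(1)] \<iota>[OF h(2)] h(3) by (auto simp: add_eq_0_iff2)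
    then show "g = h" using alpha_nz[of "\<iota> g"] \<iota>[OF h(1)] h faithful by auto
  qed
  have "\<iota> ` G = G"
    by (rule endo_inj_surj[OF finite_G _ inj]) (use \<iota> in auto)
  then have "\<epsilon> = (\<Prod>g\<in>\<iota> ` G. \<alpha> g)" by (simp add: \<epsilon>_def)
  also have "\<dots> = (\<Prod>g\<in>G. \<alpha> (\<iota> g))" by (simp add: prod.reindex[OF inj])
  finally have "\<epsilon> * \<epsilon> = (\<Prod>g\<in>G. \<alpha> (\<iota> g) * \<alpha> g)" by (simp add: \<epsilon>_def prod.distrib)
  also have "\<dots> = 1" using \<iota> by (intro prod.neutral) auto
  finally show ?thesis .
qed

lemma \<epsilon>_nz: "\<epsilon> \<noteq> 0" using \<epsilon>_square by auto

lemma \<epsilon>_cases: "\<epsilon> = 1 \<or> \<epsilon> = - 1"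
  using \<epsilon>_square by (simp add: square_eq_1_iff)

lemma poly_constant_of_act:
  assumes "Polynomial.degree r < card G" "\<And>g x. g \<in> G \<Longrightarrow> poly r (act g x) = poly r x"
  shows "\<exists>c. r = [:c:]"
  using constant_of_invariant[OF finite_G inj_coeffs assms] .

lemma degree_pcompose_act: "g \<in> G \<Longrightarrow> Polynomial.degree (P \<circ>\<^sub>p [:\<beta> g, \<alpha> g:]) = Polynomial.degree P"
  using alpha_nz by (simp add: degree_pcompose)

lemma poly_pcompose_act: "poly (P \<circ>\<^sub>p [:\<beta> g, \<alpha> g:]) x = poly P (act g x)"
  by (simp add: poly_pcompose algebra_simps)

text \<open>Division with remainder by \<open>I\<close> is compatible with the action, so the remainder is constant.\<close>

lemma invariant_poly:
  assumes "\<And>g x. g \<in> G \<Longrightarrow> poly u (act g x) = poly u x"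
  shows "\<exists>\<mu>. u = \<mu> \<circ>\<^sub>p I"
  using assms
proof (induction "Polynomial.degree u" arbitrary: u rule: less_induct)
  case less
  show ?case
  proof (cases "Polynomial.degree u < card G")
    case True
    then obtain c where "u = [:c:]" using poly_constant_of_act[OF _ less.prems] by blast
    then show ?thesis by (intro exI[of _ "[:c:]"]) (simp add: pcompose_const)
  next
    case False
    define s where "s = u div I"
    define r where "r = u mod I"
    have u: "u = s * I + r" by (simp add: s_def r_def)
    have I0: "I \<noteq> 0" using degree_I card_G_pos by auto
    have dr: "Polynomial.degree r < card G"
      using degree_mod_less[OF I0, of u] card_G_pos by (auto simp: r_def degree_I)
    have inv: "s \<circ>\<^sub>p [:\<beta> g, \<alpha> g:] = s \<and> r \<circ>\<^sub>p [:\<beta> g, \<alpha> g:] = r" if g: "g \<in> G" for g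
    proof -
      let ?A = "[:\<beta> g, \<alpha> g:]"
      have "I \<circ>\<^sub>p ?A = I"
        by (rule poly_eq_cofinite[of "{}"]) (auto simp only: poly_pcompose_act I_act[OF g])
      moreover have "u \<circ>\<^sub>p ?A = u"
        by (rule poly_eq_cofinite[of "{}"]) (auto simp only: poly_pcompose_act less.prems[OF g])
      ultimately have eq: "(s \<circ>\<^sub>p ?A - s) * I = r - r \<circ>\<^sub>p ?A"
        using arg_cong[OF u, of "\<lambda>u. u \<circ>\<^sub>p ?A"] u by (simp add: pcompose_add pcompose_mult algebra_simps)
      have "Polynomial.degree (r - r \<circ>\<^sub>p ?A) < card G"
        using degree_diff_le_max[of r "r \<circ>\<^sub>p ?A"] dr degree_pcompose_act[OF g, of r] by simp
      \<comment> \<open>The left side of \<open>eq\<close> is a multiple of \<open>I\<close>, the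
        right side has smaller degree than \<open>I\<close>: both are zero.\<close>
      then have "s \<circ>\<^sub>p ?A - s = 0"
        using eq I0 degree_I degree_mult_eq[of "s \<circ>\<^sub>p ?A - s" I] by (metis le_add2 not_le)
      with eq show ?thesis by simp
    qed
    have "Polynomial.degree s < Polynomial.degree u"
      using False card_G_pos degree_I degree_div_less[of u I] I0 by (auto simp: s_def)
    moreover have "poly s (act g x) = poly s x" if "g \<in> G" for g x
      using inv[OF that] poly_pcompose_act[of s g x] by simp
    ultimately obtain \<mu> where \<mu>: "s = \<mu> \<circ>\<^sub>p I" using less.hyps by blast
    have "poly r (act g x) = poly r x" if "g \<in> G" for g x
      using inv[OF that] poly_pcompose_act[of r g x] by simp
    then obtain c where "r = [:c:]" using poly_constant_of_act[OF dr] by blast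
    then have "u = (pCons c \<mu>) \<circ>\<^sub>p I" using u \<mu> by (simp add: pcompose_pCons algebra_simps)
    then show ?thesis by blast
  qed
qed

section \<open>The multipliers and the translations of the group\<close>

lemma M_facts: "finite M" "0 \<notin> M" "M \<noteq> {}" "1 \<in> M" "\<And>a b. a \<in> M \<Longrightarrow> b \<in> M \<Longrightarrow> a * b \<in> M"
proof -
  show "finite M" "0 \<notin> M" using finite_G alpha_nz by (auto simp: M_def)
  show "1 \<in> M" using ex_one by (force simp: M_def)
  then show "M \<noteq> {}" by auto
  show "a * b \<in> M" if "a \<in> M" "b \<in> M" for a b
  proof -
    obtain g h where gh: "g \<in> G" "h \<in> G" "a = \<alpha> g" "b = \<alpha> h"
      using \<open>a \<in> M\<close> \<open>b \<in> M\<close> by (auto simp: M_def)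
    then obtain k where "k \<in> G" "\<alpha> k = a * b" using ex_mult[of g h] by blast
    then show ?thesis unfolding M_def by (intro image_eqI[of _ _ k]) auto
  qed
qed

lemma card_M_pos: "card M > 0" using M_facts by (simp add: card_gt_0_iff)

lemma pow_card_M: "g \<in> G \<Longrightarrow> \<alpha> g ^ card M = 1"
  using power_card_mult_closed[OF M_facts(1,2,5)] by (auto simp: M_def)

lemma finite_T: "finite T" using finite_G by (simp add: T_def)

lemma T_E: "t \<in> T \<Longrightarrow> \<exists>g\<in>G. \<alpha> g = 1 \<and> \<beta> g = t" by (auto simp: T_def)

lemma T_I: "g \<in> G \<Longrightarrow> \<alpha> g = 1 \<Longrightarrow> \<beta> g = t \<Longrightarrow> t \<in> T" by (auto simp: T_def)

lemma T_0: "0 \<in> T" using ex_one T_I by blast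

lemma T_add: "s \<in> T \<Longrightarrow> t \<in> T \<Longrightarrow> s + t \<in> T"
proof -
  assume "s \<in> T" "t \<in> T"
  then obtain g h where "g \<in> G" "\<alpha> g = 1" "\<beta> g = s" "h \<in> G" "\<alpha> h = 1" "\<beta> h = t" using T_E by metis
  then show ?thesis using ex_mult[of g h] T_I by (fastforce simp: add.commute)
qed

lemma T_minus: "t \<in> T \<Longrightarrow> - t \<in> T"
proof -
  assume "t \<in> T"
  then obtain g where g: "g \<in> G" "\<alpha> g = 1" "\<beta> g = t" using T_E by metis
  then obtain k where "k \<in> G" "\<alpha> k = 1" "t + \<beta> k = 0" using ex_inverse[of g] by auto
  then show ?thesis using T_I minus_unique by metis
qed

lemma T_diff: "s \<in> T \<Longrightarrow> t \<in> T \<Longrightarrow> s - t \<in> T"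
  using T_add[of s "- t"] T_minus by simp

lemma ex_quot:
  assumes "g \<in> G" "h \<in> G"
  obtains k where "k \<in> G" "\<alpha> k = \<alpha> g / \<alpha> h" "\<beta> k = \<beta> g - \<alpha> g / \<alpha> h * \<beta> h" "\<gamma> k = \<gamma> g / \<gamma> h"
proof -
  obtain i where i: "i \<in> G" "\<alpha> i * \<alpha> h = 1" "\<alpha> i * \<beta> h + \<beta> i = 0" "\<gamma> i * \<gamma> h = 1"
    using ex_inverse[OF assms(2)] by blast
  obtain k where k: "k \<in> G" "\<alpha> k = \<alpha> g * \<alpha> i" "\<beta> k = \<alpha> g * \<beta> i + \<beta> g" "\<gamma> k = \<gamma> g * \<gamma> i"
    using ex_mult[OF assms(1) i(1)] by blast
  have "\<alpha> i = 1 / \<alpha> h" "\<gamma> i = 1 / \<gamma> h" "\<beta> i = - (\<alpha> i * \<beta> h)"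
    using i by (auto simp: eq_divide_eq add_eq_0_iff2)
  with k show thesis by (intro that[of k]) (auto simp: algebra_simps)
qed

text \<open>Conjugating the translation by \<open>t\<close> with \<open>g\<close> gives the
  translation by \<open>\<alpha> g * t\<close>.\<close>

lemma T_scale:
  assumes "g \<in> G" "t \<in> T"
  shows "\<alpha> g * t \<in> T"
proof -
  obtain h where h: "h \<in> G" "\<alpha> h = 1" "\<beta> h = t" using T_E assms(2) by metis
  obtain k where k: "k \<in> G" "\<alpha> k = \<alpha> g * \<alpha> h" "\<beta> k = \<alpha> g * \<beta> h + \<beta> g" using ex_mult[OF assms(1) h(1)] by blast
  obtain l where "l \<in> G" "\<alpha> l = \<alpha> k / \<alpha> g" "\<beta> l = \<beta> k - \<alpha> k / \<alpha> g * \<beta> g" using ex_quot[OF k(1) assms(1)] by metis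
  then show ?thesis using k h alpha_nz[OF assms(1)] by (intro T_I[of l]) auto
qed

lemma card_T_pos: "card T > 0" using finite_T T_0 by (auto simp: card_gt_0_iff)

lemma inj_beta_fibre: "inj_on \<beta> {g \<in> G. \<alpha> g = \<zeta>}"
  by (auto simp: inj_on_def intro: faithful)

text \<open>The fibres of \<alpha> are the cosets of the translation subgroup, so they all have
  \<open>card T\<close> elements.\<close>

lemma fibre_image:
  assumes "h \<in> G"
  shows "\<beta> ` {g \<in> G. \<alpha> g = \<alpha> h} = (\<lambda>t. \<beta> h + t) ` T"
proof (intro equalityI subsetI)
  fix b assume "b \<in> \<beta> ` {g \<in> G. \<alpha> g = \<alpha> h}"
  then obtain g where g: "g \<in> G" "\<alpha> g = \<alpha> h" "b = \<beta> g" by auto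
  obtain k where "k \<in> G" "\<alpha> k = \<alpha> g / \<alpha> h" "\<beta> k = \<beta> g - \<alpha> g / \<alpha> h * \<beta> h" using ex_quot[OF g(1) assms] by metis
  then have "b - \<beta> h \<in> T" using g alpha_nz[OF assms] by (intro T_I[of k]) auto
  then show "b \<in> (\<lambda>t. \<beta> h + t) ` T" by (intro image_eqI[of _ _ "b - \<beta> h"]) auto
next
  fix b assume "b \<in> (\<lambda>t. \<beta> h + t) ` T"
  then obtain t where "t \<in> T" "b = \<beta> h + t" by auto
  moreover obtain g where g: "g \<in> G" "\<alpha> g = 1" "\<beta> g = t" using T_E \<open>t \<in> T\<close> by metis
  ultimately show "b \<in> \<beta> ` {g \<in> G. \<alpha> g = \<alpha> h}"
    using ex_mult[OF g(1) assms] by (auto simp: image_iff)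
qed

lemma card_fibre: "\<zeta> \<in> M \<Longrightarrow> card {g \<in> G. \<alpha> g = \<zeta>} = card T"
proof -
  assume "\<zeta> \<in> M"
  then obtain h where h: "h \<in> G" "\<zeta> = \<alpha> h" by (auto simp: M_def)
  have "card {g \<in> G. \<alpha> g = \<zeta>} = card (\<beta> ` {g \<in> G. \<alpha> g = \<zeta>})"
    by (rule card_image[symmetric]) (rule inj_beta_fibre)
  also have "\<dots> = card T" unfolding h(2) fibre_image[OF h(1)] by (rule card_image) auto
  finally show ?thesis .
qed

lemma prod_G: "(\<Prod>g\<in>G. F g) = (\<Prod>\<zeta>\<in>M. \<Prod>g | g \<in> G \<and> \<alpha> g = \<zeta>. F g)"
  using prod.group[OF finite_G M_facts(1), of \<alpha> F] by (simp add: M_def)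

lemma card_G: "card G = card M * card T"
proof -
  have "(\<Sum>\<zeta>\<in>M. \<Sum>g | g \<in> G \<and> \<alpha> g = \<zeta>. 1) = (\<Sum>g\<in>G. (1::nat))"
    by (rule sum.group[OF finite_G M_facts(1)]) (simp add: M_def)
  then show ?thesis by (simp add: card_fibre)
qed

lemma card_T_power: "\<exists>e. card T = CHAR('a) ^ e"
  using card_additive_group[OF finite_T T_0 T_add refl] odd_char by simp

lemma odd_card_T: "odd (card T)"
proof -
  have "odd (CHAR('a))" using prime_char odd_char prime_odd_nat by blast
  then show ?thesis using card_T_power by auto
qed

text \<open>If \<open>card M = p * j\<close>, then \<open>(a^j)^p = 1\<close> for all
  \<open>a\<close> in \<open>M\<close>, and Frobenius gives \<open>a^j = 1\<close>: too many roots
  of \<open>X^j - 1\<close>.\<close>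

lemma char_not_dvd_card_M: "\<not> CHAR('a) dvd card M"
proof
  assume "CHAR('a) dvd card M"
  then obtain j where j: "card M = CHAR('a) * j" by (auto elim: dvdE)
  then have j0: "j > 0" using card_M_pos by (auto intro: Nat.gr0I)
  have "a ^ j = 1" if a: "a \<in> M" for a
  proof -
    have "a ^ (j * CHAR('a)) = 1"
      using power_card_mult_closed[OF M_facts(1,2,5) a] j by (simp add: mult.commute)
    then have "(a ^ j) ^ CHAR('a) = 1" by (simp add: power_mult)
    moreover have "(a ^ j - 1) ^ CHAR('a) + 1 ^ CHAR('a) = (a ^ j - 1 + 1) ^ CHAR('a)"
      by (rule freshmans_dream[symmetric]) (use prime_char in auto)
    ultimately have "(a ^ j - 1) ^ CHAR('a) = 0" by simp
    then show ?thesis by auto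
  qed
  then have "card M \<le> j" by (rule card_roots_of_unity_le[OF j0])
  with j j0 odd_char show False by simp
qed

text \<open>Every multiplier is taken \<open>card T\<close> times, the multipliers have product
  \<open>(- 1) ^ (card M - 1)\<close>, and \<open>card T\<close> is odd. This is the sign in the
  model for non-trivial \<gamma>; \<open>\<epsilon>_eq'\<close> provides the one for trivial
  \<gamma>.\<close>

lemma \<epsilon>_eq: "\<epsilon> = (- 1) ^ (card M - 1)"
proof -
  have "\<epsilon> = (\<Prod>\<zeta>\<in>M. \<Prod>g | g \<in> G \<and> \<alpha> g = \<zeta>. \<zeta>)"
    unfolding \<epsilon>_def prod_G by (intro prod.cong) auto
  also have "\<dots> = (\<Prod>\<zeta>\<in>M. \<zeta> ^ card T)" by (intro prod.cong) (auto simp: card_fibre)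
  also have "\<dots> = ((- 1) ^ (card M - 1)) ^ card T"
    using prod_mult_closed[OF M_facts(1,2,5,3)] by (simp flip: prod_power_distrib)
  also have "\<dots> = ((- 1) ^ card T) ^ (card M - 1)" by (simp add: mult.commute flip: power_mult)
  finally show ?thesis using odd_card_T by simp
qed

lemma \<epsilon>_eq': "\<epsilon> = (- 1) ^ (card G - 1)"
proof -
  have "even (card G) \<longleftrightarrow> even (card M)" using odd_card_T by (simp add: card_G)
  then have "even (card G - 1) \<longleftrightarrow> even (card M - 1)"
    using card_G_pos card_M_pos by (simp add: even_diff_nat)
  then show ?thesis unfolding \<epsilon>_eq by (simp add: minus_one_power_iff)
qed

text \<open>\<open>I\<close> is constant on the orbit of \<open>r\<close>. If the orbit is free, it
  therefore supplies as many roots of \<open>I - I(r)\<close> as the degree allows.\<close>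

lemma orbit_poly:
  assumes inj: "inj_on (\<lambda>g. act g r) G"
  shows "I - [:poly I r:] = Polynomial.smult \<epsilon> (\<Prod>y\<in>(\<lambda>g. act g r) ` G. [:- y, 1:])"
    "poly I r = (\<Prod>y\<in>(\<lambda>g. act g r) ` G. y)" "card ((\<lambda>g. act g r) ` G) = card G"
proof -
  let ?O = "(\<lambda>g. act g r) ` G"
  show c: "card ?O = card G" by (rule card_image[OF inj])
  show "poly I r = (\<Prod>y\<in>?O. y)" unfolding poly_I by (simp add: prod.reindex[OF inj])
  have d: "Polynomial.degree (\<Prod>y\<in>?O. [:- y, 1:]) = card G"
    by (subst degree_prod_linear) (auto simp: c)
  have l: "lead_coeff (\<Prod>y\<in>?O. [:- y, 1:]) = 1"
    by (subst lead_coeff_prod_linear) auto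
  have dI: "Polynomial.degree (I - [:poly I r:]) = card G"
    by (simp add: degree_minus_const degree_I card_G_pos)
  show "I - [:poly I r:] = Polynomial.smult \<epsilon> (\<Prod>y\<in>?O. [:- y, 1:])"
  proof (rule monic_poly_eqI[of _ ?O])
    show "lead_coeff (I - [:poly I r:]) = lead_coeff (Polynomial.smult \<epsilon> (\<Prod>y\<in>?O. [:- y, 1:]))"
      using l lead_coeff_I dI card_G_pos by (simp add: coeff_pCons split: nat.splits)
    show "poly (I - [:poly I r:]) x = poly (Polynomial.smult \<epsilon> (\<Prod>y\<in>?O. [:- y, 1:])) x" if "x \<in> ?O" for x
      using that I_act finite_G by (auto simp: poly_prod)
  qed (use dI d c card_G_pos \<epsilon>_nz in auto)
qed

end

section \<open>Fixed points\<close>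

context affine_chars begin

lemma act_mult:
  assumes "g \<in> G" "h \<in> G"
  obtains k where "k \<in> G" "\<And>x. act k x = act g (act h x)" "\<alpha> k = \<alpha> g * \<alpha> h"
  using ex_mult[OF assms] that by (auto simp: algebra_simps)

lemma fixed_alpha:
  assumes "g \<in> G" "act g u = u" "\<not> (\<alpha> g = 1 \<and> \<beta> g = 0)"
  shows "\<alpha> g \<noteq> 1" "u = \<beta> g / (1 - \<alpha> g)"
proof -
  show 1: "\<alpha> g \<noteq> 1" using assms by auto
  have "(1 - \<alpha> g) * u = \<beta> g" using assms(2) by (simp add: algebra_simps)
  with 1 show "u = \<beta> g / (1 - \<alpha> g)" by (simp add: field_simps)
qed

lemma U_I: "g \<in> G \<Longrightarrow> \<alpha> g \<noteq> 1 \<Longrightarrow> \<beta> g / (1 - \<alpha> g) \<in> U"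
  unfolding U_def
proof (intro CollectI bexI conjI)
  assume g: "g \<in> G" "\<alpha> g \<noteq> 1"
  then have "1 - \<alpha> g \<noteq> 0" by simp
  then show "act g (\<beta> g / (1 - \<alpha> g)) = \<beta> g / (1 - \<alpha> g)" by (simp add: divide_simps) (simp add: algebra_simps)
qed auto

lemma finite_U: "finite U"
proof -
  have "U \<subseteq> (\<lambda>g. \<beta> g / (1 - \<alpha> g)) ` G"
    using fixed_alpha(2) unfolding U_def by blast
  then show ?thesis using finite_G finite_surj by blast
qed

lemma U_act:
  assumes g: "g \<in> G" and u: "u \<in> U"
  shows "act g u \<in> U"
proof -
  obtain h where h: "h \<in> G" "act h u = u" "\<alpha> h \<noteq> 1" using u fixed_alpha(1) unfolding U_def by blast
  obtain k where k: "k \<in> G" "\<And>x. act k x = act g (act h x)" "\<alpha> k = \<alpha> g * \<alpha> h" using act_mult[OF g h(1)] by metis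
  \<comment> \<open>\<open>l\<close> is the conjugate of \<open>h\<close> by \<open>g\<close>, which
    fixes the image of \<open>u\<close> and has the multiplier of \<open>h\<close>.\<close>
  obtain l where l: "l \<in> G" "\<alpha> l = \<alpha> k / \<alpha> g" "\<beta> l = \<beta> k - \<alpha> k / \<alpha> g * \<beta> g" using ex_quot[OF k(1) g] by metis
  have "act l (act g u) = (\<alpha> k / \<alpha> g * \<alpha> g) * u + \<beta> k" by (simp add: l algebra_simps)
  also have "\<dots> = act k u" using alpha_nz[OF g] by simp
  also have "\<dots> = act g u" by (simp only: k(2) h(2))
  finally have "act l (act g u) = act g u" .
  moreover have "\<alpha> l \<noteq> 1" using l k h alpha_nz[OF g] by simp
  ultimately show ?thesis using l(1) unfolding U_def by blast
qed

lemma act_inj_on: "g \<in> G \<Longrightarrow> inj_on (act g) S"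
  by (rule inj_onI) (simp only: act_inj)

lemma U_act_image: "g \<in> G \<Longrightarrow> act g ` U = U"
  by (rule endo_inj_surj[OF finite_U _ act_inj_on]) (use U_act in auto)

text \<open>\<open>T\<close> is stable under multiplication by \<open>\<alpha> g\<close>, hence by
  \<open>1 - \<alpha> g\<close>; the latter is injective and \<open>T\<close> is finite, so it
  permutes \<open>T\<close>.\<close>

lemma scaled_T:
  assumes g: "g \<in> G" "\<alpha> g \<noteq> 1" and t: "(1 - \<alpha> g) * x \<in> T"
  shows "x \<in> T"
proof -
  have "(\<lambda>t. (1 - \<alpha> g) * t) ` T = T"
  proof (rule endo_inj_surj[OF finite_T])
    show "(\<lambda>t. (1 - \<alpha> g) * t) ` T \<subseteq> T"
      using T_diff T_scale[OF g(1)] by (auto simp: algebra_simps)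
    show "inj_on (\<lambda>t. (1 - \<alpha> g) * t) T" using g(2) by (auto simp: inj_on_def)
  qed
  then obtain s where "s \<in> T" "(1 - \<alpha> g) * x = (1 - \<alpha> g) * s" using t by (metis imageE)
  with g(2) show ?thesis by simp
qed

text \<open>
  If \<open>g\<close>, \<open>h\<close> have multipliers \<open>\<zeta>\<close>, \<open>\<eta>\<close> and fixed points \<open>u\<close>, \<open>v\<close>, then their commutator is
  the translation by \<open>(1 - \<zeta>) (1 - \<eta>) (u - v)\<close>.
\<close>

lemma U_diff:
  assumes "u \<in> U" "v \<in> U"
  shows "u - v \<in> T"
proof -
  obtain g where g: "g \<in> G" "act g u = u" "\<alpha> g \<noteq> 1" using assms(1) fixed_alpha(1) unfolding U_def by blast
  obtain h where h: "h \<in> G" "act h v = v" "\<alpha> h \<noteq> 1" using assms(2) fixed_alpha(1) unfolding U_def by blast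
  obtain k where k: "k \<in> G" "\<alpha> k = \<alpha> g * \<alpha> h" "\<beta> k = \<alpha> g * \<beta> h + \<beta> g" using ex_mult[OF g(1) h(1)] by blast
  obtain l where l: "l \<in> G" "\<alpha> l = \<alpha> h * \<alpha> g" "\<beta> l = \<alpha> h * \<beta> g + \<beta> h" using ex_mult[OF h(1) g(1)] by blast
  obtain i where i: "i \<in> G" "\<alpha> i = \<alpha> k / \<alpha> l" "\<beta> i = \<beta> k - \<alpha> k / \<alpha> l * \<beta> l" using ex_quot[OF k(1) l(1)] by metis
  have b: "\<beta> g = (1 - \<alpha> g) * u" "\<beta> h = (1 - \<alpha> h) * v" using g(2) h(2) by (simp_all add: algebra_simps)
  have "\<alpha> i = 1" using i k l alpha_nz[OF g(1)] alpha_nz[OF h(1)] by simp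
  moreover have "\<beta> i = (1 - \<alpha> g) * ((1 - \<alpha> h) * (u - v))"
    using i(2,3) \<open>\<alpha> i = 1\<close> k(3) l(3) b by (simp add: algebra_simps)
  ultimately have "(1 - \<alpha> g) * ((1 - \<alpha> h) * (u - v)) \<in> T" using i(1) T_I by blast
  then show ?thesis using scaled_T g h by blast
qed

lemma U_translate: "u \<in> U \<Longrightarrow> t \<in> T \<Longrightarrow> u + t \<in> U"
proof -
  assume u: "u \<in> U" "t \<in> T"
  then obtain g where "g \<in> G" "\<alpha> g = 1" "\<beta> g = t" using T_E by metis
  then show ?thesis using U_act[of g u] u by simp
qed

lemma U_eq: "u \<in> U \<Longrightarrow> U = (\<lambda>t. u + t) ` T"
proof (intro equalityI subsetI)
  fix v assume "u \<in> U" "v \<in> U"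
  then show "v \<in> (\<lambda>t. u + t) ` T" using U_diff[of v u] by (intro image_eqI[of _ _ "v - u"]) auto
qed (use U_translate in auto)

lemma card_U: "U \<noteq> {} \<Longrightarrow> card U = card T"
proof -
  assume "U \<noteq> {}"
  then obtain u where "u \<in> U" by blast
  from U_eq[OF this] show ?thesis using card_image[of "\<lambda>t. u + t" T] by simp
qed

text \<open>Multiplication by \<open>\<alpha> g\<close> permutes \<open>T - {0}\<close>; compare
  products. Because of this, \<open>W\<close>, whose degree is \<open>card T\<close> if
  \<open>U\<close> is non-empty, transforms by \<alpha> itself.\<close>

lemma alpha_pow_card_T:
  assumes "g \<in> G"
  shows "\<alpha> g ^ card T = \<alpha> g"
proof -
  have inj: "inj_on ((*) (\<alpha> g)) (T - {0})" using alpha_nz[OF assms] by (auto simp: inj_on_def)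
  have "(*) (\<alpha> g) ` (T - {0}) = T - {0}"
    by (rule endo_inj_surj[OF _ _ inj]) (use finite_T T_scale[OF assms] alpha_nz[OF assms] in auto)
  then have "\<Prod>(T - {0}) = \<Prod>((*) (\<alpha> g) ` (T - {0}))" by simp
  also have "\<dots> = (\<Prod>t\<in>T - {0}. \<alpha> g * t)" by (simp add: prod.reindex[OF inj])
  also have "\<dots> = \<alpha> g ^ card (T - {0}) * \<Prod>(T - {0})" by (simp add: prod.distrib)
  finally have "\<alpha> g ^ card (T - {0}) = 1" using finite_T by auto
  moreover have "card T = Suc (card (T - {0}))"
    using T_0 finite_T card_T_pos by (simp add: card_Diff_singleton)
  ultimately show ?thesis by simp
qed

section \<open>The semi-invariant polynomial of the fixed points\<close>

lemma poly_W: "poly W x = (\<Prod>u\<in>U. x - u)"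
  by (simp add: W_def poly_prod)

lemma degree_W: "Polynomial.degree W = card U"
  unfolding W_def by (rule degree_prod_linear) simp

lemma lead_coeff_W: "lead_coeff W = 1"
  unfolding W_def by (subst lead_coeff_prod_linear) auto

lemma W_nz: "W \<noteq> 0" using lead_coeff_W by auto

lemma poly_W_eq_0: "poly W x = 0 \<longleftrightarrow> x \<in> U"
  using finite_U by (auto simp: poly_W)

lemma W_act:
  assumes "g \<in> G" "U \<noteq> {}"
  shows "poly W (act g x) = \<alpha> g * poly W x"
proof -
  have "poly W (act g x) = (\<Prod>u\<in>act g ` U. act g x - u)"
    using U_act_image[OF assms(1)] by (simp add: poly_W)
  also have "\<dots> = (\<Prod>u\<in>U. \<alpha> g * (x - u))"
    unfolding prod.reindex[OF act_inj_on[OF assms(1)]] by (simp add: algebra_simps)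
  also have "\<dots> = \<alpha> g ^ card U * poly W x" by (simp add: prod.distrib poly_W)
  finally show ?thesis using alpha_pow_card_T assms card_U by simp
qed

text \<open>For every \<open>v\<close> in \<open>U\<close> the set \<open>U\<close> is
  \<open>v + T\<close>, so the left side takes the value \<open>lam\<close> at \<open>v\<close>,
  where \<open>W\<close> vanishes. Both sides are monic of degree \<open>card U\<close>.\<close>

lemma translates_poly:
  assumes "U \<noteq> {}"
  shows "(\<Prod>t\<in>T. [:t, 1:]) = W + [:lam:]"
proof (rule monic_poly_eqI[of _ U])
  obtain u where u: "u \<in> U" using assms by blast
  have c: "card T > 0" "card U = card T" using card_T_pos card_U[OF assms] by auto
  have dW: "Polynomial.degree (W + [:lam:]) = card U"
    using c degree_W by (subst degree_add_eq_left) auto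
  show "Polynomial.degree (\<Prod>t\<in>T. [:t, 1:]) = card U" "Polynomial.degree (W + [:lam:]) = card U" "card U > 0"
    using c dW by (auto simp: degree_prod_linear)
  have "lead_coeff (\<Prod>t\<in>T. [:t, 1:]) = 1" by (subst lead_coeff_prod_linear) auto
  moreover have "lead_coeff (W + [:lam:]) = lead_coeff W"
    using c dW degree_W by (simp add: coeff_pCons split: nat.splits)
  ultimately show "lead_coeff (\<Prod>t\<in>T. [:t, 1:]) = lead_coeff (W + [:lam:])" by (simp add: lead_coeff_W)
  fix v assume v: "v \<in> U"
  have "lam = (\<Prod>t\<in>T. v + t)"
    unfolding lam_def by (subst U_eq[OF v]) (simp add: prod.reindex)
  moreover have "poly W v = 0" using v by (simp add: poly_W_eq_0)
  ultimately show "poly (\<Prod>t\<in>T. [:t, 1:]) v = poly (W + [:lam:]) v"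
    by (simp add: poly_prod add.commute)
qed

text \<open>For each multiplier, the elements with this multiplier carry \<open>u\<close>
  bijectively onto \<open>U\<close> and contribute one factor \<open>lam\<close>.\<close>

lemma prod_orbit_U:
  assumes "u \<in> U"
  shows "poly I u = lam ^ card M"
proof -
  have ne: "U \<noteq> {}" using assms by auto
  have "(\<Prod>g | g \<in> G \<and> \<alpha> g = \<zeta>. act g u) = lam" if "\<zeta> \<in> M" for \<zeta>
  proof -
    let ?F = "{g \<in> G. \<alpha> g = \<zeta>}"
    have inj: "inj_on (\<lambda>g. act g u) ?F" by (auto simp: inj_on_def intro: faithful)
    have "(\<lambda>g. act g u) ` ?F = U"
    proof (rule card_subset_eq[OF finite_U])
      show "(\<lambda>g. act g u) ` ?F \<subseteq> U" using U_act assms by auto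
      show "card ((\<lambda>g. act g u) ` ?F) = card U"
        using card_image[OF inj] card_fibre[OF that] card_U[OF ne] by auto
    qed
    then have "lam = (\<Prod>y\<in>(\<lambda>g. act g u) ` ?F. y)" by (simp add: lam_def)
    also have "\<dots> = (\<Prod>g\<in>?F. act g u)" unfolding prod.reindex[OF inj] by simp
    finally show ?thesis by simp
  qed
  then show ?thesis unfolding poly_I prod_G by simp
qed

text \<open>Both sides are invariant of degree \<open>card G\<close> with leading coefficient \<open>\<epsilon>\<close>.\<close>

lemma I_eq_W:
  assumes "U \<noteq> {}"
  shows "I = Polynomial.smult \<epsilon> (W ^ card M) + [:lam ^ card M:]"
proof -
  obtain u where u: "u \<in> U" using assms by blast
  define r where "r = I - Polynomial.smult \<epsilon> (W ^ card M)"
  have d: "Polynomial.degree (Polynomial.smult \<epsilon> (W ^ card M)) = card G"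
    using \<epsilon>_nz W_nz by (simp add: degree_power_eq degree_W card_G card_U[OF assms] mult.commute)
  have "Polynomial.coeff (W ^ card M) (card G) = 1"
    using lead_coeff_power[of W "card M"] d \<epsilon>_nz by (simp add: lead_coeff_W)
  then have "Polynomial.coeff r (card G) = 0" by (simp add: r_def lead_coeff_I)
  moreover have "Polynomial.degree r \<le> card G"
    unfolding r_def using d degree_I by (intro degree_diff_le) auto
  ultimately have "Polynomial.degree r < card G"
    using card_G_pos by (metis degree_0 leading_coeff_0_iff le_neq_implies_less)
  moreover have "poly r (act g x) = poly r x" if "g \<in> G" for g x
    using pow_card_M[OF that] that assms by (simp add: r_def I_act W_act power_mult_distrib)
  ultimately obtain c where c: "r = [:c:]" using poly_constant_of_act by blast
  have "poly r u = lam ^ card M"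
    using prod_orbit_U[OF u] u card_M_pos by (simp add: r_def poly_W_eq_0)
  with c have "c = lam ^ card M" by simp
  then have "I - Polynomial.smult \<epsilon> (W ^ card M) = [:lam ^ card M:]" using c by (simp add: r_def)
  then show ?thesis by (simp only: diff_eq_eq add.commute)
qed

end

section \<open>The character \<open>\<gamma>\<close>\<close>

locale affine_curve = affine_chars G \<alpha> \<beta> \<gamma>
  for G :: "'g set" and \<alpha> \<beta> \<gamma> :: "'g \<Rightarrow> 'a::alg_closed_field" +
  fixes c :: 'a and R :: "'a set" and f :: "'a poly"
  defines "f \<equiv> Polynomial.smult c (\<Prod>r\<in>R. [:- r, 1:])"
  assumes finite_R: "finite R" and R_nonempty: "R \<noteq> {}" and c_nz: "c \<noteq> 0"
    and f_act: "g \<in> G \<Longrightarrow> poly f (\<alpha> g * x + \<beta> g) = \<gamma> g ^ 2 * poly f x"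
begin

lemma poly_f: "poly f x = c * (\<Prod>r\<in>R. x - r)"
  by (simp add: f_def poly_prod)

lemma poly_f_eq_0: "poly f x = 0 \<longleftrightarrow> x \<in> R"
  using finite_R c_nz by (auto simp: poly_f)

lemma f_nz: "f \<noteq> 0"
  using c_nz finite_R by (auto simp: f_def)

lemma R_act: "g \<in> G \<Longrightarrow> r \<in> R \<Longrightarrow> act g r \<in> R"
  using f_act[of g r] by (simp flip: poly_f_eq_0)

text \<open>The \<open>p\<close>-th power of a translation acts trivially on \<open>X\<close>, so by
  \<open>faithful\<close> it is the identity and \<open>\<gamma> g ^ p = 1\<close>. Leading
  coefficients in the transformation law of \<open>f\<close> give \<open>\<gamma> g ^ 2 = 1\<close>,
  and \<open>p\<close> is odd.\<close>

lemma \<gamma>_of_translation: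
  assumes "g \<in> G" "\<alpha> g = 1"
  shows "\<gamma> g = 1"
proof -
  define p where "p = CHAR('a)"
  have "\<exists>k\<in>G. \<alpha> k = 1 \<and> \<beta> k = of_nat n * \<beta> g \<and> \<gamma> k = \<gamma> g ^ n" for n
  proof (induction n)
    case 0
    then show ?case using ex_one by simp
  next
    case (Suc n)
    then obtain k where "k \<in> G" "\<alpha> k = 1" "\<beta> k = of_nat n * \<beta> g" "\<gamma> k = \<gamma> g ^ n" by blast
    then show ?case using ex_mult[OF assms(1), of k] assms(2) by (auto simp: algebra_simps)
  qed
  from this[of p] obtain k where k: "k \<in> G" "\<alpha> k = 1" "\<beta> k = 0" "\<gamma> k = \<gamma> g ^ p" by (auto simp: p_def)
  obtain e where e: "e \<in> G" "\<alpha> e = 1" "\<beta> e = 0" "\<gamma> e = 1" using ex_one by blast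
  have "k = e" by (rule faithful) (simp_all add: k e)
  then have gp: "\<gamma> g ^ p = 1" using k e by simp
  have "f \<circ>\<^sub>p [:\<beta> g, 1:] = Polynomial.smult (\<gamma> g ^ 2) f"
    by (rule poly_eq_cofinite[of "{}"]) (use f_act[OF assms(1)] assms(2) in \<open>auto simp: poly_pcompose add.commute\<close>)
  moreover have "lead_coeff (f \<circ>\<^sub>p [:\<beta> g, 1:]) = lead_coeff f"
    by (subst lead_coeff_comp) auto
  ultimately have "\<gamma> g ^ 2 * lead_coeff f = lead_coeff f" by (simp only: lead_coeff_smult)
  then have g2: "\<gamma> g ^ 2 = 1" using f_nz by simp
  have "odd p" unfolding p_def using prime_char odd_char prime_odd_nat by blast
  then obtain j where "p = 2 * j + 1" by (auto elim: oddE)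
  with gp have "\<gamma> g * (\<gamma> g ^ 2) ^ j = 1" by (simp add: power_mult)
  with g2 show ?thesis by simp
qed

text \<open>
  Cancel \<open>X - r\<close>, of which \<open>r\<close> is a simple root, in \<open>f(\<alpha> X + \<beta>) = \<gamma>\<^sup>2 f(X)\<close>, and evaluate at \<open>r\<close>.
\<close>

lemma \<gamma>_of_fixed_root:
  assumes g: "g \<in> G" and r: "r \<in> R" "act g r = r"
  shows "\<gamma> g ^ 2 = \<alpha> g"
proof -
  define h where "h = (\<Prod>s\<in>R - {r}. [:- s, 1:])"
  have h: "poly f x = c * ((x - r) * poly h x)" for x
    using prod.remove[OF finite_R r(1), of "\<lambda>s. x - s"] by (simp add: poly_f h_def poly_prod)
  have hr: "poly h r \<noteq> 0" using finite_R by (auto simp: h_def poly_prod)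
  have "Polynomial.smult (\<alpha> g) (h \<circ>\<^sub>p [:\<beta> g, \<alpha> g:]) = Polynomial.smult (\<gamma> g ^ 2) h"
  proof (rule poly_eq_cofinite[of "{r}"])
    fix x assume x: "x \<notin> {r}"
    have "act g x - r = act g x - act g r" using r by simp
    also have "\<dots> = \<alpha> g * (x - r)" by (simp add: algebra_simps)
    finally have "\<alpha> g * (x - r) * poly h (act g x) = \<gamma> g ^ 2 * ((x - r) * poly h x)"
      using f_act[OF g, of x] c_nz by (simp add: h)
    then have "\<alpha> g * poly h (act g x) = \<gamma> g ^ 2 * poly h x" using x by simp
    then show "poly (Polynomial.smult (\<alpha> g) (h \<circ>\<^sub>p [:\<beta> g, \<alpha> g:])) x = poly (Polynomial.smult (\<gamma> g ^ 2) h) x"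
      unfolding poly_smult poly_pcompose_act .
  qed simp
  from arg_cong[OF this, of "\<lambda>p. poly p r"] have "\<alpha> g * poly h r = \<gamma> g ^ 2 * poly h r"
    unfolding poly_smult poly_pcompose_act r(2) .
  with hr show ?thesis by simp
qed

lemma \<gamma>_of_fixed_nonroot:
  assumes "g \<in> G" "u \<notin> R" "act g u = u"
  shows "\<gamma> g ^ 2 = 1"
  using f_act[OF assms(1), of u] assms by (simp add: poly_f_eq_0)

text \<open>The quotient of \<open>g\<close> and \<open>h\<close> is a translation. So \<gamma> is
  in effect a character of \<open>M\<close>.\<close>

lemma \<gamma>_of_\<alpha>:
  assumes "g \<in> G" "h \<in> G" "\<alpha> g = \<alpha> h"
  shows "\<gamma> g = \<gamma> h"
proof -
  obtain k where "k \<in> G" "\<alpha> k = \<alpha> g / \<alpha> h" "\<gamma> k = \<gamma> g / \<gamma> h" using ex_quot[OF assms(1,2)] by metis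
  then show ?thesis
    using \<gamma>_of_translation[of k] assms alpha_nz[OF assms(2)] gamma_nz[OF assms(2)] by simp
qed

lemma fixed_point: "g \<in> G \<Longrightarrow> \<alpha> g \<noteq> 1 \<Longrightarrow> \<exists>u\<in>U. act g u = u"
proof (rule bexI[of _ "\<beta> g / (1 - \<alpha> g)"])
  assume g: "g \<in> G" "\<alpha> g \<noteq> 1"
  then have "1 - \<alpha> g \<noteq> 0" by simp
  then show "act g (\<beta> g / (1 - \<alpha> g)) = \<beta> g / (1 - \<alpha> g)" by (simp add: divide_simps) (simp add: algebra_simps)
qed (rule U_I)

text \<open>The translations alone already act transitively on \<open>U\<close>. Hence
  \<open>U\<close> lies in \<open>R\<close> or is disjoint from it.\<close>

lemma U_orbit:
  assumes "u \<in> U"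
  shows "(\<lambda>g. act g u) ` G = U"
proof (intro equalityI subsetI)
  fix v assume "v \<in> U"
  then have "v - u \<in> T" using U_diff assms by blast
  then obtain g where "g \<in> G" "\<alpha> g = 1" "\<beta> g = v - u" using T_E by metis
  then show "v \<in> (\<lambda>g. act g u) ` G" by (intro image_eqI[of _ _ g]) auto
qed (use U_act assms in auto)

lemma U_cases: "U \<subseteq> R \<or> U \<inter> R = {}"
proof (cases "U \<inter> R = {}")
  case False
  then obtain u where u: "u \<in> U" "u \<in> R" by blast
  have "U \<subseteq> R" unfolding U_orbit[OF u(1), symmetric] using R_act u(2) by auto
  then show ?thesis ..
qed simp

lemma \<gamma>_square_of_U_subset:
  assumes "U \<subseteq> R" "g \<in> G"
  shows "\<gamma> g ^ 2 = \<alpha> g"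
proof (cases "\<alpha> g = 1")
  case True
  then show ?thesis using \<gamma>_of_translation assms by simp
next
  case False
  then obtain u where "u \<in> U" "act g u = u" using fixed_point assms(2) by blast
  then show ?thesis using \<gamma>_of_fixed_root assms by blast
qed

lemma \<gamma>_square_of_U_disjoint:
  assumes "U \<inter> R = {}" "g \<in> G"
  shows "\<gamma> g ^ 2 = 1"
proof (cases "\<alpha> g = 1")
  case True
  then show ?thesis using \<gamma>_of_translation assms by simp
next
  case False
  then obtain u where "u \<in> U" "act g u = u" using fixed_point assms(2) by blast
  then show ?thesis using \<gamma>_of_fixed_nonroot assms by blast
qed

text \<open>Here \<open>\<gamma>\<close> embeds \<open>M\<close> in a group of order \<open>card M\<close> of square roots of its elements.\<close>

lemma odd_case:
  assumes "U \<subseteq> R"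
  shows "odd (card M)" "g \<in> G \<Longrightarrow> \<gamma> g * \<alpha> g ^ (card M div 2) = 1"
proof -
  define \<Gamma> where "\<Gamma> = \<gamma> ` G"
  have sq: "\<gamma> g ^ 2 = \<alpha> g" if "g \<in> G" for g using \<gamma>_square_of_U_subset[OF assms that] .
  have "bij_betw (\<lambda>x. x ^ 2) \<Gamma> M"
    unfolding bij_betw_def
  proof
    show "inj_on (\<lambda>x. x ^ 2) \<Gamma>" unfolding \<Gamma>_def by (auto simp: inj_on_def sq intro: \<gamma>_of_\<alpha>)
    show "(\<lambda>x. x ^ 2) ` \<Gamma> = M" unfolding \<Gamma>_def M_def by (auto simp: image_image sq)
  qed
  then have card: "card \<Gamma> = card M" by (rule bij_betw_same_card)
  have "a * b \<in> \<Gamma>" if ab: "a \<in> \<Gamma>" "b \<in> \<Gamma>" for a b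
  proof -
    obtain g h where gh: "g \<in> G" "h \<in> G" "a = \<gamma> g" "b = \<gamma> h" using ab by (auto simp: \<Gamma>_def)
    obtain k where "k \<in> G" "\<gamma> k = a * b" using ex_mult[OF gh(1,2)] gh by auto
    then show ?thesis by (auto simp: \<Gamma>_def intro: image_eqI[of _ _ k])
  qed
  then have pow: "\<gamma> g ^ card M = 1" if "g \<in> G" for g
    unfolding card[symmetric] using finite_G gamma_nz that
    by (intro power_card_mult_closed) (auto simp: \<Gamma>_def)
  \<comment> \<open>If \<open>card M = 2 j\<close>, then every multiplier is
    \<open>\<gamma> g ^ 2\<close>, and its \<open>j\<close>-th power is
    \<open>\<gamma> g ^ (2 j) = 1\<close>: too many roots of \<open>X^j - 1\<close>.\<close>
  show odd: "odd (card M)"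
  proof
    assume "even (card M)"
    then obtain j where j: "card M = 2 * j" by (auto elim: evenE)
    have "a ^ j = 1" if a: "a \<in> M" for a
    proof -
      obtain g where g: "g \<in> G" "a = \<alpha> g" using a by (auto simp: M_def)
      have "a ^ j = \<gamma> g ^ (2 * j)" unfolding g(2) sq[OF g(1), symmetric] by (simp add: power_mult)
      then show ?thesis using pow[OF g(1)] j by simp
    qed
    then have "card M \<le> j" using j card_M_pos by (intro card_roots_of_unity_le) auto
    with j card_M_pos show False by simp
  qed
  show "\<gamma> g * \<alpha> g ^ (card M div 2) = 1" if g: "g \<in> G"
  proof -
    have "\<gamma> g * \<alpha> g ^ (card M div 2) = \<gamma> g * (\<gamma> g ^ 2) ^ (card M div 2)" using sq[OF g] by simp
    also have "\<dots> = \<gamma> g ^ (1 + 2 * (card M div 2))" by (simp add: power_mult)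
    also have "1 + 2 * (card M div 2) = card M" using odd by simp
    finally show ?thesis using pow[OF g] by simp
  qed
qed

text \<open>
  Here \<open>\<gamma>\<close> is a non-trivial quadratic character of \<open>M\<close>. Its kernel has order \<open>j = card M div 2\<close>, so it
  consists of all solutions of \<open>a\<^sup>j = 1\<close>, and \<open>a\<^sup>j = -1\<close> on the rest of \<open>M\<close>.
\<close>

lemma even_case:
  assumes disj: "U \<inter> R = {}" and nt: "\<exists>g\<in>G. \<gamma> g \<noteq> 1"
  shows "even (card M)" "g \<in> G \<Longrightarrow> \<gamma> g * \<alpha> g ^ (card M div 2) = 1"
proof -
  have sq: "\<gamma> g = 1 \<or> \<gamma> g = - 1" if "g \<in> G" for g
    using \<gamma>_square_of_U_disjoint[OF disj that] by (simp add: power2_eq_1_iff)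
  have two: "(1::'a) \<noteq> - 1"
  proof
    assume "(1::'a) = - 1"
    then have "of_nat 2 = (0::'a)" by (simp add: eq_neg_iff_add_eq_0)
    then have "CHAR('a) dvd 2" by (simp only: of_nat_eq_0_iff_char_dvd)
    with odd_char show False by (auto dest: dvd_imp_le)
  qed
  define M1 where "M1 = \<alpha> ` {g \<in> G. \<gamma> g = 1}"
  define M2 where "M2 = \<alpha> ` {g \<in> G. \<gamma> g = - 1}"
  have fin: "finite M1" "finite M2" using finite_G by (auto simp: M1_def M2_def)
  have un: "M = M1 \<union> M2" using sq by (auto simp: M_def M1_def M2_def)
  have "a \<notin> M2" if a: "a \<in> M1" for a
  proof
    assume "a \<in> M2"
    then obtain g' where g': "g' \<in> G" "a = \<alpha> g'" "\<gamma> g' = - 1" by (auto simp: M2_def)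
    obtain g where g: "g \<in> G" "a = \<alpha> g" "\<gamma> g = 1" using a by (auto simp: M1_def)
    show False using \<gamma>_of_\<alpha>[OF g(1) g'(1)] g g' two by simp
  qed
  then have dis: "M1 \<inter> M2 = {}" by blast
  obtain h where h: "h \<in> G" "\<gamma> h = - 1" using nt sq by blast
  have mul: "\<exists>k\<in>G. \<alpha> k = \<alpha> g * \<alpha> g' \<and> \<gamma> k = \<gamma> g * \<gamma> g'" if "g \<in> G" "g' \<in> G" for g g'
    using ex_mult[OF that] by blast
  have swap: "\<alpha> h * \<alpha> g \<in> \<alpha> ` {k \<in> G. \<gamma> k = - \<gamma> g}" if g: "g \<in> G" for g
  proof -
    obtain k where "k \<in> G" "\<alpha> k = \<alpha> h * \<alpha> g" "\<gamma> k = - \<gamma> g" using mul[OF h(1) g] h(2) by auto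
    then show ?thesis by (intro image_eqI[of _ _ k]) auto
  qed
  have "\<alpha> h * a \<in> M2" if a: "a \<in> M1" for a
  proof -
    obtain g where g: "g \<in> G" "a = \<alpha> g" "\<gamma> g = 1" using a by (auto simp: M1_def)
    show ?thesis using swap[OF g(1)] by (simp add: g M2_def)
  qed
  moreover have "\<alpha> h * a \<in> M1" if a: "a \<in> M2" for a
  proof -
    obtain g where g: "g \<in> G" "a = \<alpha> g" "\<gamma> g = - 1" using a by (auto simp: M2_def)
    show ?thesis using swap[OF g(1)] by (simp add: g M1_def)
  qed
  ultimately have "(*) (\<alpha> h) ` M1 \<subseteq> M2" "(*) (\<alpha> h) ` M2 \<subseteq> M1" by auto
  moreover have "inj_on ((*) (\<alpha> h)) M1" "inj_on ((*) (\<alpha> h)) M2"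
    using alpha_nz[OF h(1)] by (auto simp: inj_on_def)
  ultimately have "card M1 \<le> card M2" "card M2 \<le> card M1"
    using card_inj_on_le fin by blast+
  then have card: "card M = 2 * card M1" using un dis fin by (simp add: card_Un_disjoint)
  then show "even (card M)" by simp
  have "1 \<in> M1" using ex_one by (force simp: M1_def)
  then have pos: "card M1 > 0" using fin by (auto simp: card_gt_0_iff)
  have "a * b \<in> M1" if ab: "a \<in> M1" "b \<in> M1" for a b
  proof -
    obtain g g' where g: "g \<in> G" "g' \<in> G" "a = \<alpha> g" "b = \<alpha> g'" "\<gamma> g = 1" "\<gamma> g' = 1" using ab by (auto simp: M1_def)
    obtain k where "k \<in> G" "\<alpha> k = a * b" "\<gamma> k = 1" using mul[OF g(1,2)] g by auto
    then show ?thesis by (auto simp: M1_def intro: image_eqI[of _ _ k])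
  qed
  then have p1: "a ^ card M1 = 1" if "a \<in> M1" for a
    using M_facts(2) un that by (intro power_card_mult_closed[OF fin(1)]) auto
  have p2: "a ^ card M1 = - 1" if "a \<in> M2" for a
  proof -
    have "a \<in> M" using un that by blast
    then have "(a ^ card M1) ^ 2 = 1"
      using power_card_mult_closed[OF M_facts(1,2,5)] card by (simp add: mult.commute flip: power_mult)
    moreover have "a ^ card M1 \<noteq> 1"
    proof
      assume "a ^ card M1 = 1"
      with p1 have "card (insert a M1) \<le> card M1" by (intro card_roots_of_unity_le[OF pos]) auto
      moreover have "a \<notin> M1" using dis that by blast
      ultimately show False using fin by simp
    qed
    ultimately show ?thesis by (simp add: power2_eq_1_iff)
  qed
  show "\<gamma> g * \<alpha> g ^ (card M div 2) = 1" if g: "g \<in> G"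
    using sq[OF g] p1[of "\<alpha> g"] p2[of "\<alpha> g"] g card by (auto simp: M1_def M2_def)
qed

end

section \<open>The model of the quotient\<close>

context affine_curve begin

definition S :: "'a set set" where "S = (\<lambda>r. (\<lambda>g. act g r) ` G) ` R"

definition V :: "'a poly" where
  "V = (if \<forall>g\<in>G. \<gamma> g = 1 then 1 else W ^ (card M div 2))"

definition f\<^sub>G :: "'a poly" where
  "f\<^sub>G = (if \<forall>g\<in>G. \<gamma> g = 1
     then Polynomial.smult (c * (- 1) ^ (card R - card S)) (\<Prod>Q\<in>S. [:- (\<Prod>r\<in>Q. r), 1:])
     else Polynomial.smult (c * (- 1) ^ ((card M - 1) * (card S - 1)))
       ([:- (lam ^ card M), 1:] * (\<Prod>Q\<in>S - {U}. [:- (\<Prod>r\<in>Q. r), 1:])))"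

text \<open>If \<open>g\<close> and \<open>h\<close> agree at \<open>r\<close>, then
  \<open>h^(-1) g\<close> fixes \<open>r\<close>, so it is trivial by the choice of
  \<open>r\<close>.\<close>

lemma free_orbit:
  assumes "r \<notin> U"
  shows "inj_on (\<lambda>g. act g r) G"
proof (rule inj_onI)
  fix g h assume gh: "g \<in> G" "h \<in> G" "act g r = act h r"
  obtain i where i: "i \<in> G" "\<alpha> i * \<alpha> h = 1" "\<alpha> i * \<beta> h + \<beta> i = 0" using ex_inverse[OF gh(2)] by blast
  obtain k where k: "k \<in> G" "\<And>x. act k x = act i (act g x)" using act_mult[OF i(1) gh(1)] by metis
  have ih: "act i (act h x) = x" for x
  proof -
    have "act i (act h x) = \<alpha> i * \<alpha> h * x + (\<alpha> i * \<beta> h + \<beta> i)" by (simp add: algebra_simps)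
    then show ?thesis using i by simp
  qed
  have "act k r = r" by (simp only: k(2) gh(3) ih)
  then have "\<alpha> k = 1 \<and> \<beta> k = 0" using assms k(1) unfolding U_def by blast
  then have "act i (act g x) = act i (act h x)" for x
    unfolding ih k(2)[symmetric] by simp
  then have eq: "act g x = act h x" for x unfolding act_inj[OF i(1)] .
  from eq[of 0] eq[of 1] show "g = h" using gh faithful by simp
qed

lemma orbit_act:
  assumes "h \<in> G"
  shows "(\<lambda>g. act g (act h r)) ` G = (\<lambda>g. act g r) ` G"
proof -
  obtain \<pi> where \<pi>: "bij_betw \<pi> G G" "\<And>g x. g \<in> G \<Longrightarrow> act (\<pi> g) x = act g (act h x)"
    using right_mult_bij[OF assms] by metis
  have "(\<lambda>g. act g r) ` G = (\<lambda>g. act g r) ` \<pi> ` G" using \<pi>(1) by (simp add: bij_betw_def)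
  also have "\<dots> = (\<lambda>g. act g (act h r)) ` G" unfolding image_image by (rule image_cong) (simp_all only: \<pi>(2))
  finally show ?thesis ..
qed

lemma orbit_self: "r \<in> (\<lambda>g. act g r) ` G"
proof -
  obtain e where "e \<in> G" "\<alpha> e = 1" "\<beta> e = 0" using ex_one by blast
  then show ?thesis by (intro image_eqI[of _ _ e]) auto
qed

lemma S_eq_orbit: "Q \<in> S \<Longrightarrow> r \<in> Q \<Longrightarrow> Q = (\<lambda>g. act g r) ` G"
proof -
  assume Q: "Q \<in> S" "r \<in> Q"
  then obtain s where s: "Q = (\<lambda>g. act g s) ` G" by (auto simp: S_def)
  with Q obtain h where "h \<in> G" "r = act h s" by blast
  then show ?thesis using orbit_act[of h s] s by simp
qed

lemma S_subset: "Q \<in> S \<Longrightarrow> Q \<subseteq> R" unfolding S_def using R_act by auto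

lemma S_nonempty: "Q \<in> S \<Longrightarrow> Q \<noteq> {}" unfolding S_def using orbit_self by auto

lemma finite_S: "finite S" unfolding S_def using finite_R by simp

lemma card_S_pos: "card S > 0" unfolding S_def using finite_R R_nonempty by (simp add: card_gt_0_iff)

lemma S_disjoint: "Q \<in> S \<Longrightarrow> Q' \<in> S \<Longrightarrow> Q \<noteq> Q' \<Longrightarrow> Q \<inter> Q' = {}"
  using S_eq_orbit by blast

lemma finite_orbit: "Q \<in> S \<Longrightarrow> finite Q"
  using S_subset finite_R finite_subset by blast

lemma U_in_S: "Q \<in> S \<Longrightarrow> r \<in> Q \<Longrightarrow> r \<in> U \<Longrightarrow> Q = U"
  using S_eq_orbit U_orbit by blast

lemma Union_S: "\<Union>(S - {U}) = R - U"
proof (intro equalityI subsetI)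
  fix r assume "r \<in> \<Union>(S - {U})"
  then show "r \<in> R - U" using S_subset U_in_S by blast
next
  fix r assume r: "r \<in> R - U"
  have "(\<lambda>g. act g r) ` G \<in> S" using r by (auto simp: S_def)
  moreover have "(\<lambda>g. act g r) ` G \<noteq> U" using orbit_self[of r] r by blast
  ultimately show "r \<in> \<Union>(S - {U})" using orbit_self[of r] by blast
qed

lemma S_orbit_poly:
  assumes "Q \<in> S - {U}" "r \<in> Q"
  shows "I - [:\<Prod>y\<in>Q. y:] = Polynomial.smult \<epsilon> (\<Prod>y\<in>Q. [:- y, 1:])" "poly I r = (\<Prod>y\<in>Q. y)" "card Q = card G"
proof -
  have "r \<notin> U" using assms U_in_S by blast
  moreover have "Q = (\<lambda>g. act g r) ` G" using assms S_eq_orbit by blast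
  ultimately show "I - [:\<Prod>y\<in>Q. y:] = Polynomial.smult \<epsilon> (\<Prod>y\<in>Q. [:- y, 1:])"
    "poly I r = (\<Prod>y\<in>Q. y)" "card Q = card G"
    using orbit_poly[OF free_orbit] by simp_all
qed

lemma prod_smult_const:
  fixes P :: "'b \<Rightarrow> 'a poly"
  shows "(\<Prod>i\<in>A. Polynomial.smult a (P i)) = Polynomial.smult (a ^ card A) (\<Prod>i\<in>A. P i)"
  by (induction A rule: infinite_finite_induct) (auto simp: mult.commute)

lemma linear_pcompose:
  fixes P :: "'a poly"
  shows "[:- a, 1:] \<circ>\<^sub>p P = P - [:a:]"
proof -
  have "[:- a, 1:] \<circ>\<^sub>p P = P + - [:a:]" by (simp add: pcompose_pCons add.commute)
  then show ?thesis by (simp only: diff_conv_add_uminus)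
qed

text \<open>An orbit other than \<open>U\<close> is free, so composing its linear factor with
  \<open>I\<close> yields \<epsilon> times the product of \<open>X - y\<close> over the
  orbit.\<close>

lemma prod_S:
  "(\<Prod>Q\<in>S - {U}. [:- (\<Prod>r\<in>Q. r), 1:]) \<circ>\<^sub>p I
     = Polynomial.smult (\<epsilon> ^ card (S - {U})) (\<Prod>r\<in>R - U. [:- r, 1:])"
proof -
  have "(\<Prod>Q\<in>S - {U}. [:- (\<Prod>r\<in>Q. r), 1:]) \<circ>\<^sub>p I = (\<Prod>Q\<in>S - {U}. I - [:\<Prod>r\<in>Q. r:])"
    by (simp only: pcompose_prod linear_pcompose)
  also have "\<dots> = (\<Prod>Q\<in>S - {U}. Polynomial.smult \<epsilon> (\<Prod>y\<in>Q. [:- y, 1:]))"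
  proof (rule prod.cong)
    fix Q assume "Q \<in> S - {U}"
    moreover then obtain r where "r \<in> Q" using S_nonempty by blast
    ultimately show "I - [:\<Prod>r\<in>Q. r:] = Polynomial.smult \<epsilon> (\<Prod>y\<in>Q. [:- y, 1:])" by (rule S_orbit_poly)
  qed simp
  also have "\<dots> = Polynomial.smult (\<epsilon> ^ card (S - {U})) (\<Prod>Q\<in>S - {U}. \<Prod>y\<in>Q. [:- y, 1:])"
    by (rule prod_smult_const)
  also have "(\<Prod>Q\<in>S - {U}. \<Prod>y\<in>Q. [:- y, 1:]) = (\<Prod>y\<in>\<Union>(S - {U}). [:- y, 1:])"
    by (rule prod.Union_disjoint[symmetric, unfolded comp_def]) (use finite_orbit S_disjoint in auto)
  finally show ?thesis by (simp only: Union_S)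
qed

text \<open>A root fixed by a non-trivial \<open>g\<close> would give
  \<open>\<gamma> g ^ 2 = \<alpha> g \<noteq> 1\<close>. So for trivial \<gamma> all orbits in
  \<open>R\<close> are free.\<close>

lemma trivial_disjoint:
  assumes "\<forall>g\<in>G. \<gamma> g = 1"
  shows "U \<inter> R = {}"
proof (rule ccontr)
  assume "U \<inter> R \<noteq> {}"
  then obtain r g where "r \<in> R" "g \<in> G" "act g r = r" "\<alpha> g \<noteq> 1"
    using fixed_alpha(1) unfolding U_def by blast
  then show False using \<gamma>_of_fixed_root[of g r] assms by simp
qed

lemma U_nonempty:
  assumes "\<exists>g\<in>G. \<gamma> g \<noteq> 1"
  shows "U \<noteq> {}"
  using assms \<gamma>_of_translation fixed_point by blast

lemma U_notin_S: "U \<inter> R = {} \<Longrightarrow> U \<notin> S"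
  using S_subset S_nonempty by blast

lemma card_S_U: "card (S - {U}) = (if U \<inter> R = {} then card S else card S - 1)"
proof (cases "U \<inter> R = {}")
  case True
  then show ?thesis using U_notin_S by simp
next
  case False
  then obtain r where "r \<in> R" "r \<in> U" by blast
  then have "U \<in> S" unfolding S_def using U_orbit by blast
  then show ?thesis using False finite_S by (simp add: card_Diff_singleton)
qed

lemma quotient_equation: "f\<^sub>G \<circ>\<^sub>p I = f * V ^ 2"
proof (cases "\<forall>g\<in>G. \<gamma> g = 1")
  case True
  have disj: "U \<inter> R = {}" using trivial_disjoint[OF True] .
  have S: "S - {U} = S" "R - U = R" using U_notin_S[OF disj] disj by auto
  \<comment> \<open>Needed for the sign: as all orbits are free, \<open>card R - card S\<close> is
    \<open>(card G - 1) * card S\<close>, so the sign of the model is \<epsilon> to the number of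
    orbits.\<close>
  have "card G * card S = card R"
  proof -
    have "card G * card S = card (\<Union>S)"
    proof (rule card_partition)
      show "finite S" by (rule finite_S)
      show "finite (\<Union>S)" using finite_S finite_orbit by blast
      show "card Q = card G" if "Q \<in> S" for Q
        using S_nonempty[OF that] S_orbit_poly(3) that S(1) by blast
    qed (rule S_disjoint)
    then show ?thesis using Union_S S by simp
  qed
  then have "card R - card S = (card G - 1) * card S" by (simp add: diff_mult_distrib flip: \<open>card G * card S = card R\<close>)
  then have "(- 1) ^ (card R - card S) = \<epsilon> ^ card S" by (simp add: \<epsilon>_eq' power_mult)
  then have "f\<^sub>G \<circ>\<^sub>p I = Polynomial.smult (c * \<epsilon> ^ card S) (Polynomial.smult (\<epsilon> ^ card S) (\<Prod>r\<in>R. [:- r, 1:]))"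
    using True prod_S S by (simp add: f\<^sub>G_def pcompose_smult)
  also have "\<dots> = Polynomial.smult (c * (\<epsilon> * \<epsilon>) ^ card S) (\<Prod>r\<in>R. [:- r, 1:])"
    by (simp add: power_mult_distrib mult.assoc)
  finally show ?thesis using True by (simp add: V_def f_def \<epsilon>_square)
next
  case False
  define P where "P = (\<Prod>r\<in>R - U. [:- r, 1:])"
  define m where "m = card M"
  have U: "U \<noteq> {}" using U_nonempty False by blast
  have nt: "\<exists>g\<in>G. \<gamma> g \<noteq> 1" using False by blast
  have "\<epsilon> ^ (card S - 1) * (\<epsilon> * \<epsilon> ^ card (S - {U})) = 1 \<and> f * V ^ 2 = Polynomial.smult c (P * W ^ m)"
  proof (cases "U \<inter> R = {}")
    \<comment> \<open>Here \<open>m\<close> is even, so \<open>V^2 = W^m\<close>, and \<epsilon>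
      occurs with the even exponent \<open>2 * card S\<close>.\<close>
    case True
    have "card S = Suc (card S - 1)" using card_S_pos by simp
    then have "\<epsilon> * \<epsilon> ^ card (S - {U}) = \<epsilon> * \<epsilon> * \<epsilon> ^ (card S - 1)"
      using card_S_U True by (metis mult.assoc power_Suc)
    then have 1: "\<epsilon> ^ (card S - 1) * (\<epsilon> * \<epsilon> ^ card (S - {U})) = (\<epsilon> * \<epsilon>) ^ (card S - 1)"
      by (simp add: \<epsilon>_square flip: power_mult_distrib)
    have "R - U = R" using True by blast
    moreover have "V ^ 2 = W ^ m"
    proof -
      have "m div 2 * 2 = m" using even_case(1)[OF True nt] by (simp add: m_def)
      then show ?thesis unfolding V_def if_not_P[OF False] m_def[symmetric] by (simp flip: power_mult)
    qed
    ultimately show ?thesis using 1 by (simp add: P_def f_def \<epsilon>_square)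
  next
    \<comment> \<open>Here \<open>m\<close> is odd, so \<epsilon> is 1 and \<open>V^2\<close> is
      \<open>W^(m - 1)\<close>; the missing factor \<open>W\<close> is a divisor of
      \<open>f\<close>.\<close>
    case ne: False
    then have sub: "U \<subseteq> R" using U_cases by blast
    have m: "odd m" using odd_case(1)[OF sub] by (simp add: m_def)
    then have "\<epsilon> = 1" by (simp add: \<epsilon>_eq flip: m_def)
    moreover have "(\<Prod>r\<in>R. [:- r, 1:]) = P * W"
      unfolding P_def W_def using prod.subset_diff[OF sub finite_R] by blast
    moreover have "W * V ^ 2 = W ^ m"
    proof -
      have "Suc (m div 2 * 2) = m" using m by presburger
      then show ?thesis unfolding V_def if_not_P[OF False] m_def[symmetric] by (metis power_Suc power_mult)
    qed
    ultimately show ?thesis by (simp add: f_def mult.assoc)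
  qed
  then have sign: "\<epsilon> ^ (card S - 1) * (\<epsilon> * \<epsilon> ^ card (S - {U})) = 1" and fV: "f * V ^ 2 = Polynomial.smult c (P * W ^ m)"
    by blast+
  have "f\<^sub>G \<circ>\<^sub>p I = Polynomial.smult (c * \<epsilon> ^ (card S - 1)) ((I - [:lam ^ m:]) * Polynomial.smult (\<epsilon> ^ card (S - {U})) P)"
    unfolding f\<^sub>G_def if_not_P[OF False] pcompose_smult pcompose_mult linear_pcompose prod_S
    by (simp only: P_def m_def \<epsilon>_eq power_mult)
  also have "I - [:lam ^ m:] = Polynomial.smult \<epsilon> (W ^ m)"
    using I_eq_W[OF U] unfolding m_def by (simp only: add_diff_cancel_right')
  finally have "f\<^sub>G \<circ>\<^sub>p I = Polynomial.smult (c * (\<epsilon> ^ (card S - 1) * (\<epsilon> * \<epsilon> ^ card (S - {U})))) (P * W ^ m)"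
    by (simp add: mult_ac)
  then show ?thesis by (simp only: sign fV mult_1_right)
qed

lemma V_act:
  assumes "g \<in> G"
  shows "\<gamma> g * poly V (act g x) = poly V x"
proof (cases "\<forall>g\<in>G. \<gamma> g = 1")
  case True
  then show ?thesis using assms by (simp add: V_def)
next
  case False
  then have nt: "\<exists>g\<in>G. \<gamma> g \<noteq> 1" by blast
  have "\<gamma> g * \<alpha> g ^ (card M div 2) = 1"
    using U_cases odd_case(2)[OF _ assms] even_case(2)[OF _ nt assms] by blast
  then show ?thesis
    unfolding V_def if_not_P[OF False] poly_power W_act[OF assms U_nonempty[OF nt]]
    by (simp add: power_mult_distrib flip: mult.assoc)
qed

text \<open>The product over an orbit is the value of \<open>I\<close> on it, and \<open>I\<close>
  takes this value nowhere else. Together with \<open>lam_not_orbit_prod\<close> this makes the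
  model squarefree.\<close>

lemma inj_prod_orbits: "inj_on (\<lambda>Q. \<Prod>r\<in>Q. r) (S - {U})"
proof (rule inj_onI)
  fix Q Q' assume Q: "Q \<in> S - {U}" "Q' \<in> S - {U}" "(\<Prod>r\<in>Q. r) = (\<Prod>r\<in>Q'. r)"
  obtain r r' where r: "r \<in> Q" "r' \<in> Q'" using S_nonempty Q by blast
  have "poly (I - [:\<Prod>r\<in>Q. r:]) r' = 0" using S_orbit_poly(2)[OF Q(2) r(2)] Q(3) by simp
  then have "poly (Polynomial.smult \<epsilon> (\<Prod>y\<in>Q. [:- y, 1:])) r' = 0" using S_orbit_poly(1)[OF Q(1) r(1)] by simp
  then have "r' \<in> Q" using \<epsilon>_nz finite_orbit Q(1) by (auto simp: poly_prod)
  then show "Q = Q'" using S_disjoint Q r by blast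
qed

lemma lam_not_orbit_prod:
  assumes "Q \<in> S - {U}" "U \<noteq> {}"
  shows "(\<Prod>r\<in>Q. r) \<noteq> lam ^ card M"
proof
  assume eq: "(\<Prod>r\<in>Q. r) = lam ^ card M"
  obtain u where u: "u \<in> U" using assms by blast
  obtain r where r: "r \<in> Q" using S_nonempty assms by blast
  have "poly (I - [:\<Prod>r\<in>Q. r:]) u = 0" using prod_orbit_U[OF u] eq by simp
  then have "poly (Polynomial.smult \<epsilon> (\<Prod>y\<in>Q. [:- y, 1:])) u = 0" using S_orbit_poly(1)[OF assms(1) r] by simp
  then have "u \<in> Q" using \<epsilon>_nz finite_orbit assms(1) by (auto simp: poly_prod)
  then show False using U_in_S u assms(1) by blast
qed

lemma f\<^sub>G_factors:
  "\<exists>n R'. finite R' \<and> R' \<noteq> {} \<and> f\<^sub>G = Polynomial.smult (c * (- 1) ^ n) (\<Prod>r\<in>R'. [:- r, 1:])"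
proof (cases "\<forall>g\<in>G. \<gamma> g = 1")
  case True
  have "S - {U} = S" using U_notin_S[OF trivial_disjoint[OF True]] by simp
  then have "(\<Prod>Q\<in>S. [:- (\<Prod>r\<in>Q. r), 1:]) = (\<Prod>r\<in>(\<lambda>Q. \<Prod>r\<in>Q. r) ` S. [:- r, 1:])"
    using inj_prod_orbits by (simp add: prod.reindex)
  then show ?thesis using True finite_S card_S_pos
    by (intro exI[of _ "card R - card S"] exI[of _ "(\<lambda>Q. \<Prod>r\<in>Q. r) ` S"]) (auto simp: f\<^sub>G_def)
next
  case False
  let ?R = "(\<lambda>Q. \<Prod>r\<in>Q. r) ` (S - {U})"
  have "lam ^ card M \<notin> ?R" using lam_not_orbit_prod U_nonempty False by fastforce
  then have "(\<Prod>r\<in>insert (lam ^ card M) ?R. [:- r, 1:]) = [:- (lam ^ card M), 1:] * (\<Prod>r\<in>?R. [:- r, 1:])"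
    using finite_S by (subst prod.insert) auto
  also have "(\<Prod>r\<in>?R. [:- r, 1:]) = (\<Prod>Q\<in>S - {U}. [:- (\<Prod>r\<in>Q. r), 1:])"
    by (simp add: prod.reindex[OF inj_prod_orbits])
  finally show ?thesis unfolding f\<^sub>G_def if_not_P[OF False] using finite_S
    by (intro exI[of _ "(card M - 1) * (card S - 1)"] exI[of _ "insert (lam ^ card M) ?R"]) simp
qed

end

section \<open>Invariant functions and the map \<open>a X\<^sup>q + b\<close>\<close>

context affine_curve begin

text \<open>At a root of \<open>f\<close>, which is simple, a non-zero right side has odd order,
  whereas the left side has even order.\<close>

lemma square_eq_f_square:
  assumes "B0 ^ 2 = f * B1 ^ 2"
  shows "B1 = 0" "B0 = 0"
proof -
  obtain r where r: "r \<in> R" using R_nonempty by blast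
  define h where "h = Polynomial.smult c (\<Prod>s\<in>R - {r}. [:- s, 1:])"
  have f: "f = [:- r, 1:] * h"
    using prod.remove[OF finite_R r, of "\<lambda>s. [:- s, 1:]"] by (simp only: f_def h_def mult_smult_right)
  have "poly h r \<noteq> 0" using finite_R c_nz by (auto simp: h_def poly_prod)
  then have "Polynomial.order r h = 0" "h \<noteq> 0" using order_root by auto
  then have of: "Polynomial.order r f = 1"
    using f_nz f order_mult[of "[:- r, 1:]" h r] order_power_n_n[of r 1] by (simp del: mult_pCons_left)
  show "B1 = 0"
  proof (rule ccontr)
    assume "B1 \<noteq> 0"
    then have nz: "f * B1 ^ 2 \<noteq> 0" using f_nz by simp
    then have "Polynomial.order r (f * (B1 * B1)) = 1 + 2 * Polynomial.order r B1"
      by (simp add: order_mult of power2_eq_square)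
    moreover have "Polynomial.order r (B0 * B0) = 2 * Polynomial.order r B0"
      using nz assms by (subst order_mult) (auto simp: power2_eq_square)
    ultimately have "2 * Polynomial.order r B0 = 1 + 2 * Polynomial.order r B1"
      using assms by (simp add: power2_eq_square)
    then show False by presburger
  qed
  with assms show "B0 = 0" by simp
qed

text \<open>
  Multiplying numerator and denominator by the conjugate of the denominator and by the remaining
  factors of the norm over \<open>G\<close> makes the denominator an invariant polynomial in \<open>X\<close>.
\<close>

lemma invariant_fraction:
  fixes A0 A1 B0 B1 :: "'a poly"
  assumes B: "B0 \<noteq> 0 \<or> B1 \<noteq> 0"
    and inv: "\<And>g x y. g \<in> G \<Longrightarrow> y ^ 2 = poly f x \<Longrightarrow> poly B0 x + y * poly B1 x \<noteq> 0 \<Longrightarrow>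
      poly B0 (act g x) + \<gamma> g * y * poly B1 (act g x) \<noteq> 0 \<Longrightarrow>
      (poly A0 (act g x) + \<gamma> g * y * poly A1 (act g x)) * (poly B0 x + y * poly B1 x)
        = (poly A0 x + y * poly A1 x) * (poly B0 (act g x) + \<gamma> g * y * poly B1 (act g x))"
    and closed: "P A0" "P A1" "P B0" "P B1" "P f" "P V"
    "\<And>p q. P p \<Longrightarrow> P q \<Longrightarrow> P (p * q)" "\<And>p q. P p \<Longrightarrow> P q \<Longrightarrow> P (p - q)"
    "\<And>(S :: 'g set) h. (\<And>i. i \<in> S \<Longrightarrow> P (h i)) \<Longrightarrow> P (prod h S)"
    "\<And>p g. g \<in> G \<Longrightarrow> P p \<Longrightarrow> P (p \<circ>\<^sub>p [:\<beta> g, \<alpha> g:])"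
  obtains \<mu> \<mu>0 \<mu>1 where "\<mu> \<noteq> 0" "P (\<mu> \<circ>\<^sub>p I)" "P (\<mu>0 \<circ>\<^sub>p I)" "P (\<mu>1 \<circ>\<^sub>p I)"
    "\<And>x y. y ^ 2 = poly f x \<Longrightarrow>
      (poly A0 x + y * poly A1 x) * (poly \<mu> (poly I x) * poly f\<^sub>G (poly I x))
        = (poly B0 x + y * poly B1 x) *
          (poly \<mu>0 (poly I x) * poly f\<^sub>G (poly I x) + poly V x * y * poly \<mu>1 (poly I x))"
proof -
  \<comment> \<open>\<open>D\<close> is the norm \<open>(B0 + y B1) (B0 - y B1)\<close>, and
    \<open>E0 + y E1\<close> is the numerator times the conjugate \<open>B0 - y B1\<close> of the
    denominator.\<close>
  define D where "D = B0 * B0 - f * (B1 * B1)"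
  define E0 where "E0 = A0 * B0 - f * (A1 * B1)"
  define E1 where "E1 = A1 * B0 - A0 * B1"
  obtain e where e: "e \<in> G" "\<alpha> e = 1" "\<beta> e = 0" "\<gamma> e = 1" using ex_one by blast
  \<comment> \<open>\<open>N\<close> is the norm of \<open>D\<close> over \<open>G\<close> and
    \<open>D'\<close> is the cofactor \<open>N / D\<close>, so the given fraction becomes
    \<open>(u + y w) / N\<close>.\<close>
  define N where "N = (\<Prod>g\<in>G. D \<circ>\<^sub>p [:\<beta> g, \<alpha> g:])"
  define D' where "D' = (\<Prod>g\<in>G - {e}. D \<circ>\<^sub>p [:\<beta> g, \<alpha> g:])"
  define u where "u = E0 * D'"
  define w where "w = E1 * D'"
  have D0: "D \<noteq> 0"
  proof
    assume "D = 0"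
    then have "B0 ^ 2 = f * B1 ^ 2" unfolding D_def power2_eq_square by (simp only: eq_iff_diff_eq_0[symmetric])
    then show False using square_eq_f_square B by blast
  qed
  have N: "poly N x = (\<Prod>g\<in>G. poly D (act g x))" for x
    unfolding N_def poly_prod poly_pcompose_act ..
  have ND: "poly N x = poly D x * poly D' x" for x
    unfolding N D'_def poly_prod poly_pcompose_act using e finite_G
    by (subst prod.remove[OF finite_G e(1)]) simp
  have N_act: "poly N (act g x) = poly N x" if "g \<in> G" for g x
    unfolding N by (rule prod_act[OF that])
  have "D \<circ>\<^sub>p [:\<beta> g, \<alpha> g:] \<noteq> 0" if "g \<in> G" for g
    using D0 degree_pcompose_act[OF that, of D] alpha_nz[OF that] by (auto simp: pcompose_eq_0_iff)
  then have N0: "N \<noteq> 0" unfolding N_def using finite_G by auto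
  have key: "(poly B0 x + y * poly B1 x) * (poly u x + y * poly w x) = (poly A0 x + y * poly A1 x) * poly N x"
    if "y ^ 2 = poly f x" for x y
    unfolding ND u_def w_def E0_def E1_def D_def poly_mult poly_diff that[symmetric]
    by (simp add: algebra_simps power2_eq_square)
  \<comment> \<open>Off \<open>Z\<close> the norms at all images of \<open>x\<close> are non-zero,
    so the denominators may be cancelled; moreover \<open>y\<close> is non-zero there.\<close>
  define Z where "Z = {x. poly (N * f) x = 0}"
  have finZ: "finite Z" unfolding Z_def using N0 f_nz by (intro poly_roots_finite) simp
  have norm_nz: "poly D (act g x) \<noteq> 0" if "g \<in> G" "x \<notin> Z" for g x
    using that finite_G by (auto simp: Z_def N)
  have two: "(2::'a) \<noteq> 0"
  proof
    assume "(2::'a) = 0"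
    then have "of_nat 2 = (0::'a)" by simp
    then have "CHAR('a) dvd 2" by (simp only: of_nat_eq_0_iff_char_dvd)
    with odd_char show False by (auto dest: dvd_imp_le)
  qed
  have uw: "poly u (act g x) + \<gamma> g * y * poly w (act g x) = poly u x + y * poly w x"
    if g: "g \<in> G" and x: "x \<notin> Z" and y: "y ^ 2 = poly f x" for g x y
  proof -
    let ?b = "poly B0 x + y * poly B1 x" and ?b' = "poly B0 (act g x) + \<gamma> g * y * poly B1 (act g x)"
    have y': "(\<gamma> g * y) ^ 2 = poly f (act g x)" using f_act[OF g] y by (simp add: power_mult_distrib)
    have "?b * (poly B0 x - y * poly B1 x) = poly D x"
      unfolding D_def poly_diff poly_mult y[symmetric] by (simp add: algebra_simps power2_eq_square)
    moreover have "poly D x \<noteq> 0" using norm_nz[OF e(1) x] e by simp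
    ultimately have b: "?b \<noteq> 0" by auto
    have "?b' * (poly B0 (act g x) - \<gamma> g * y * poly B1 (act g x)) = poly D (act g x)"
      unfolding D_def poly_diff poly_mult y'[symmetric] by (simp add: algebra_simps power2_eq_square)
    then have b': "?b' \<noteq> 0" using norm_nz[OF g x] by auto
    let ?a = "poly A0 x + y * poly A1 x" and ?a' = "poly A0 (act g x) + \<gamma> g * y * poly A1 (act g x)"
    have "?b * (?b' * (poly u (act g x) + \<gamma> g * y * poly w (act g x))) = ?b * (?a' * poly N x)"
      by (simp only: key[OF y'] N_act[OF g])
    also have "\<dots> = (?a' * ?b) * poly N x" by (simp only: mult_ac)
    also have "\<dots> = (?a * ?b') * poly N x" by (simp only: inv[OF g y b b'])
    also have "\<dots> = ?b' * (?a * poly N x)" by (simp only: mult_ac)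
    also have "\<dots> = ?b' * (?b * (poly u x + y * poly w x))" by (simp only: key[OF y])
    also have "\<dots> = ?b * (?b' * (poly u x + y * poly w x))" by (simp only: mult_ac)
    finally show ?thesis using b b' by simp
  qed
  \<comment> \<open>Adding and subtracting the relations for \<open>y\<close> and \<open>-y\<close>
    separates \<open>u\<close> from \<open>w\<close>.\<close>
  have uw': "poly u (act g x) = poly u x" "\<gamma> g * poly w (act g x) = poly w x"
    if g: "g \<in> G" and x: "x \<notin> Z" for g x
  proof -
    obtain y where y: "y ^ 2 = poly f x" using ex_sqrt by blast
    have "y \<noteq> 0" using y x by (auto simp: Z_def)
    have 1: "poly u (act g x) + \<gamma> g * y * poly w (act g x) = poly u x + y * poly w x" using uw[OF g x y] .
    have 2: "poly u (act g x) - \<gamma> g * y * poly w (act g x) = poly u x - y * poly w x"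
      using uw[OF g x, of "- y"] y by simp
    have "2 * poly u (act g x) = (poly u (act g x) + \<gamma> g * y * poly w (act g x))
        + (poly u (act g x) - \<gamma> g * y * poly w (act g x))" by simp
    also have "\<dots> = 2 * poly u x" unfolding 1 2 by simp
    finally have "2 * poly u (act g x) = 2 * poly u x" .
    then show "poly u (act g x) = poly u x" using two by simp
    with 1 have "y * (\<gamma> g * poly w (act g x)) = y * poly w x" by (simp add: mult_ac)
    then show "\<gamma> g * poly w (act g x) = poly w x" using \<open>y \<noteq> 0\<close> by simp
  qed
  have u_inv: "poly u (act g x) = poly u x" if g: "g \<in> G" for g x
  proof -
    have "u \<circ>\<^sub>p [:\<beta> g, \<alpha> g:] = u"
      by (rule poly_eq_cofinite[OF finZ]) (unfold poly_pcompose_act, rule uw'(1)[OF g])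
    then show ?thesis using poly_pcompose_act[of u g x] by simp
  qed
  have w_inv: "\<gamma> g * poly w (act g x) = poly w x" if g: "g \<in> G" for g x
  proof -
    have "Polynomial.smult (\<gamma> g) (w \<circ>\<^sub>p [:\<beta> g, \<alpha> g:]) = w"
      by (rule poly_eq_cofinite[OF finZ]) (unfold poly_smult poly_pcompose_act, rule uw'(2)[OF g])
    then show ?thesis using poly_pcompose_act[of w g x] by (metis poly_smult)
  qed
  obtain \<mu>0 where \<mu>0: "u = \<mu>0 \<circ>\<^sub>p I" using invariant_poly[OF u_inv] by blast
  obtain \<mu> where \<mu>: "N = \<mu> \<circ>\<^sub>p I" using invariant_poly[OF N_act] by blast
  \<comment> \<open>Both \<open>w\<close> and \<open>V\<close> are multiplied by the inverse of
    \<open>\<gamma> g\<close> and \<open>f\<close> by its square, so the product is invariant.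
    Writing \<open>w y\<close> as \<open>(w V f) (V y) / (f V^2)\<close> explains the additional
    factor \<open>f\<^sub>G\<close> in the denominator.\<close>
  have "poly (w * (V * f)) (act g x) = poly (w * (V * f)) x" if g: "g \<in> G" for g x
  proof -
    have "poly (w * (V * f)) (act g x) = (\<gamma> g * poly w (act g x)) * (\<gamma> g * poly V (act g x)) * poly f x"
      unfolding poly_mult f_act[OF g] by (simp add: power2_eq_square mult_ac)
    then show ?thesis unfolding w_inv[OF g] V_act[OF g] by simp
  qed
  then obtain \<mu>1 where \<mu>1: "w * (V * f) = \<mu>1 \<circ>\<^sub>p I" using invariant_poly by blast
  have fG: "poly f\<^sub>G (poly I x) = poly f x * poly V x ^ 2" for x
    using arg_cong[OF quotient_equation, of "\<lambda>p. poly p x"] by (simp add: poly_pcompose)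
  show thesis
  proof (rule that[of \<mu> \<mu>0 \<mu>1])
    show "\<mu> \<noteq> 0" using N0 \<mu> by auto
    \<comment> \<open>\<open>P\<close> stands for rationality over the base field, of which this
      locale knows nothing; only closure properties of \<open>P\<close> enter.\<close>
    have PD: "P D" and PE: "P E0" "P E1" unfolding D_def E0_def E1_def by (intro closed)+
    have "P N" unfolding N_def by (intro closed(9,10) PD)
    then show "P (\<mu> \<circ>\<^sub>p I)" by (simp only: \<mu>)
    have "P D'" unfolding D'_def by (intro closed(9,10) PD) simp
    then have "P u" "P w" unfolding u_def w_def using PE by (auto intro: closed(7))
    then show "P (\<mu>0 \<circ>\<^sub>p I)" "P (\<mu>1 \<circ>\<^sub>p I)"
      unfolding \<mu>0[symmetric] \<mu>1[symmetric] by (auto intro!: closed(5,6,7))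
    fix x y assume y: "y ^ 2 = poly f x"
    have "poly \<mu> (poly I x) = poly N x" "poly \<mu>0 (poly I x) = poly u x"
      "poly \<mu>1 (poly I x) = poly w x * (poly V x * poly f x)"
      by (simp_all add: \<mu> \<mu>0 flip: poly_pcompose \<mu>1)
    then have "(poly B0 x + y * poly B1 x) *
          (poly \<mu>0 (poly I x) * poly f\<^sub>G (poly I x) + poly V x * y * poly \<mu>1 (poly I x))
        = ((poly B0 x + y * poly B1 x) * (poly u x + y * poly w x)) * (poly f x * poly V x ^ 2)"
      by (simp add: fG power2_eq_square algebra_simps)
    also have "\<dots> = (poly A0 x + y * poly A1 x) * (poly \<mu> (poly I x) * poly f\<^sub>G (poly I x))"
      unfolding key[OF y] fG \<open>poly \<mu> (poly I x) = poly N x\<close> by (simp only: mult_ac)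
    finally show "(poly A0 x + y * poly A1 x) * (poly \<mu> (poly I x) * poly f\<^sub>G (poly I x))
        = (poly B0 x + y * poly B1 x) *
          (poly \<mu>0 (poly I x) * poly f\<^sub>G (poly I x) + poly V x * y * poly \<mu>1 (poly I x))" ..
  qed
qed

end

section \<open>Maps \<open>a X^q + b\<close> that normalise the group\<close>

locale normalising_frobenius = affine_curve G \<alpha> \<beta> \<gamma> c R f
  for G :: "'g set" and \<alpha> \<beta> \<gamma> :: "'g \<Rightarrow> 'a::alg_closed_field" and c :: 'a and R :: "'a set" and f :: "'a poly" +
  fixes a b d :: 'a and q s :: nat
  assumes q: "q = CHAR('a) ^ s"
    and f_frob: "y ^ 2 = poly f x \<Longrightarrow> poly f (a * x ^ q + b) = (d * y ^ q) ^ 2"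
    and normal: "g \<in> G \<Longrightarrow> \<exists>h\<in>G. \<forall>x. a * (\<alpha> g * x + \<beta> g) ^ q + b = \<alpha> h * (a * x ^ q + b) + \<beta> h"
begin

lemma q_pos: "q > 0" and odd_q: "odd q"
  using prime_char odd_char prime_odd_nat by (auto simp: q)

lemma pow_add: "(x + y) ^ q = x ^ q + (y::'a) ^ q"
  unfolding q by (rule freshmans_dream') (use prime_char in auto)

lemma pow_diff: "(x - y) ^ q = x ^ q - (y::'a) ^ q"
  using pow_add[of "x - y" y] by simp

lemma pow_eq_iff: "x ^ q = y ^ q \<longleftrightarrow> x = (y::'a)"
  using pow_diff[of x y] q_pos by auto

lemma f_frob': "poly f (a * x ^ q + b) = d ^ 2 * poly f x ^ q"
proof -
  obtain y where y: "y ^ 2 = poly f x" using ex_sqrt by blast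
  show ?thesis unfolding f_frob[OF y] y[symmetric] by (simp add: power_mult_distrib flip: power_mult) (simp add: mult.commute)
qed

text \<open>If \<open>a = 0\<close>, then \<open>f(b) = d^2 f(x)^q\<close> for all \<open>x\<close>;
  a root of \<open>f\<close> shows \<open>f(b) = 0\<close>, and any other point then gives
  \<open>d = 0\<close>.\<close>

lemma d_eq_0: "a = 0 \<Longrightarrow> d = 0"
proof -
  assume a: "a = 0"
  obtain r where "r \<in> R" using R_nonempty by blast
  then have "poly f r = 0" by (simp add: poly_f_eq_0)
  then have 0: "poly f b = 0" using f_frob'[of r] a q_pos by simp
  obtain x where "poly f x \<noteq> 0" using poly_eq_cofinite[of "{}" f 0] f_nz by auto
  then show "d = 0" using f_frob'[of x] 0 a by simp
qed

text \<open>Both sides of the normalising relation are affine in \<open>x^q\<close>; the values at 0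
  and 1 determine the coefficients, as \<open>a\<close> is non-zero.\<close>

lemma normal_coeffs:
  assumes "a \<noteq> 0" "g \<in> G"
  obtains h where "h \<in> G" "\<alpha> h = \<alpha> g ^ q" "a * \<beta> g ^ q + b = \<alpha> h * b + \<beta> h"
    "\<And>x. a * act g x ^ q + b = act h (a * x ^ q + b)"
proof -
  obtain h where h: "h \<in> G" "\<And>x. a * act g x ^ q + b = act h (a * x ^ q + b)" using normal[OF assms(2)] by blast
  have 0: "a * \<beta> g ^ q + b = \<alpha> h * b + \<beta> h" using h(2)[of 0] q_pos by simp
  have "a * (\<alpha> g ^ q + \<beta> g ^ q) + b = \<alpha> h * (a + b) + \<beta> h" using h(2)[of 1] by (simp add: pow_add)
  then have "a * \<alpha> g ^ q + (a * \<beta> g ^ q + b) = a * \<alpha> h + (\<alpha> h * b + \<beta> h)" by (simp add: algebra_simps)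
  then have "a * \<alpha> g ^ q = a * \<alpha> h" unfolding 0 by simp
  then have "\<alpha> h = \<alpha> g ^ q" using assms(1) by simp
  with h 0 that show thesis by blast
qed

text \<open>
  \<open>I(aX + b)\<close> is invariant under the group with coefficients \<open>\<alpha>\<^sup>q\<close>, \<open>\<beta>\<^sup>q\<close>, hence agrees with
  \<open>a\<^sup>N\<close> times the analogue of \<open>I\<close> for that group up to a constant.
\<close>

lemma I_frob: "poly I (a * x ^ q + b) = a ^ card G * poly I x ^ q + poly I b"
proof (cases "a = 0")
  case True
  then show ?thesis using card_G_pos by simp
next
  case a: False
  define J where "J = I \<circ>\<^sub>p [:b, a:]"
  define Iq where "Iq = (\<Prod>g\<in>G. [:\<beta> g ^ q, \<alpha> g ^ q:])"
  define r where "r = J - Polynomial.smult (a ^ card G) Iq"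
  have J: "poly J y = poly I (a * y + b)" for y by (simp add: J_def poly_pcompose algebra_simps)
  have Iq: "poly Iq y = (\<Prod>g\<in>G. \<alpha> g ^ q * y + \<beta> g ^ q)" for y
    by (simp add: Iq_def poly_prod algebra_simps)
  have dJ: "Polynomial.degree J = card G" "lead_coeff J = \<epsilon> * a ^ card G"
    using a lead_coeff_comp[of "[:b, a:]" I] by (simp_all add: J_def degree_pcompose degree_I lead_coeff_I)
  have dIq: "Polynomial.degree Iq = card G" "lead_coeff Iq = \<epsilon> ^ q"
    using degree_prod_linear[of G "\<lambda>g. \<alpha> g ^ q"] lead_coeff_prod_linear[of G "\<lambda>g. \<alpha> g ^ q"] alpha_nz
    by (simp_all add: Iq_def \<epsilon>_def prod_power_distrib)
  \<comment> \<open>This makes the leading coefficients agree, so that the difference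
    \<open>r\<close> has degree below \<open>card G\<close>.\<close>
  have "\<epsilon> ^ q = \<epsilon>" using \<epsilon>_cases odd_q by auto
  then have "Polynomial.coeff r (card G) = 0" using dJ dIq by (simp add: r_def)
  moreover have "Polynomial.degree r \<le> card G"
    unfolding r_def using dJ dIq by (intro degree_diff_le) (auto intro: order.trans[OF degree_smult_le])
  ultimately have "Polynomial.degree r < card G"
    using card_G_pos by (metis degree_0 leading_coeff_0_iff le_neq_implies_less)
  moreover have "inj_on (\<lambda>g. (\<alpha> g ^ q, \<beta> g ^ q)) G"
    by (auto simp: inj_on_def pow_eq_iff intro: faithful)
  moreover have "poly r (\<alpha> g ^ q * y + \<beta> g ^ q) = poly r y" if g: "g \<in> G" for g y
  proof -
    obtain h where h: "h \<in> G" "\<alpha> h = \<alpha> g ^ q" "a * \<beta> g ^ q + b = \<alpha> h * b + \<beta> h"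
      using normal_coeffs[OF a g] by metis
    have "a * (\<alpha> g ^ q * y + \<beta> g ^ q) + b = \<alpha> h * (a * y) + (a * \<beta> g ^ q + b)"
      by (simp add: h(2) algebra_simps)
    also have "\<dots> = act h (a * y + b)" unfolding h(3) by (simp add: algebra_simps)
    finally have "a * (\<alpha> g ^ q * y + \<beta> g ^ q) + b = act h (a * y + b)" .
    then have 1: "poly J (\<alpha> g ^ q * y + \<beta> g ^ q) = poly J y" unfolding J using I_act[OF h(1)] by simp
    obtain \<pi> where \<pi>: "bij_betw \<pi> G G" "\<And>k x. k \<in> G \<Longrightarrow> act (\<pi> k) x = act k (act g x)"
      using right_mult_bij[OF g] by metis
    have "\<alpha> (\<pi> k) ^ q * y + \<beta> (\<pi> k) ^ q = \<alpha> k ^ q * (\<alpha> g ^ q * y + \<beta> g ^ q) + \<beta> k ^ q" if k: "k \<in> G" for k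
    proof -
      have b: "\<beta> (\<pi> k) = \<alpha> k * \<beta> g + \<beta> k" using \<pi>(2)[OF k, of 0] by simp
      have "\<alpha> (\<pi> k) = \<alpha> k * \<alpha> g" using \<pi>(2)[OF k, of 1] b by (simp add: algebra_simps)
      with b show ?thesis by (simp add: pow_add power_mult_distrib algebra_simps)
    qed
    then have "poly Iq (\<alpha> g ^ q * y + \<beta> g ^ q) = (\<Prod>k\<in>G. \<alpha> (\<pi> k) ^ q * y + \<beta> (\<pi> k) ^ q)"
      unfolding Iq by simp
    also have "\<dots> = poly Iq y" unfolding Iq by (rule prod.reindex_bij_betw[OF \<pi>(1)])
    finally show ?thesis using 1 by (simp add: r_def)
  qed
  ultimately obtain c where c: "r = [:c:]"
    using constant_of_invariant[OF finite_G, where r = r and \<alpha> = "\<lambda>g. \<alpha> g ^ q" and \<beta> = "\<lambda>g. \<beta> g ^ q"] by blast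
  have Iqq: "poly Iq (y ^ q) = poly I y ^ q" for y
    unfolding Iq poly_I by (simp add: pow_add power_mult_distrib prod_power_distrib)
  \<comment> \<open>The identity of \<open>G\<close> contributes the factor \<open>X\<close> to
    \<open>I\<close>, hence also to its Frobenius twist \<open>Iq\<close>; evaluation at 0
    identifies the constant.\<close>
  have "poly Iq 0 = 0" using Iqq[of 0] I_0 q_pos by (simp add: zero_power)
  then have "c = poly I b" using arg_cong[OF c, of "\<lambda>p. poly p 0"] J[of 0] by (simp add: r_def)
  then have "poly J (x ^ q) - a ^ card G * poly Iq (x ^ q) = poly I b"
    using arg_cong[OF c, of "\<lambda>p. poly p (x ^ q)"] by (simp add: r_def)
  then show ?thesis unfolding J Iqq by (simp add: algebra_simps)
qed

lemma W_frob:
  assumes a: "a \<noteq> 0"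
  shows "poly W (a * x ^ q + b) = a ^ card U * poly W x ^ q"
proof -
  define \<phi> where "\<phi> x = a * x ^ q + b" for x
  have inj: "inj_on \<phi> U" using a by (auto simp: \<phi>_def inj_on_def pow_eq_iff)
  have "\<phi> u \<in> U" if u: "u \<in> U" for u
  proof -
    obtain g where g: "g \<in> G" "act g u = u" "\<alpha> g \<noteq> 1" using u fixed_alpha(1) unfolding U_def by blast
    obtain h where h: "h \<in> G" "\<alpha> h = \<alpha> g ^ q" "\<And>x. a * act g x ^ q + b = act h (a * x ^ q + b)"
      using normal_coeffs[OF a g(1)] by metis
    have "act h (\<phi> u) = \<phi> u" using h(3)[of u] g(2) by (simp add: \<phi>_def)
    moreover have "\<alpha> h \<noteq> 1" using h(2) g(3) pow_eq_iff[of "\<alpha> g" 1] by simp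
    ultimately show ?thesis using h(1) unfolding U_def by blast
  qed
  then have img: "\<phi> ` U = U" by (intro endo_inj_surj[OF finite_U _ inj]) auto
  have "poly W (\<phi> x) = (\<Prod>u\<in>\<phi> ` U. \<phi> x - u)" by (simp add: img poly_W)
  also have "\<dots> = (\<Prod>u\<in>U. a * (x - u) ^ q)"
    unfolding prod.reindex[OF inj] by (simp add: \<phi>_def pow_diff algebra_simps)
  finally show ?thesis by (simp add: \<phi>_def prod.distrib poly_W prod_power_distrib)
qed

text \<open>\<open>W(a X^q + b)\<close> produces the factor \<open>a ^ card U\<close>, where
  \<open>card U = card T\<close>, and \<open>V\<close> is the power of \<open>W\<close> with
  exponent \<open>card M div 2\<close>.\<close>

definition d\<^sub>G :: 'a where
  "d\<^sub>G = (if \<forall>g\<in>G. \<gamma> g = 1 then d else a ^ (card M div 2 * card T) * d)"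

lemma V_frob: "d * poly V (a * x ^ q + b) = d\<^sub>G * poly V x ^ q"
proof (cases "\<forall>g\<in>G. \<gamma> g = 1")
  case True
  then show ?thesis by (simp add: V_def d\<^sub>G_def)
next
  case False
  show ?thesis
  proof (cases "a = 0")
    case True
    then show ?thesis using d_eq_0 unfolding d\<^sub>G_def by simp
  next
    case a: False
    have "card U = card T" using card_U U_nonempty False by blast
    then show ?thesis
      unfolding V_def d\<^sub>G_def if_not_P[OF False] poly_power W_frob[OF a]
      by (simp add: power_mult_distrib mult.commute flip: power_mult)
  qed
qed

text \<open>\<open>I\<close> is surjective on the closure, so \<open>z\<close> may be written as
  \<open>I(x)\<close>, where both sides are known through \<open>f\<close> and
  \<open>V\<close>.\<close>

lemma f\<^sub>G_frob: "poly f\<^sub>G (a ^ card G * z ^ q + poly I b) = d\<^sub>G ^ 2 * poly f\<^sub>G z ^ q"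
proof -
  have fG: "poly f\<^sub>G (poly I x) = poly f x * poly V x ^ 2" for x
    using arg_cong[OF quotient_equation, of "\<lambda>p. poly p x"] by (simp add: poly_pcompose)
  obtain x where x: "poly I x = z" using poly_surj[of I z] card_G_pos degree_I by auto
  have "poly f\<^sub>G (a ^ card G * z ^ q + poly I b) = poly f\<^sub>G (poly I (a * x ^ q + b))"
    using I_frob[of x] x by simp
  also have "\<dots> = poly f x ^ q * (d * poly V (a * x ^ q + b)) ^ 2"
    unfolding fG f_frob' by (simp add: power_mult_distrib mult_ac)
  also have "\<dots> = d\<^sub>G ^ 2 * poly f\<^sub>G z ^ q"
    unfolding V_frob x[symmetric] fG by (simp add: power_mult_distrib mult_ac flip: power_mult)
  finally show ?thesis .
qed

end

section \<open>Affine groups of automorphisms\<close>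

lemma hyp_involution_wpoint:
  assumes "wpoint (weight f) x y z \<in> curve f"
  shows "hyp_involution f (wpoint (weight f) x y z) = wpoint (weight f) x (- y) z"
proof -
  have "(\<lambda>(x, y, z). (x, - y, z)) ` wpoint (weight f) x y z = wpoint (weight f) x (- y) z"
  proof (intro equalityI subsetI)
    fix v assume "v \<in> wpoint (weight f) x (- y) z"
    then obtain t where "t \<noteq> 0" "v = (t * x, t ^ weight f * (- y), t * z)" by (auto simp: mem_wpoint)
    then show "v \<in> (\<lambda>(x, y, z). (x, - y, z)) ` wpoint (weight f) x y z"
      by (intro image_eqI[of _ _ "(t * x, t ^ weight f * y, t * z)"]) (auto simp: mem_wpoint)
  qed (auto simp: mem_wpoint)
  then show ?thesis using assms by (simp add: hyp_involution_def)
qed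

lemma morphism_hyp_involution:
  assumes "curve_poly f"
  shows "morphism f f (hyp_involution f)"
proof (rule global_morphism[OF assms, where e = 1 and ?F0.0 = "\<lambda>(x, y, z). x" and ?F2.0 = "\<lambda>(x, y, z). z"
      and ?F1.0 = "\<lambda>v. to_ac (- 1) * (\<lambda>(x, y, z). y) v"])
  show "kpoly f" using assms by (simp add: curve_poly_def)
  show "wform (weight f) (weight f * 1) (\<lambda>v. to_ac (- 1) * (\<lambda>(x, y, z). y) v)"
    unfolding mult_1_right by (rule wform_smult[OF rangeI wform.y])
qed (simp_all add: wform.x[simplified] wform.z[simplified] hyp_involution_wpoint wpoint_in_curve)

lemma curve_poly_hyp_poly:
  assumes "hyperelliptic c R" "CHAR('k::field) > 2"
  shows "curve_poly (hyp_poly (c :: 'k) R)"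
proof -
  have R: "finite R" "R \<noteq> {}" "c \<noteq> 0" using assms(1) by (auto simp: hyperelliptic_def)
  have "Polynomial.degree (hyp_poly c R) = card R"
    using R by (simp add: hyp_poly_def degree_prod_linear)
  moreover have "(2 :: 'k alg_closure) \<noteq> 0"
  proof
    assume "(2 :: 'k alg_closure) = 0"
    then have "of_nat 2 = (0 :: 'k alg_closure)" by simp
    then have "CHAR('k) dvd 2" by (simp only: of_nat_eq_0_iff_char_dvd CHAR_alg_closure)
    with assms(2) show False by (auto dest: dvd_imp_le)
  qed
  ultimately show ?thesis
    using assms(1) R by (auto simp: curve_poly_def kpoly_iff hyperelliptic_def card_gt_0_iff)
qed

lemma on_coordsD: "on_coords f f' \<phi> u v \<Longrightarrow> y ^ 2 = poly f x \<Longrightarrow> \<phi> (aff f x y) = aff f' (u x y) (v x y)"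
  by (simp add: on_coords_def)

lemma on_coords_equation:
  assumes "morphism f f' \<phi>" "on_coords f f' \<phi> u v" "y ^ 2 = poly f x"
  shows "v x y ^ 2 = poly f' (u x y)"
  using morphism_mem[OF assms(1), of "aff f x y"] assms(3) on_coordsD[OF assms(2,3)]
  by (simp add: aff_in_curve_iff)

lemma affine_coeffs_unique:
  fixes \<alpha> \<beta> \<gamma> \<alpha>' \<beta>' \<gamma>' :: "'k::field alg_closure"
  assumes f: "f \<noteq> 0"
    and eq: "\<And>x y. y ^ 2 = poly f x \<Longrightarrow> \<alpha> * x + \<beta> = \<alpha>' * x + \<beta>' \<and> \<gamma> * y = \<gamma>' * y"
  shows "\<alpha> = \<alpha>' \<and> \<beta> = \<beta>' \<and> \<gamma> = \<gamma>'"
proof -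
  have 1: "\<alpha> * x + \<beta> = \<alpha>' * x + \<beta>'" for x using ex_sqrt[of "poly f x"] eq by blast
  obtain x where "poly f x \<noteq> 0" using poly_eq_cofinite[of "{}" f 0] f by auto
  moreover obtain y where "y ^ 2 = poly f x" using ex_sqrt by blast
  ultimately have "\<gamma> * y = \<gamma>' * y" "y \<noteq> 0" using eq by auto
  with 1[of 0] 1[of 1] show ?thesis by simp
qed

text \<open>Each group law is read off from the effect on affine points: over every \<open>x\<close>
  there is one, and some have \<open>y \<noteq> 0\<close>, so the coefficients are
  determined.\<close>

lemma affine_group_imp_affine_curve:
  fixes c :: "'k::field" and R :: "'k alg_closure set" and \<alpha> \<beta> \<gamma> :: "'k aut_char"
  defines "f \<equiv> hyp_poly c R"
  assumes char: "CHAR('k) > 2" and curve: "hyperelliptic c R"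
    and group: "affine_group f G \<alpha> \<beta> \<gamma>" and hyp: "hyp_involution f \<notin> G"
  shows "affine_curve G (\<lambda>g. to_ac (\<alpha> g)) (\<lambda>g. to_ac (\<beta> g)) (\<lambda>g. to_ac (\<gamma> g)) (to_ac c) R"
proof -
  have f: "curve_poly f" unfolding f_def by (rule curve_poly_hyp_poly[OF curve char])
  have f0: "f \<noteq> 0" using f by (auto simp: curve_poly_def)
  have two: "(2 :: 'k alg_closure) \<noteq> 0" using f by (simp add: curve_poly_def)
  let ?C = "curve f"
  have fin: "finite G" and sub: "subgroup G (BijGroup ?C)"
    and mor: "\<And>g. g \<in> G \<Longrightarrow> morphism f f g" and bij: "\<And>g. g \<in> G \<Longrightarrow> g \<in> Bij ?C"
    and oc: "\<And>g. g \<in> G \<Longrightarrow> on_coords f f g (\<lambda>x y. to_ac (\<alpha> g) * x + to_ac (\<beta> g)) (\<lambda>x y. to_ac (\<gamma> g) * y)"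
    using group unfolding affine_group_def Aut_def by blast+
  have act: "g (aff f x y) = aff f (to_ac (\<alpha> g) * x + to_ac (\<beta> g)) (to_ac (\<gamma> g) * y)"
    "(to_ac (\<gamma> g) * y) ^ 2 = poly f (to_ac (\<alpha> g) * x + to_ac (\<beta> g))"
    if "g \<in> G" "y ^ 2 = poly f x" for g x y
    using on_coordsD[OF oc[OF that(1)] that(2)] on_coords_equation[OF mor[OF that(1)] oc[OF that(1)] that(2)]
    by auto
  have aff_C: "aff f x y \<in> ?C" if "y ^ 2 = poly f x" for x y using that by (simp add: aff_in_curve_iff)
  have one: "(\<lambda>P\<in>?C. P) \<in> G"
    using subgroup.one_closed[OF sub] by (simp add: BijGroup_def)
  have comp: "compose ?C g h \<in> G" if "g \<in> G" "h \<in> G" for g h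
    using subgroup.m_closed[OF sub that] bij[OF that(1)] bij[OF that(2)] by (simp add: BijGroup_def)
  have coeffs: "\<alpha> k = \<alpha>' \<and> \<beta> k = \<beta>' \<and> \<gamma> k = \<gamma>'"
    if k: "k \<in> G" and eq: "\<And>x y. y ^ 2 = poly f x \<Longrightarrow>
      k (aff f x y) = aff f (to_ac \<alpha>' * x + to_ac \<beta>') (to_ac \<gamma>' * y)" for k \<alpha>' \<beta>' \<gamma>'
  proof -
    have "to_ac (\<alpha> k) * x + to_ac (\<beta> k) = to_ac \<alpha>' * x + to_ac \<beta>' \<and> to_ac (\<gamma> k) * y = to_ac \<gamma>' * y"
      if "y ^ 2 = poly f x" for x y
      using trans[OF act(1)[OF k that, symmetric] eq[OF that]] unfolding aff_eq_iff .
    from affine_coeffs_unique[OF f0 this] show ?thesis unfolding to_ac_eq_iff .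
  qed
  have ex_one: "\<exists>e\<in>G. \<alpha> e = 1 \<and> \<beta> e = 0 \<and> \<gamma> e = 1"
    by (rule bexI[OF _ one], rule coeffs[OF one]) (simp add: aff_C)
  have ex_mult: "\<exists>k\<in>G. \<alpha> k = \<alpha> g * \<alpha> h \<and> \<beta> k = \<alpha> g * \<beta> h + \<beta> g \<and> \<gamma> k = \<gamma> g * \<gamma> h"
    if g: "g \<in> G" and h: "h \<in> G" for g h
  proof (rule bexI[OF _ comp[OF g h]], rule coeffs[OF comp[OF g h]])
    fix x y assume y: "y ^ 2 = poly f x"
    show "compose ?C g h (aff f x y)
      = aff f (to_ac (\<alpha> g * \<alpha> h) * x + to_ac (\<alpha> g * \<beta> h + \<beta> g)) (to_ac (\<gamma> g * \<gamma> h) * y)"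
      using aff_C[OF y] act(1)[OF h y] act(1)[OF g act(2)[OF h y]]
      by (simp add: compose_def algebra_simps)
  qed
  have ex_inverse: "\<exists>k\<in>G. \<alpha> k * \<alpha> g = 1 \<and> \<alpha> k * \<beta> g + \<beta> k = 0 \<and> \<gamma> k * \<gamma> g = 1" if g: "g \<in> G" for g
  proof -
    define k where "k = (\<lambda>P\<in>?C. inv_into ?C g P)"
    have k: "k \<in> G"
      using subgroup.m_inv_closed[OF sub g] inv_BijGroup[OF bij[OF g]] by (simp add: k_def)
    have kg: "k (g P) = P" if "P \<in> ?C" for P
      using bij[OF g] that morphism_mem[OF mor[OF g] that] by (simp add: k_def Bij_def bij_betw_def)
    have "\<alpha> k * \<alpha> g = 1 \<and> \<alpha> k * \<beta> g + \<beta> k = 0 \<and> \<gamma> k * \<gamma> g = 1"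
    proof -
      have "to_ac (\<alpha> k * \<alpha> g) = 1 \<and> to_ac (\<alpha> k * \<beta> g + \<beta> k) = 0 \<and> to_ac (\<gamma> k * \<gamma> g) = 1"
      proof (rule affine_coeffs_unique[OF f0])
        fix x y assume y: "y ^ 2 = poly f x"
        have "aff f x y = k (g (aff f x y))" using kg aff_C[OF y] by simp
        also have "\<dots> = aff f (to_ac (\<alpha> k * \<alpha> g) * x + to_ac (\<alpha> k * \<beta> g + \<beta> k)) (to_ac (\<gamma> k * \<gamma> g) * y)"
          unfolding act(1)[OF g y] act(1)[OF k act(2)[OF g y]] by (simp add: algebra_simps)
        finally show "to_ac (\<alpha> k * \<alpha> g) * x + to_ac (\<alpha> k * \<beta> g + \<beta> k) = 1 * x + 0 \<and>
            to_ac (\<gamma> k * \<gamma> g) * y = 1 * y"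
          by (simp add: aff_eq_iff)
      qed
      then show ?thesis unfolding to_ac_eq_1_iff to_ac_eq_0_iff .
    qed
    with k show ?thesis by blast
  qed
  have f_act: "poly f (to_ac (\<alpha> g) * x + to_ac (\<beta> g)) = to_ac (\<gamma> g) ^ 2 * poly f x" if "g \<in> G" for g x
  proof -
    obtain y where y: "y ^ 2 = poly f x" using ex_sqrt by blast
    show ?thesis using act(2)[OF that y] y by (simp add: power_mult_distrib)
  qed
  \<comment> \<open>Group elements are maps that are undefined off the curve, so equality needs all
    points, including those at infinity; \<open>morphism_unique\<close> supplies the latter.\<close>
  have same: "g = h" if g: "g \<in> G" and h: "h \<in> extensional ?C" "morphism f f h"
    and eq: "\<And>x y. y ^ 2 = poly f x \<Longrightarrow> g (aff f x y) = h (aff f x y)" for g h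
  proof (rule extensionalityI)
    show "g \<in> extensional ?C" using bij[OF g] by (simp add: Bij_def)
    show "g P = h P" if "P \<in> ?C" for P using morphism_unique[OF mor[OF g] h(2) f eq that] .
  qed (rule h)
  have faithful: "g = h" if g: "g \<in> G" and h: "h \<in> G" and eq: "\<alpha> g = \<alpha> h" "\<beta> g = \<beta> h" for g h
  proof -
    obtain x where x: "poly f x \<noteq> 0" using poly_eq_cofinite[of "{}" f 0] f0 by auto
    have "to_ac (\<gamma> g) ^ 2 * poly f x = to_ac (\<gamma> h) ^ 2 * poly f x"
      by (simp only: eq flip: f_act[OF g] f_act[OF h])
    then have "to_ac (\<gamma> g ^ 2) = to_ac (\<gamma> h ^ 2)" using x by simp
    then have "\<gamma> g ^ 2 = \<gamma> h ^ 2" unfolding to_ac_eq_iff .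
    then consider "\<gamma> g = \<gamma> h" | "\<gamma> g = - \<gamma> h" by (auto simp: power2_eq_iff)
    then show ?thesis
    proof cases
      case 1
      have "h \<in> extensional ?C" using bij[OF h] by (simp add: Bij_def)
      then show ?thesis using same[OF g _ mor[OF h]] act(1)[OF g] act(1)[OF h] eq 1 by simp
    next
      case 2
      \<comment> \<open>\<open>j\<close> is \<open>h^(-1) g\<close>: it fixes \<open>X\<close> and
        changes the sign of \<open>Y\<close>, so it is the excluded involution.\<close>
      obtain i where i: "i \<in> G" "\<alpha> i * \<alpha> h = 1" "\<alpha> i * \<beta> h + \<beta> i = 0" "\<gamma> i * \<gamma> h = 1"
        using ex_inverse[OF h] by blast
      obtain j where j: "j \<in> G" "\<alpha> j = \<alpha> i * \<alpha> g" "\<beta> j = \<alpha> i * \<beta> g + \<beta> i" "\<gamma> j = \<gamma> i * \<gamma> g"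
        using ex_mult[OF i(1) g] by blast
      have "j = hyp_involution f"
      proof (rule same[OF j(1)])
        show "hyp_involution f \<in> extensional ?C" by (simp add: hyp_involution_def)
        show "morphism f f (hyp_involution f)" by (rule morphism_hyp_involution[OF f])
        fix x y assume y: "y ^ 2 = poly f x"
        show "j (aff f x y) = hyp_involution f (aff f x y)"
          using act(1)[OF j(1) y] j eq i 2 hyp_involution_wpoint[of f x y 1] aff_C[OF y] by (simp add: aff_def)
      qed
      with j(1) hyp show ?thesis by simp
    qed
  qed
  have of: "f = Polynomial.smult (to_ac c) (\<Prod>r\<in>R. [:- r, 1:])" by (simp add: f_def hyp_poly_def)
  show ?thesis
  proof
    show "\<exists>e\<in>G. to_ac (\<alpha> e) = 1 \<and> to_ac (\<beta> e) = 0 \<and> to_ac (\<gamma> e) = 1" using ex_one by simp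
    show "\<exists>k\<in>G. to_ac (\<alpha> k) = to_ac (\<alpha> g) * to_ac (\<alpha> h) \<and>
        to_ac (\<beta> k) = to_ac (\<alpha> g) * to_ac (\<beta> h) + to_ac (\<beta> g) \<and> to_ac (\<gamma> k) = to_ac (\<gamma> g) * to_ac (\<gamma> h)"
      if "g \<in> G" "h \<in> G" for g h
      using ex_mult[OF that] by (simp flip: to_ac_mult to_ac_add)
    show "\<exists>k\<in>G. to_ac (\<alpha> k) * to_ac (\<alpha> g) = 1 \<and> to_ac (\<alpha> k) * to_ac (\<beta> g) + to_ac (\<beta> k) = 0 \<and>
        to_ac (\<gamma> k) * to_ac (\<gamma> g) = 1" if "g \<in> G" for g
      using ex_inverse[OF that] by (simp flip: to_ac_mult to_ac_add)
    show "g = h" if "g \<in> G" "h \<in> G" "to_ac (\<alpha> g) = to_ac (\<alpha> h)" "to_ac (\<beta> g) = to_ac (\<beta> h)" for g h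
      using faithful that by simp
    show "2 < CHAR('k alg_closure)" using char by simp
    show "finite R" "R \<noteq> {}" "to_ac c \<noteq> 0" using curve by (auto simp: hyperelliptic_def)
    show "poly (Polynomial.smult (to_ac c) (\<Prod>r\<in>R. [:- r, 1:])) (to_ac (\<alpha> g) * x + to_ac (\<beta> g)) =
        (to_ac (\<gamma> g))\<^sup>2 * poly (Polynomial.smult (to_ac c) (\<Prod>r\<in>R. [:- r, 1:])) x" if "g \<in> G" for g x
      using f_act[OF that] by (simp only: of)
  qed (rule fin)
qed

section \<open>The quotient map\<close>

locale affine_aut_group =
  fixes c :: "'k::field" and R :: "'k alg_closure set" and G :: "('k point \<Rightarrow> 'k point) set"
    and \<alpha> \<beta> \<gamma> :: "('k point \<Rightarrow> 'k point) \<Rightarrow> 'k"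
  assumes char: "CHAR('k) > 2" and hyperelliptic: "hyperelliptic c R"
    and affine_group: "affine_group (hyp_poly c R) G \<alpha> \<beta> \<gamma>"
    and no_involution: "hyp_involution (hyp_poly c R) \<notin> G"
begin

sublocale affine_curve G "\<lambda>g. to_ac (\<alpha> g)" "\<lambda>g. to_ac (\<beta> g)" "\<lambda>g. to_ac (\<gamma> g)" "to_ac c" R "hyp_poly c R"
  by (rule affine_group_imp_affine_curve[OF char hyperelliptic affine_group no_involution])
     (simp add: hyp_poly_def)

abbreviation f :: "'k kbar_poly" where "f \<equiv> hyp_poly c R"

lemma curve_poly_f: "curve_poly f"
  by (rule curve_poly_hyp_poly[OF hyperelliptic char])

lemma kpoly_f: "kpoly f"
  using curve_poly_f by (simp add: curve_poly_def)

lemma G_act: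
  assumes "g \<in> G" "y ^ 2 = poly f x"
  shows "morphism f f g" "g (aff f x y) = aff f (act g x) (to_ac (\<gamma> g) * y)"
    "(to_ac (\<gamma> g) * y) ^ 2 = poly f (act g x)"
proof -
  show 1: "morphism f f g" using affine_group assms(1) unfolding affine_group_def Aut_def by blast
  have 2: "on_coords f f g (\<lambda>x y. act g x) (\<lambda>x y. to_ac (\<gamma> g) * y)"
    using affine_group assms(1) unfolding affine_group_def by blast
  show "g (aff f x y) = aff f (act g x) (to_ac (\<gamma> g) * y)" using on_coordsD[OF 2 assms(2)] .
  show "(to_ac (\<gamma> g) * y) ^ 2 = poly f (act g x)" using on_coords_equation[OF 1 2 assms(2)] .
qed

lemma identity_iff:
  assumes "g \<in> G"
  shows "g = (\<lambda>P\<in>curve f. P) \<longleftrightarrow> \<alpha> g = 1 \<and> \<beta> g = 0"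
proof -
  let ?e = "\<lambda>P\<in>curve f. P"
  have e: "?e \<in> G"
    using affine_group subgroup.one_closed[of G "BijGroup (curve f)"] by (simp add: affine_group_def BijGroup_def)
  have eq: "act ?e x = x" for x
  proof -
    obtain y where y: "y ^ 2 = poly f x" using ex_sqrt by blast
    then have "aff f x y \<in> curve f" by (simp add: aff_in_curve_iff)
    then show ?thesis using G_act(2)[OF e y] by (simp add: aff_eq_iff)
  qed
  have ae: "\<alpha> ?e = 1" "\<beta> ?e = 0" using eq[of 0] eq[of 1] by simp_all
  show ?thesis
  proof
    assume "\<alpha> g = 1 \<and> \<beta> g = 0"
    then show "g = ?e" by (intro faithful[OF assms e]) (simp_all add: ae)
  qed (use ae in auto)
qed

text \<open>\<open>U\<close> is taken in the closure, but the fixed point of \<open>g\<close> is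
  \<open>\<beta> g / (1 - \<alpha> g)\<close>, which lies in \<open>k\<close>.\<close>

lemma U_eq_fixed_points: "U = to_ac ` fixed_points f G \<alpha> \<beta>"
proof (intro equalityI subsetI)
  fix u assume "u \<in> U"
  then obtain g where g: "g \<in> G" "\<not> (to_ac (\<alpha> g) = 1 \<and> to_ac (\<beta> g) = 0)" "act g u = u"
    unfolding U_def by blast
  define a where "a = \<beta> g / (1 - \<alpha> g)"
  have u: "u = to_ac a" using fixed_alpha(2)[OF g(1,3,2)] by (simp add: a_def)
  have "to_ac (\<alpha> g * a + \<beta> g) = to_ac a" using g(3) by (simp add: u)
  then have "\<alpha> g * a + \<beta> g = a" unfolding to_ac_eq_iff .
  then have "a \<in> fixed_points f G \<alpha> \<beta>" using g identity_iff[OF g(1)] unfolding fixed_points_def by auto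
  then show "u \<in> to_ac ` fixed_points f G \<alpha> \<beta>" using u by blast
next
  fix u assume "u \<in> to_ac ` fixed_points f G \<alpha> \<beta>"
  then obtain a g where g: "u = to_ac a" "g \<in> G" "g \<noteq> (\<lambda>P\<in>curve f. P)" "\<alpha> g * a + \<beta> g = a"
    unfolding fixed_points_def by blast
  have "act g u = u" unfolding g(1) by (simp only: g(4) flip: to_ac_mult to_ac_add)
  moreover have "\<not> (to_ac (\<alpha> g) = 1 \<and> to_ac (\<beta> g) = 0)" using identity_iff[OF g(2)] g(3) by simp
  ultimately show "u \<in> U" using g(2) unfolding U_def by blast
qed

lemma card_fixed_points: "card (fixed_points f G \<alpha> \<beta>) = card U"
  unfolding U_eq_fixed_points by (rule card_image[symmetric]) (simp add: inj_on_def)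

lemma lam_eq: "lam = to_ac (lambda f G \<alpha> \<beta>)"
  unfolding lam_def lambda_def U_eq_fixed_points to_ac_prod by (subst prod.reindex) (auto simp: inj_on_def)

text \<open>\<open>card U = card T\<close> and \<open>card G = card M * card T\<close>. For empty
  \<open>U\<close> the division by zero would make \<open>m_of\<close> zero.\<close>

lemma m_of_eq: "U \<noteq> {} \<Longrightarrow> m_of f G \<alpha> \<beta> = card M"
  unfolding m_of_def card_fixed_points using card_T_pos by (simp add: card_U card_G)

lemma gamma_trivial_iff: "(\<forall>g\<in>G. to_ac (\<gamma> g) = 1) \<longleftrightarrow> (\<forall>g\<in>G. \<gamma> g = 1)"
  by simp

lemma f\<^sub>G_eq: "f\<^sub>G = quotient_poly c R G \<alpha> \<beta> \<gamma>"
proof (cases "\<forall>g\<in>G. \<gamma> g = 1")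
  case True
  then show ?thesis unfolding f\<^sub>G_def quotient_poly_def Let_def S_def orbits_def by simp
next
  case False
  then have "U \<noteq> {}" using U_nonempty by auto
  then show ?thesis using False m_of_eq
    unfolding f\<^sub>G_def gamma_trivial_iff quotient_poly_def Let_def if_not_P[OF False] S_def orbits_def
    by (simp add: lam_eq flip: U_eq_fixed_points)
qed

lemma quotient_y_eq: "quotient_y f G \<alpha> \<beta> \<gamma> x y = poly V x * y"
proof (cases "\<forall>g\<in>G. \<gamma> g = 1")
  case True
  then show ?thesis by (simp add: quotient_y_def V_def)
next
  case False
  then have U: "U \<noteq> {}" using U_nonempty by auto
  have "inv_IT G \<alpha> \<beta> x = (\<Prod>g\<in>{g \<in> G. to_ac (\<alpha> g) = 1}. to_ac (\<beta> g) + x)"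
    unfolding inv_IT_def by (rule prod.cong) (auto simp: add.commute)
  also have "\<dots> = poly (\<Prod>t\<in>T. [:t, 1:]) x"
    unfolding T_def by (subst prod.reindex[OF inj_beta_fibre]) (simp add: poly_prod)
  also have "\<dots> = poly W x + lam" unfolding translates_poly[OF U] by simp
  finally show ?thesis
    unfolding quotient_y_def V_def gamma_trivial_iff if_not_P[OF False] m_of_eq[OF U] lam_eq by simp
qed

lemma inv_I_eq: "inv_I G \<alpha> \<beta> x = poly I x"
  by (simp add: inv_I_def poly_I)

lemma kpoly_act: "kpoly [:to_ac (\<beta> g), to_ac (\<alpha> g):]"
  by (intro kpoly_pCons kpoly_0 rangeI)

lemma kpoly_I: "kpoly I"
  unfolding I_def by (intro kpoly_prod kpoly_act)

lemma kpoly_V: "kpoly V"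
proof -
  have "kpoly [:- u, 1:]" if "u \<in> U" for u
    using that unfolding U_eq_fixed_points
    by (intro kpoly_pCons kpoly_0) (auto intro: range_to_ac_closed(5) range_eqI[of _ _ 1])
  then have "kpoly W" unfolding W_def by (rule kpoly_prod)
  then show ?thesis unfolding V_def by (auto intro: kpoly_power)
qed

lemma degree_I_pos: "Polynomial.degree I > 0"
  using degree_I card_G_pos by simp

text \<open>The products over orbits are only known to lie in the closure; rationality comes from
  \<open>f\<^sub>G \<circ> I = f V^2\<close>, in which \<open>I\<close>, \<open>f\<close> and
  \<open>V\<close> are defined over \<open>k\<close>.\<close>

lemma kpoly_f\<^sub>G: "kpoly f\<^sub>G"
  by (rule kpoly_descend[OF _ kpoly_I degree_I_pos])
     (simp only: quotient_equation kpoly_mult kpoly_power kpoly_f kpoly_V)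

lemma hyperelliptic_f\<^sub>G: "\<exists>c' R'. hyperelliptic c' R' \<and> f\<^sub>G = hyp_poly c' R'"
proof -
  obtain n R' where R': "finite R'" "R' \<noteq> {}"
    "f\<^sub>G = Polynomial.smult (to_ac c * (- 1) ^ n) (\<Prod>r\<in>R'. [:- r, 1:])"
    using f\<^sub>G_factors by blast
  have f: "f\<^sub>G = hyp_poly (c * (- 1) ^ n) R'" by (simp add: R'(3) hyp_poly_def)
  have "hyperelliptic (c * (- 1) ^ n) R'"
    using R'(1,2) c_nz kpoly_f\<^sub>G unfolding hyperelliptic_def f[symmetric] kpoly_iff by simp
  with f show ?thesis by blast
qed

lemma curve_poly_f\<^sub>G: "curve_poly f\<^sub>G"
  using hyperelliptic_f\<^sub>G curve_poly_hyp_poly char by metis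

lemma quotient_map_exists:
  obtains \<pi> where "quotient_map f G f\<^sub>G \<pi>" "morphism f f\<^sub>G \<pi>"
    "on_coords f f\<^sub>G \<pi> (\<lambda>x y. poly I x) (\<lambda>x y. poly V x * y)"
proof -
  obtain \<pi> where \<pi>: "morphism f f\<^sub>G \<pi>" "on_coords f f\<^sub>G \<pi> (\<lambda>x y. poly I x) (\<lambda>x y. poly V x * y)"
    using polynomial_morphism[OF curve_poly_f kpoly_f\<^sub>G kpoly_I kpoly_V quotient_equation] by metis
  have coords: "\<pi> (aff f x y) = aff f\<^sub>G (poly I x) (poly V x * y)" if "y ^ 2 = poly f x" for x y
    using on_coordsD[OF \<pi>(2) that] .
  have inv: "\<pi> (g P) = \<pi> P" if g: "g \<in> G" and P: "P \<in> curve f" for g P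
  proof (rule morphism_unique[OF morphism_compose[OF _ \<pi>(1)] \<pi>(1) curve_poly_f _ P])
    show "morphism f f g" using affine_group g unfolding affine_group_def Aut_def by blast
    fix x y assume y: "y ^ 2 = poly f x"
    have eq: "poly V (act g x) * (to_ac (\<gamma> g) * y) = poly V x * y"
      using V_act[OF g, of x] by (simp add: mult_ac)
    show "\<pi> (g (aff f x y)) = \<pi> (aff f x y)"
      unfolding G_act(2)[OF g y] coords[OF y] coords[OF G_act(3)[OF g y]] I_act[OF g] by (simp only: eq)
  qed
  have pull: "\<exists>A' B'. ratfun f\<^sub>G A' B' \<and> is_pullback f \<pi> A B A' B'"
    if rf: "ratfun f A B" and ir: "invariant_ratfun f G A B" for A B
  proof -
    obtain e P v where AB: "wform (weight f) e A" "wform (weight f) e B" "P \<in> curve f" "v \<in> P" "B v \<noteq> 0"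
      using rf unfolding ratfun_def by blast
    obtain A0 A1 where A: "kpoly A0" "kpoly A1" "Polynomial.degree A0 \<le> e"
      "A1 = 0 \<or> Polynomial.degree A1 + weight f \<le> e"
      "\<forall>x y z. y ^ 2 = homog f x z \<longrightarrow> A (x, y, z) = homogen e A0 x z + y * homogen (e - weight f) A1 x z"
      using wform_normal_form[OF AB(1) kpoly_f] by (elim exE conjE)
    obtain B0 B1 where B: "kpoly B0" "kpoly B1" "Polynomial.degree B0 \<le> e"
      "B1 = 0 \<or> Polynomial.degree B1 + weight f \<le> e"
      "\<forall>x y z. y ^ 2 = homog f x z \<longrightarrow> B (x, y, z) = homogen e B0 x z + y * homogen (e - weight f) B1 x z"
      using wform_normal_form[OF AB(2) kpoly_f] by (elim exE conjE)
    have A_aff: "A (x, y, 1) = poly A0 x + y * poly A1 x" if "y ^ 2 = poly f x" for x y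
      using A(5)[rule_format, of y x 1] A(3,4) that by (auto simp: homogen_z1)
    have B_aff: "B (x, y, 1) = poly B0 x + y * poly B1 x" if "y ^ 2 = poly f x" for x y
      using B(5)[rule_format, of y x 1] B(3,4) that by (auto simp: homogen_z1)
    have Bnz: "B0 \<noteq> 0 \<or> B1 \<noteq> 0"
    proof (rule ccontr)
      assume "\<not> (B0 \<noteq> 0 \<or> B1 \<noteq> 0)"
      then have "B v = 0" using B(5)[rule_format] curve_memD(2)[OF AB(3)] AB(4) by (cases v) auto
      with AB(5) show False by simp
    qed
    have inv_AB: "(poly A0 (act g x) + to_ac (\<gamma> g) * y * poly A1 (act g x)) * (poly B0 x + y * poly B1 x)
        = (poly A0 x + y * poly A1 x) * (poly B0 (act g x) + to_ac (\<gamma> g) * y * poly B1 (act g x))"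
      if g: "g \<in> G" and y: "y ^ 2 = poly f x" and nz: "poly B0 x + y * poly B1 x \<noteq> 0"
        "poly B0 (act g x) + to_ac (\<gamma> g) * y * poly B1 (act g x) \<noteq> 0" for g x y
    proof -
      let ?v = "(x, y, 1)" and ?w = "(act g x, to_ac (\<gamma> g) * y, 1)"
      note gy = G_act(3)[OF g y]
      have "B ?v \<noteq> 0" "B ?w \<noteq> 0" using nz by (simp_all add: B_aff[OF y] B_aff[OF gy])
      moreover have "aff f x y \<in> curve f" "?v \<in> aff f x y" "?w \<in> g (aff f x y)"
        using y by (simp_all add: aff_in_curve_iff aff_self G_act(2)[OF g y])
      ultimately have "A ?w / B ?w = A ?v / B ?v"
        using ir g unfolding invariant_ratfun_def by blast
      then have "A ?w * B ?v = A ?v * B ?w" using frac_eq_eq[OF \<open>B ?w \<noteq> 0\<close> \<open>B ?v \<noteq> 0\<close>] by blast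
      then show ?thesis unfolding A_aff[OF y] B_aff[OF y] A_aff[OF gy] B_aff[OF gy] .
    qed
    obtain \<mu> \<mu>0 \<mu>1 where \<mu>: "\<mu> \<noteq> 0" "kpoly (\<mu> \<circ>\<^sub>p I)" "kpoly (\<mu>0 \<circ>\<^sub>p I)" "kpoly (\<mu>1 \<circ>\<^sub>p I)"
      and id: "\<And>x y. y ^ 2 = poly f x \<Longrightarrow>
      (poly A0 x + y * poly A1 x) * (poly \<mu> (poly I x) * poly f\<^sub>G (poly I x))
        = (poly B0 x + y * poly B1 x) *
          (poly \<mu>0 (poly I x) * poly f\<^sub>G (poly I x) + poly V x * y * poly \<mu>1 (poly I x))"
      by (rule invariant_fraction[OF Bnz inv_AB, of kpoly])
         (auto intro: A B kpoly_f kpoly_V kpoly_mult kpoly_diff kpoly_prod kpoly_pcompose kpoly_act)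
    have k: "kpoly \<mu>" "kpoly \<mu>0" "kpoly \<mu>1"
      using \<mu>(2-4) kpoly_descend[OF _ kpoly_I degree_I_pos] by blast+
    define h where "h = weight f\<^sub>G"
    \<comment> \<open>A common degree large enough for all terms; the summand \<open>h\<close> makes
      \<open>E - h\<close> a true difference.\<close>
    define E where "E = Polynomial.degree (\<mu>0 * f\<^sub>G) + Polynomial.degree (\<mu> * f\<^sub>G) + Polynomial.degree \<mu>1 + h"
    define A' :: "'k coords \<Rightarrow> 'k alg_closure" where
      "A' = (\<lambda>v. (\<lambda>(x, y, z). homogen E (\<mu>0 * f\<^sub>G) x z) v
        + (\<lambda>(x, y, z). y) v * (\<lambda>(x, y, z). homogen (E - h) \<mu>1 x z) v)"
    define B' :: "'k coords \<Rightarrow> 'k alg_closure" where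
      "B' = (\<lambda>(x, y, z). homogen E (\<mu> * f\<^sub>G) x z)"
    have "wform h E (\<lambda>v. (\<lambda>(x, y, z). y) v * (\<lambda>(x, y, z). homogen (E - h) \<mu>1 x z) v)"
      by (rule wform_mult'[OF wform.y wform_homogen[OF k(3)]]) (simp add: E_def)
    then have A': "wform h E A'" unfolding A'_def
      by (intro wform.add wform_homogen kpoly_mult k kpoly_f\<^sub>G)
    have B': "wform h E B'" unfolding B'_def by (intro wform_homogen kpoly_mult k kpoly_f\<^sub>G)
    have A'_aff: "A' (x, y, 1) = poly \<mu>0 x * poly f\<^sub>G x + y * poly \<mu>1 x" for x y
      by (simp add: A'_def homogen_z1 E_def)
    have B'_aff: "B' (x, y, 1) = poly \<mu> x * poly f\<^sub>G x" for x y
      by (simp add: B'_def homogen_z1 E_def)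
    have "\<mu> * f\<^sub>G \<noteq> 0" using \<mu>(1) curve_poly_f\<^sub>G by (auto simp: curve_poly_def)
    then obtain z where z: "poly \<mu> z * poly f\<^sub>G z \<noteq> 0" using poly_eq_cofinite[of "{}" "\<mu> * f\<^sub>G" 0] by auto
    \<comment> \<open>The point over \<open>z\<close> on the quotient lifts to the curve because
      \<open>I\<close> is surjective. It witnesses that the denominator is non-zero both on the
      quotient and after pulling back.\<close>
    obtain x0 where x0: "poly I x0 = z" using poly_surj[OF degree_I_pos] by metis
    obtain y0 where y0: "y0 ^ 2 = poly f x0" using ex_sqrt by blast
    have c0: "aff f x0 y0 \<in> curve f" using y0 by (simp add: aff_in_curve_iff)
    have c1: "aff f\<^sub>G z (poly V x0 * y0) \<in> curve f\<^sub>G"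
      using morphism_mem[OF \<pi>(1) c0] unfolding coords[OF y0] x0 .
    have "ratfun f\<^sub>G A' B'"
      unfolding ratfun_def h_def[symmetric]
    proof
      show "\<exists>e. wform h e A' \<and> wform h e B'" using A' B' by blast
      show "\<exists>P\<in>curve f\<^sub>G. \<exists>v\<in>P. B' v \<noteq> 0"
        using c1 aff_self[of z "poly V x0 * y0" f\<^sub>G] z B'_aff by metis
    qed
    moreover have "is_pullback f \<pi> A B A' B'"
      unfolding is_pullback_def
    proof (intro conjI ballI impI)
      show "\<exists>P\<in>curve f. \<exists>w\<in>\<pi> P. B' w \<noteq> 0"
        using c0 coords[OF y0] x0 aff_self[of z "poly V x0 * y0" f\<^sub>G] z B'_aff by metis
      fix P v w assume P: "P \<in> curve f" "v \<in> P" "w \<in> \<pi> P" and nz: "B v \<noteq> 0 \<and> B' w \<noteq> 0"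
      \<comment> \<open>With denominators cleared the identity is one between forms, so its affine
        case suffices.\<close>
      have "\<exists>w\<in>\<pi> (aff f x y). A (x, y, 1) * B' w = B (x, y, 1) * A' w" if y: "y ^ 2 = poly f x" for x y
        unfolding coords[OF y]
      proof (rule bexI[OF _ aff_self])
        show "A (x, y, 1) * B' (poly I x, poly V x * y, 1) = B (x, y, 1) * A' (poly I x, poly V x * y, 1)"
          unfolding A_aff[OF y] B_aff[OF y] A'_aff B'_aff by (rule id[OF y])
      qed
      from pullback_identity_extends[OF \<pi>(1) curve_poly_f AB(1,2) A'[unfolded h_def] B'[unfolded h_def] this P]
      have "A v * B' w = B v * A' w" .
      then show "A v / B v = A' w / B' w" using nz by (simp add: frac_eq_eq mult.commute)
    qed
    ultimately show ?thesis by blast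
  qed
  have "quotient_map f G f\<^sub>G \<pi>"
    unfolding quotient_map_def using hyperelliptic_f\<^sub>G \<pi>(1) inv pull by blast
  with \<pi> that show thesis by blast
qed

end

section \<open>The descended map\<close>

lemma prime_to_part_eq:
  assumes "prime p" "\<not> p dvd m" "m > 0"
  shows "prime_to_part p (m * p ^ e) = m"
proof -
  have "\<not> p ^ Suc e dvd m * p ^ e"
    using assms by (simp add: prime_gt_0_nat)
  then have "multiplicity p (m * p ^ e) = e" by (intro multiplicity_eqI) auto
  then show ?thesis using assms by (simp add: prime_to_part_def prime_gt_0_nat)
qed

theorem theorem1p3:
  fixes c a b d :: "'k::field" and R :: "'k alg_closure set"
    and G :: "('k point \<Rightarrow> 'k point) set" and \<alpha> \<beta> \<gamma> :: "('k point \<Rightarrow> 'k point) \<Rightarrow> 'k"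
    and \<Phi> :: "'k point \<Rightarrow> 'k point" and p q s :: nat
  defines "f \<equiv> hyp_poly c R"
    and "f' \<equiv> quotient_poly c R G \<alpha> \<beta> \<gamma>"
    and "m \<equiv> prime_to_part p (card G)"
  assumes char: "CHAR('k) = p" "p > 2"
    and curve: "hyperelliptic c R"
    and group: "affine_group f G \<alpha> \<beta> \<gamma>" "hyp_involution f \<notin> G"
    and q: "q = p ^ s"
    and Phi: "morphism f f \<Phi>"
      "on_coords f f \<Phi> (\<lambda>x y. to_ac a * x ^ q + to_ac b) (\<lambda>x y. to_ac d * y ^ q)"
      "normalises f \<Phi> G"
  shows "\<exists>\<pi>. quotient_map f G f' \<pi> \<and>
           on_coords f f' \<pi> (\<lambda>x y. inv_I G \<alpha> \<beta> x) (quotient_y f G \<alpha> \<beta> \<gamma>) \<and>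
           (\<exists>\<Psi>. morphism f' f' \<Psi> \<and>
                (\<forall>P\<in>curve f. \<pi> (\<Phi> P) = \<Psi> (\<pi> P)) \<and>
                on_coords f' f' \<Psi>
                  (\<lambda>x y. to_ac (a ^ card G) * x ^ q + to_ac (\<Prod>g\<in>G. \<alpha> g * b + \<beta> g))
                  (\<lambda>x y. if \<forall>g\<in>G. \<gamma> g = 1 then to_ac d * y ^ q
                          else to_ac (a ^ (m div 2 * (card G div m)) * d) * y ^ q))"
proof -
  interpret A: affine_aut_group c R G \<alpha> \<beta> \<gamma>
    by unfold_locales (use char curve group in \<open>simp_all add: f_def\<close>)
  have Phi_aff: "\<Phi> (aff f x y) = aff f (to_ac a * x ^ q + to_ac b) (to_ac d * y ^ q)"
    "poly f (to_ac a * x ^ q + to_ac b) = (to_ac d * y ^ q) ^ 2" if "y ^ 2 = poly f x" for x y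
    using on_coordsD[OF Phi(2) that] on_coords_equation[OF Phi(1,2) that] by simp_all
  interpret N: normalising_frobenius G "\<lambda>g. to_ac (\<alpha> g)" "\<lambda>g. to_ac (\<beta> g)" "\<lambda>g. to_ac (\<gamma> g)" "to_ac c" R
    "hyp_poly c R" "to_ac a" "to_ac b" "to_ac d" q s
  proof unfold_locales
    show "q = CHAR('k alg_closure) ^ s" using q char by simp
    let ?f = "Polynomial.smult (to_ac c) (\<Prod>r\<in>R. [:- r, 1:])"
    show "poly ?f (to_ac a * x ^ q + to_ac b) = (to_ac d * y ^ q)\<^sup>2" if "y\<^sup>2 = poly ?f x" for x y
      using Phi_aff(2) that unfolding f_def hyp_poly_def .
    fix g assume g: "g \<in> G"
    then have "compose (curve f) \<Phi> g \<in> (\<lambda>g. compose (curve f) g \<Phi>) ` G"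
      using Phi(3) unfolding normalises_def by blast
    then obtain h where h: "h \<in> G" "compose (curve f) \<Phi> g = compose (curve f) h \<Phi>" by blast
    have "to_ac a * A.act g x ^ q + to_ac b = A.act h (to_ac a * x ^ q + to_ac b)" for x
    proof -
      obtain y where y: "y ^ 2 = poly f x" using ex_sqrt by blast
      have "aff f x y \<in> curve f" using y by (simp add: aff_in_curve_iff)
      then have "\<Phi> (g (aff f x y)) = h (\<Phi> (aff f x y))"
        using fun_cong[OF h(2), of "aff f x y"] by (simp add: compose_def)
      note gy = A.G_act[OF g y[unfolded f_def], folded f_def]
      note Py = A.G_act[OF h(1) Phi_aff(2)[OF y, symmetric, unfolded f_def], folded f_def]
      from \<open>\<Phi> (g (aff f x y)) = h (\<Phi> (aff f x y))\<close>
      show ?thesis unfolding gy(2) Phi_aff(1)[OF y] Phi_aff(1)[OF gy(3)] Py(2) aff_eq_iff by blast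
    qed
    then show "\<exists>h\<in>G. \<forall>x. to_ac a * A.act g x ^ q + to_ac b = A.act h (to_ac a * x ^ q + to_ac b)"
      using h(1) by blast
  qed
  have f': "f' = A.f\<^sub>G" by (simp add: f'_def A.f\<^sub>G_eq)
  have cf': "curve_poly f'" unfolding f' by (rule A.curve_poly_f\<^sub>G)
  obtain \<pi> where \<pi>: "quotient_map f G f' \<pi>" "morphism f f' \<pi>"
    "on_coords f f' \<pi> (\<lambda>x y. poly A.I x) (\<lambda>x y. poly A.V x * y)"
    using A.quotient_map_exists unfolding f' f_def by metis
  define D where "D = (if \<forall>g\<in>G. \<gamma> g = 1 then d else a ^ (m div 2 * (card G div m)) * d)"
  have D: "N.d\<^sub>G = to_ac D"
  proof -
    \<comment> \<open>\<open>card G\<close> is \<open>card M * card T\<close>, with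
      \<open>card T\<close> a power of \<open>p\<close> and \<open>card M\<close> prime to
      \<open>p\<close>; so \<open>m = card M\<close>, and the exponents of \<open>a\<close>
      agree.\<close>
    obtain e where e: "card A.T = p ^ e" using A.card_T_power char by auto
    have "\<not> p dvd card A.M" using A.char_not_dvd_card_M char by simp
    then have "m = card A.M"
      unfolding m_def A.card_G e using A.prime_char char A.card_M_pos by (intro prime_to_part_eq) auto
    moreover then have "card G div m = card A.T" using A.card_M_pos by (simp add: A.card_G)
    ultimately show ?thesis unfolding N.d\<^sub>G_def D_def by simp
  qed
  define B where "B = (\<Prod>g\<in>G. \<alpha> g * b + \<beta> g)"
  have B: "poly A.I (to_ac b) = to_ac B" by (simp add: A.poly_I B_def to_ac_prod)
  define PX where "PX = Polynomial.monom (to_ac (a ^ card G)) q + [:to_ac B:]"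
  \<comment> \<open>As \<open>q\<close> is odd, \<open>y^q = f'^((q - 1) / 2) * y\<close> on the
    curve. So \<open>D y^q\<close> has the form \<open>PY(x) y\<close> required by
    \<open>polynomial_morphism\<close>.\<close>
  define PY where "PY = Polynomial.smult (to_ac D) (f' ^ ((q - 1) div 2))"
  have PX: "poly PX x = to_ac (a ^ card G) * x ^ q + to_ac B" for x by (simp add: PX_def poly_monom)
  have half: "z ^ q = z ^ Suc (2 * ((q - 1) div 2))" for z :: "'k alg_closure"
    using N.odd_q by (intro arg_cong[of _ _ "(^) z"]) presburger
  have pow: "z * (z ^ ((q - 1) div 2)) ^ 2 = z ^ q" "(z ^ 2) ^ ((q - 1) div 2) * z = z ^ q"
    for z :: "'k alg_closure"
    unfolding half by (simp_all add: mult.commute flip: power_mult)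
  have "f' \<circ>\<^sub>p PX = f' * PY ^ 2"
  proof (rule poly_eq_cofinite[of "{}"])
    fix x
    have "poly f' (poly PX x) = to_ac D ^ 2 * poly f' x ^ q"
      using N.f\<^sub>G_frob[of x] unfolding PX f' B D by simp
    also have "\<dots> = poly f' x * poly PY x ^ 2"
      unfolding pow(1)[symmetric] by (simp add: PY_def power_mult_distrib)
    finally show "poly (f' \<circ>\<^sub>p PX) x = poly (f' * PY ^ 2) x" by (simp add: poly_pcompose)
  qed simp
  moreover have "kpoly PX"
    unfolding PX_def by (intro kpoly_add kpoly_monom kpoly_pCons kpoly_0 rangeI)
  moreover have "kpoly PY"
    unfolding PY_def using cf' by (intro kpoly_smult kpoly_power rangeI) (simp add: curve_poly_def)
  ultimately obtain \<Psi> where \<Psi>: "morphism f' f' \<Psi>" "on_coords f' f' \<Psi> (\<lambda>x y. poly PX x) (\<lambda>x y. poly PY x * y)"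
    using polynomial_morphism[OF cf', of f' PX PY] cf' unfolding curve_poly_def by metis
  have \<Psi>': "on_coords f' f' \<Psi> (\<lambda>x y. to_ac (a ^ card G) * x ^ q + to_ac B) (\<lambda>x y. to_ac D * y ^ q)"
    unfolding on_coords_def
  proof (intro allI impI)
    fix x y assume y: "y ^ 2 = poly f' x"
    have "poly PY x * y = to_ac D * y ^ q" unfolding PY_def poly_smult poly_power y[symmetric] mult.assoc pow(2) ..
    then show "\<Psi> (aff f' x y) = aff f' (to_ac (a ^ card G) * x ^ q + to_ac B) (to_ac D * y ^ q)"
      using on_coordsD[OF \<Psi>(2) y] PX by simp
  qed
  \<comment> \<open>Both composites are morphisms, so affine points suffice; there the claim is
    \<open>I_frob\<close> in the first coordinate and \<open>V_frob\<close> in the second.\<close>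
  have commute: "\<pi> (\<Phi> P) = \<Psi> (\<pi> P)" if P: "P \<in> curve f" for P
  proof (rule morphism_unique[OF morphism_compose[OF Phi(1) \<pi>(2)] morphism_compose[OF \<pi>(2) \<Psi>(1)] _ _ P])
    show "curve_poly f" unfolding f_def by (rule A.curve_poly_f)
    fix x y assume y: "y ^ 2 = poly f x"
    have "\<pi> (\<Phi> (aff f x y)) = aff f' (to_ac a ^ card G * poly A.I x ^ q + to_ac B)
        (to_ac D * poly A.V x ^ q * y ^ q)"
      unfolding Phi_aff(1)[OF y] on_coordsD[OF \<pi>(3) Phi_aff(2)[OF y, symmetric]] N.I_frob B
      using N.V_frob[of x] D by (simp add: aff_eq_iff mult_ac)
    moreover have "\<Psi> (\<pi> (aff f x y)) = aff f' (to_ac a ^ card G * poly A.I x ^ q + to_ac B)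
        (to_ac D * poly A.V x ^ q * y ^ q)"
      unfolding on_coordsD[OF \<pi>(3) y] on_coordsD[OF \<Psi>' on_coords_equation[OF \<pi>(2,3) y]]
      by (simp add: power_mult_distrib mult.assoc)
    ultimately show "\<pi> (\<Phi> (aff f x y)) = \<Psi> (\<pi> (aff f x y))" by simp
  qed
  have coords: "on_coords f f' \<pi> (\<lambda>x y. inv_I G \<alpha> \<beta> x) (quotient_y f G \<alpha> \<beta> \<gamma>)"
    using \<pi>(3) unfolding f_def A.inv_I_eq A.quotient_y_eq[abs_def] .
  have cond: "(\<lambda>x y. if \<forall>g\<in>G. \<gamma> g = 1 then to_ac d * y ^ q
      else to_ac (a ^ (m div 2 * (card G div m)) * d) * y ^ q) = (\<lambda>x y. to_ac D * y ^ q)"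
  proof (cases "\<forall>g\<in>G. \<gamma> g = 1")
    case True
    show ?thesis unfolding D_def if_P[OF True] ..
  next
    case False
    show ?thesis unfolding D_def if_not_P[OF False] ..
  qed
  show ?thesis
    unfolding cond B_def[symmetric]
  proof (intro exI conjI ballI)
    show "quotient_map f G f' \<pi>" by (rule \<pi>(1))
    show "morphism f' f' \<Psi>" by (rule \<Psi>(1))
  qed (fact commute coords \<Psi>')+
qed

end
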